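(* Let $k$ be a commutative ring and let $\mathcal{C}$ be a Grothendieck $k$-linear category. Let $\mathcal{J}_{\mathcal{C}}$ be the category of small $k$-linear site presentations of $\mathcal{C}$ (LC morphisms from small $k$-linear sites to $\mathcal{C}$ with its canonical topology), and let $G_{\mathcal{C}}:\mathcal{J}_{\mathcal{C}}\to\mathsf{Cat}(k)$ be the functor sending an LC morphism $u_{\mathfrak{a}}:(\mathfrak{a},\mathcal{T}_{\mathfrak{a}})\to\mathcal{C}$ to the category $\mathfrak{a}$ and a morphism $f:u_{\mathfrak{a}}\to u_{\mathfrak{b}}$ to the underlying $k$-linear functor $f:\mathfrak{a}\to\mathfrak{b}$. Then $\mathcal{C}$ is the $k$-linear filtered bicolimit of $G_{\mathcal{C}}$.
   Context: Set theory: we work in Tarski–Grothendieck set theory with a fixed universe $\mathcal{U}$; "small" means $\mathcal{U}$-small, $k$ is a small commutative ring, and large categories are small with respect to a larger universe; $\mathsf{Cat}$ and $\mathsf{Cat}(k)$ (categories, resp. $k$-linear categories) are understood with respect to a large enough universe. A Grothendieck category is a cocomplete abelian category with a generator and exact filtered colimits. Linear sites. Let $\mathfrak{a}$ be a $k$-linear category. A $k$-linear sieve on $A\in\mathfrak{a}$ is a subobject $R$ of $\mathfrak{a}(-,A)$ in the category $\mathsf{Mod}(\mathfrak{a})$ of $k$-linear functors $\mathfrak{a}^{\mathrm{op}}\to\mathsf{Mod}(k)$; the sieve generated by a family $(f_i:A_i\to A)_i$ is the smallest sieve $R$ with $f_i\in R(A_i)$ for all $i$. A $k$-linear cover system gives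 for each $A$ a family $\mathcal{T}(A)$ of sieves on $A$ (covers); a family of morphisms is a covering family if the sieve it generates is a cover. For $g:A'\to A$, $g^{-1}R(A'')=\{f:A''\to A'\mid g f\in R(A'')\}$. A $k$-linear Grothendieck topology is a cover system $\mathcal{T}$ such that: $\mathfrak{a}(-,A)\in\mathcal{T}(A)$ for all $A$; $R\in\mathcal{T}(A)$ and $g:A'\to A$ imply $g^{-1}R\in\mathcal{T}(A')$; and if $R$ is a sieve on $A$ and there is $S\in\mathcal{T}(A)$ with $g^{-1}R\in\mathcal{T}(A')$ for all $g:A'\to A$ in $S$, then $R\in\mathcal{T}(A)$. A $k$-linear site is a $k$-linear category with a $k$-linear Grothendieck topology. The canonical topology on a Grothendieck category $\mathcal{C}$ is the one whose covering families are the jointly epimorphic families. LC morphisms. A $k$-linear functor $f:(\mathfrak{a},\mathcal{T}_{\mathfrak{a}})\to(\mathfrak{c},\mathcal{T}_{\mathfrak{c}})$ ($\mathfrak{a}$ small, $\mathfrak{c}$ possibly large) is an LC morphism if: (G) for every $C\in\mathfrak{c}$ there is a covering family $(f(A_i)\to C)_{i}$ for $\mathcal{T}_{\mathfrak{c}}$; (F) for every $c:f(A)\to f(A')$ in $\mathfrak{c}$ there are a covering family $(a_i:A_i\to A)_i$ for $\mathcal{T}_{\mathfrak{a}}$ and morphisms $f_i:A_i\to A'$ with $c f(a_i)=f(f_i)$ for all $i$; (FF) for every $a:A\to A'$ in $\mathfrak{a}$ with $f(a)=0$ there is a covering family $(a_i:A_i\to A)_i$ for $\mathcal{T}_{\mathfrak{a}}$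 with $a a_i=0$ for all $i$; and $\mathcal{T}_{\mathfrak{a}}=f^{-1}\mathcal{T}_{\mathfrak{c}}$, i.e. a sieve $R$ on $A$ belongs to $\mathcal{T}_{\mathfrak{a}}(A)$ if and only if the family $(f(a))_{a\in R}$ is a covering family of $f(A)$ for $\mathcal{T}_{\mathfrak{c}}$. The category $\mathcal{J}_{\mathcal{C}}$: objects are the LC morphisms $u_{\mathfrak{a}}:(\mathfrak{a},\mathcal{T}_{\mathfrak{a}})\to\mathcal{C}$ with $(\mathfrak{a},\mathcal{T}_{\mathfrak{a}})$ a small $k$-linear site and $\mathcal{C}$ endowed with the canonical topology; morphisms $u_{\mathfrak{a}}\to u_{\mathfrak{b}}$ are the $k$-linear functors $f:\mathfrak{a}\to\mathfrak{b}$ that are LC morphisms and satisfy $u_{\mathfrak{b}}\circ f=u_{\mathfrak{a}}$. This category is filtered. Filtered bicolimit: given a filtered category $\mathcal{I}$ and a pseudofunctor $F:\mathcal{I}\to\mathsf{Cat}$, the filtered bicolimit of $F$ is a category $\mathcal{L}(F)$ with a pseudonatural transformation from $F$ to the constant $2$-functor at $\mathcal{L}(F)$ which, for every category $\mathcal{D}$, induces by composition an equivalence $\mathsf{Cat}(\mathcal{L}(F),\mathcal{D})\cong\mathsf{Psnat}(F,\mathcal{D})$ with the category of pseudonatural transformations from $F$ to the constant $2$-functor at $\mathcal{D}$ (morphisms: modifications). If $F$ takes values in $k$-linear categories and $k$-linear functors, the $k$-linear filtered bicolimit is defined by the same property with $\mathsf{Cat}$ replaced by $\mathsf{Cat}(k)$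 and $\mathsf{Psnat}$ by its $k$-linear analogue; its underlying category is the filtered bicolimit. *)

theory Defs
  imports "HOL-Algebra.Module"
begin

unbundle cardinal_syntax

section \<open>Universes and smallness\<close>

text \<open>
  A Grothendieck universe (with infinite members) enters only through its cardinality, which is
  strongly inaccessible. A subset \<open>X\<close> of a universe \<open>U\<close> is an element of \<open>U\<close> iff \<open>|X| < |U|\<close>;
  so small structures are those whose underlying sets are subsets of \<open>U\<close> of smaller cardinality.
\<close>

definition universe :: "'u set \<Rightarrow> bool" where
  "universe U \<longleftrightarrow>
     natLeq <o |U| \<and> regularCard |U| \<and> (\<forall>X \<subseteq> U. |X| <o |U| \<longrightarrow> |Pow X| <o |U| )"

definition small :: "'u set \<Rightarrow> 'a set \<Rightarrow> bool" where
  "small U X \<longleftrightarrow> |X| <o |U|"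


section \<open>Categories, functors, natural transformations\<close>

record ('o, 'm) cat =
  Ob :: "'o set"
  Ar :: "'m set"
  Src :: "'m \<Rightarrow> 'o"
  Tgt :: "'m \<Rightarrow> 'o"
  Cmp :: "'m \<Rightarrow> 'm \<Rightarrow> 'm" (infixl \<open>\<cdot>\<index>\<close> 70)
  Ide :: "'o \<Rightarrow> 'm"

definition Hom :: "('o, 'm, 'z) cat_scheme \<Rightarrow> 'o \<Rightarrow> 'o \<Rightarrow> 'm set" where
  "Hom C A B = {f \<in> Ar C. Src C f = A \<and> Tgt C f = B}"

definition is_category :: "('o, 'm, 'z) cat_scheme \<Rightarrow> bool" where
  "is_category C \<longleftrightarrow>
     (\<forall>f \<in> Ar C. Src C f \<in> Ob C \<and> Tgt C f \<in> Ob C) \<and>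
     (\<forall>A \<in> Ob C. Ide C A \<in> Hom C A A) \<and>
     (\<forall>f \<in> Ar C. \<forall>g \<in> Ar C. Tgt C f = Src C g \<longrightarrow> g \<cdot>\<^bsub>C\<^esub> f \<in> Hom C (Src C f) (Tgt C g)) \<and>
     (\<forall>f \<in> Ar C. f \<cdot>\<^bsub>C\<^esub> Ide C (Src C f) = f \<and> Ide C (Tgt C f) \<cdot>\<^bsub>C\<^esub> f = f) \<and>
     (\<forall>f \<in> Ar C. \<forall>g \<in> Ar C. \<forall>h \<in> Ar C. Tgt C f = Src C g \<longrightarrow> Tgt C g = Src C h \<longrightarrow>
        (h \<cdot>\<^bsub>C\<^esub> g) \<cdot>\<^bsub>C\<^esub> f = h \<cdot>\<^bsub>C\<^esub> (g \<cdot>\<^bsub>C\<^esub> f))"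

definition small_category :: "'u set \<Rightarrow> ('u, 'u, 'z) cat_scheme \<Rightarrow> bool" where
  "small_category U C \<longleftrightarrow>
     is_category C \<and> Ob C \<subseteq> U \<and> small U (Ob C) \<and> Ar C \<subseteq> U \<and> small U (Ar C)"

definition locally_small :: "'u set \<Rightarrow> ('o, 'm, 'z) cat_scheme \<Rightarrow> bool" where
  "locally_small U C \<longleftrightarrow> (\<forall>A \<in> Ob C. \<forall>B \<in> Ob C. small U (Hom C A B))"

definition is_iso :: "('o, 'm, 'z) cat_scheme \<Rightarrow> 'm \<Rightarrow> bool" where
  "is_iso C f \<longleftrightarrow> f \<in> Ar C \<and>
     (\<exists>g \<in> Hom C (Tgt C f) (Src C f). g \<cdot>\<^bsub>C\<^esub> f = Ide C (Src C f) \<and> f \<cdot>\<^bsub>C\<^esub> g = Ide C (Tgt C f))"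

text \<open>
  The two maps of a functor, and the components of a natural transformation, are extensional
  functions, so that HOL equality is equality of functors and of transformations.
\<close>

record ('o1, 'm1, 'o2, 'm2) func =
  FO :: "'o1 \<Rightarrow> 'o2"
  FA :: "'m1 \<Rightarrow> 'm2"

definition is_functor ::
  "('o1, 'm1, 'y) cat_scheme \<Rightarrow> ('o2, 'm2, 'z) cat_scheme \<Rightarrow> ('o1, 'm1, 'o2, 'm2) func \<Rightarrow> bool" where
  "is_functor X Y F \<longleftrightarrow>
     FO F \<in> Ob X \<rightarrow>\<^sub>E Ob Y \<and> FA F \<in> Ar X \<rightarrow>\<^sub>E Ar Y \<and>
     (\<forall>f \<in> Ar X. FA F f \<in> Hom Y (FO F (Src X f)) (FO F (Tgt X f))) \<and>
     (\<forall>A \<in> Ob X. FA F (Ide X A) = Ide Y (FO F A)) \<and>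
     (\<forall>f \<in> Ar X. \<forall>g \<in> Ar X. Tgt X f = Src X g \<longrightarrow> FA F (g \<cdot>\<^bsub>X\<^esub> f) = FA F g \<cdot>\<^bsub>Y\<^esub> FA F f)"

definition id_func :: "('o, 'm, 'z) cat_scheme \<Rightarrow> ('o, 'm, 'o, 'm) func" where
  "id_func X = \<lparr> FO = (\<lambda>A \<in> Ob X. A), FA = (\<lambda>f \<in> Ar X. f) \<rparr>"

text \<open>\<open>comp_func X G F\<close> is the composite of \<open>F\<close>, with source category \<open>X\<close>, followed by \<open>G\<close>.\<close>

definition comp_func ::
  "('o1, 'm1, 'z) cat_scheme \<Rightarrow> ('o2, 'm2, 'o3, 'm3) func \<Rightarrow> ('o1, 'm1, 'o2, 'm2) func
     \<Rightarrow> ('o1, 'm1, 'o3, 'm3) func" where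
  "comp_func X G F = \<lparr> FO = compose (Ob X) (FO G) (FO F), FA = compose (Ar X) (FA G) (FA F) \<rparr>"

definition nat_trans ::
  "('o1, 'm1, 'y) cat_scheme \<Rightarrow> ('o2, 'm2, 'z) cat_scheme \<Rightarrow>
   ('o1, 'm1, 'o2, 'm2) func \<Rightarrow> ('o1, 'm1, 'o2, 'm2) func \<Rightarrow> ('o1 \<Rightarrow> 'm2) \<Rightarrow> bool" where
  "nat_trans X Y F G \<tau> \<longleftrightarrow>
     \<tau> \<in> extensional (Ob X) \<and>
     (\<forall>A \<in> Ob X. \<tau> A \<in> Hom Y (FO F A) (FO G A)) \<and>
     (\<forall>f \<in> Ar X. FA G f \<cdot>\<^bsub>Y\<^esub> \<tau> (Src X f) = \<tau> (Tgt X f) \<cdot>\<^bsub>Y\<^esub> FA F f)"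

definition nat_iso ::
  "('o1, 'm1, 'y) cat_scheme \<Rightarrow> ('o2, 'm2, 'z) cat_scheme \<Rightarrow>
   ('o1, 'm1, 'o2, 'm2) func \<Rightarrow> ('o1, 'm1, 'o2, 'm2) func \<Rightarrow> ('o1 \<Rightarrow> 'm2) \<Rightarrow> bool" where
  "nat_iso X Y F G \<tau> \<longleftrightarrow> nat_trans X Y F G \<tau> \<and> (\<forall>A \<in> Ob X. is_iso Y (\<tau> A))"

definition is_equivalence ::
  "('o1, 'm1, 'y) cat_scheme \<Rightarrow> ('o2, 'm2, 'z) cat_scheme \<Rightarrow> ('o1, 'm1, 'o2, 'm2) func \<Rightarrow> bool" where
  "is_equivalence X Y F \<longleftrightarrow>
     is_functor X Y F \<and>
     (\<exists>G \<eta> \<epsilon>. is_functor Y X G \<and>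
        nat_iso X X (id_func X) (comp_func X G F) \<eta> \<and>
        nat_iso Y Y (comp_func Y F G) (id_func Y) \<epsilon>)"

definition filtered_category :: "('o, 'm, 'z) cat_scheme \<Rightarrow> bool" where
  "filtered_category I \<longleftrightarrow>
     is_category I \<and> Ob I \<noteq> {} \<and>
     (\<forall>i \<in> Ob I. \<forall>j \<in> Ob I. \<exists>l \<in> Ob I. Hom I i l \<noteq> {} \<and> Hom I j l \<noteq> {}) \<and>
     (\<forall>i \<in> Ob I. \<forall>j \<in> Ob I. \<forall>f \<in> Hom I i j. \<forall>g \<in> Hom I i j.
        \<exists>l \<in> Ob I. \<exists>h \<in> Hom I j l. h \<cdot>\<^bsub>I\<^esub> f = h \<cdot>\<^bsub>I\<^esub> g)"


section \<open>Linear categories\<close>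

record ('o, 'm, 'k) lincat = "('o, 'm) cat" +
  ArAdd :: "'m \<Rightarrow> 'm \<Rightarrow> 'm"
  ArZero :: "'o \<Rightarrow> 'o \<Rightarrow> 'm"
  ArSmult :: "'k \<Rightarrow> 'm \<Rightarrow> 'm"

text \<open>The ring multiplication and unit carried by the module record play no role.\<close>

definition hom_module :: "('o, 'm, 'k) lincat \<Rightarrow> 'o \<Rightarrow> 'o \<Rightarrow> ('k, 'm) module" where
  "hom_module C A B =
     \<lparr> carrier = Hom C A B, mult = undefined, one = undefined,
       zero = ArZero C A B, add = ArAdd C, smult = ArSmult C \<rparr>"

definition lin_category :: "'k ring \<Rightarrow> ('o, 'm, 'k) lincat \<Rightarrow> bool" where
  "lin_category k C \<longleftrightarrow>
     is_category C \<and>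
     (\<forall>A \<in> Ob C. \<forall>B \<in> Ob C. module k (hom_module C A B)) \<and>
     (\<forall>A \<in> Ob C. \<forall>B \<in> Ob C. \<forall>D \<in> Ob C.
        \<forall>f \<in> Hom C A B. \<forall>f' \<in> Hom C A B. \<forall>g \<in> Hom C B D. \<forall>g' \<in> Hom C B D.
          g \<cdot>\<^bsub>C\<^esub> ArAdd C f f' = ArAdd C (g \<cdot>\<^bsub>C\<^esub> f) (g \<cdot>\<^bsub>C\<^esub> f') \<and>
          ArAdd C g g' \<cdot>\<^bsub>C\<^esub> f = ArAdd C (g \<cdot>\<^bsub>C\<^esub> f) (g' \<cdot>\<^bsub>C\<^esub> f)) \<and>
     (\<forall>A \<in> Ob C. \<forall>B \<in> Ob C. \<forall>D \<in> Ob C.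
        \<forall>f \<in> Hom C A B. \<forall>g \<in> Hom C B D. \<forall>r \<in> carrier k.
          g \<cdot>\<^bsub>C\<^esub> ArSmult C r f = ArSmult C r (g \<cdot>\<^bsub>C\<^esub> f) \<and>
          ArSmult C r g \<cdot>\<^bsub>C\<^esub> f = ArSmult C r (g \<cdot>\<^bsub>C\<^esub> f))"

definition lin_functor ::
  "'k ring \<Rightarrow> ('o1, 'm1, 'k) lincat \<Rightarrow> ('o2, 'm2, 'k) lincat \<Rightarrow> ('o1, 'm1, 'o2, 'm2) func \<Rightarrow> bool" where
  "lin_functor k X Y F \<longleftrightarrow>
     is_functor X Y F \<and>
     (\<forall>A \<in> Ob X. \<forall>B \<in> Ob X. \<forall>f \<in> Hom X A B. \<forall>g \<in> Hom X A B.
        FA F (ArAdd X f g) = ArAdd Y (FA F f) (FA F g)) \<and>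
     (\<forall>f \<in> Ar X. \<forall>r \<in> carrier k. FA F (ArSmult X r f) = ArSmult Y r (FA F f))"


section \<open>Grothendieck categories\<close>

definition is_mono :: "('o, 'm, 'z) cat_scheme \<Rightarrow> 'm \<Rightarrow> bool" where
  "is_mono C f \<longleftrightarrow> f \<in> Ar C \<and>
     (\<forall>X \<in> Ob C. \<forall>g \<in> Hom C X (Src C f). \<forall>h \<in> Hom C X (Src C f). f \<cdot>\<^bsub>C\<^esub> g = f \<cdot>\<^bsub>C\<^esub> h \<longrightarrow> g = h)"

definition is_epi :: "('o, 'm, 'z) cat_scheme \<Rightarrow> 'm \<Rightarrow> bool" where
  "is_epi C f \<longleftrightarrow> f \<in> Ar C \<and>
     (\<forall>X \<in> Ob C. \<forall>g \<in> Hom C (Tgt C f) X. \<forall>h \<in> Hom C (Tgt C f) X. g \<cdot>\<^bsub>C\<^esub> f = h \<cdot>\<^bsub>C\<^esub> f \<longrightarrow> g = h)"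

definition is_zero_object :: "('o, 'm, 'z) cat_scheme \<Rightarrow> 'o \<Rightarrow> bool" where
  "is_zero_object C Z \<longleftrightarrow> Z \<in> Ob C \<and>
     (\<forall>A \<in> Ob C. (\<exists>!f. f \<in> Hom C A Z) \<and> (\<exists>!f. f \<in> Hom C Z A))"

definition is_biproduct ::
  "('o, 'm, 'k) lincat \<Rightarrow> 'o \<Rightarrow> 'o \<Rightarrow> 'o \<Rightarrow> 'm \<Rightarrow> 'm \<Rightarrow> 'm \<Rightarrow> 'm \<Rightarrow> bool" where
  "is_biproduct C A B P i1 i2 p1 p2 \<longleftrightarrow>
     P \<in> Ob C \<and> i1 \<in> Hom C A P \<and> i2 \<in> Hom C B P \<and> p1 \<in> Hom C P A \<and> p2 \<in> Hom C P B \<and>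
     p1 \<cdot>\<^bsub>C\<^esub> i1 = Ide C A \<and> p2 \<cdot>\<^bsub>C\<^esub> i2 = Ide C B \<and>
     p1 \<cdot>\<^bsub>C\<^esub> i2 = ArZero C B A \<and> p2 \<cdot>\<^bsub>C\<^esub> i1 = ArZero C A B \<and>
     ArAdd C (i1 \<cdot>\<^bsub>C\<^esub> p1) (i2 \<cdot>\<^bsub>C\<^esub> p2) = Ide C P"

definition is_kernel :: "('o, 'm, 'k) lincat \<Rightarrow> 'm \<Rightarrow> 'm \<Rightarrow> bool" where
  "is_kernel C f i \<longleftrightarrow>
     f \<in> Ar C \<and> i \<in> Ar C \<and> Tgt C i = Src C f \<and> f \<cdot>\<^bsub>C\<^esub> i = ArZero C (Src C i) (Tgt C f) \<and>
     (\<forall>h \<in> Ar C. Tgt C h = Src C f \<longrightarrow> f \<cdot>\<^bsub>C\<^esub> h = ArZero C (Src C h) (Tgt C f) \<longrightarrow>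
        (\<exists>!u. u \<in> Hom C (Src C h) (Src C i) \<and> i \<cdot>\<^bsub>C\<^esub> u = h))"

definition is_cokernel :: "('o, 'm, 'k) lincat \<Rightarrow> 'm \<Rightarrow> 'm \<Rightarrow> bool" where
  "is_cokernel C f p \<longleftrightarrow>
     f \<in> Ar C \<and> p \<in> Ar C \<and> Src C p = Tgt C f \<and> p \<cdot>\<^bsub>C\<^esub> f = ArZero C (Src C f) (Tgt C p) \<and>
     (\<forall>h \<in> Ar C. Src C h = Tgt C f \<longrightarrow> h \<cdot>\<^bsub>C\<^esub> f = ArZero C (Src C f) (Tgt C h) \<longrightarrow>
        (\<exists>!u. u \<in> Hom C (Tgt C p) (Tgt C h) \<and> u \<cdot>\<^bsub>C\<^esub> p = h))"

definition abelian_category :: "'k ring \<Rightarrow> ('o, 'm, 'k) lincat \<Rightarrow> bool" where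
  "abelian_category k C \<longleftrightarrow>
     lin_category k C \<and>
     (\<exists>Z. is_zero_object C Z) \<and>
     (\<forall>A \<in> Ob C. \<forall>B \<in> Ob C. \<exists>P i1 i2 p1 p2. is_biproduct C A B P i1 i2 p1 p2) \<and>
     (\<forall>f \<in> Ar C. \<exists>i. is_kernel C f i) \<and>
     (\<forall>f \<in> Ar C. \<exists>p. is_cokernel C f p) \<and>
     (\<forall>i. is_mono C i \<longrightarrow> (\<exists>f. is_kernel C f i)) \<and>
     (\<forall>p. is_epi C p \<longrightarrow> (\<exists>f. is_cokernel C f p))"

definition is_cocone ::
  "('j, 'a, 'y) cat_scheme \<Rightarrow> ('o, 'm, 'z) cat_scheme \<Rightarrow> ('j, 'a, 'o, 'm) func \<Rightarrow> 'o \<Rightarrow> ('j \<Rightarrow> 'm)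
     \<Rightarrow> bool" where
  "is_cocone J C D L \<iota> \<longleftrightarrow>
     L \<in> Ob C \<and> (\<forall>j \<in> Ob J. \<iota> j \<in> Hom C (FO D j) L) \<and>
     (\<forall>a \<in> Ar J. \<iota> (Tgt J a) \<cdot>\<^bsub>C\<^esub> FA D a = \<iota> (Src J a))"

definition is_colimit ::
  "('j, 'a, 'y) cat_scheme \<Rightarrow> ('o, 'm, 'z) cat_scheme \<Rightarrow> ('j, 'a, 'o, 'm) func \<Rightarrow> 'o \<Rightarrow> ('j \<Rightarrow> 'm)
     \<Rightarrow> bool" where
  "is_colimit J C D L \<iota> \<longleftrightarrow>
     is_cocone J C D L \<iota> \<and>
     (\<forall>M \<kappa>. is_cocone J C D M \<kappa> \<longrightarrow>
        (\<exists>!u. u \<in> Hom C L M \<and> (\<forall>j \<in> Ob J. u \<cdot>\<^bsub>C\<^esub> \<iota> j = \<kappa> j)))"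

definition cocomplete :: "'u set \<Rightarrow> ('o, 'm, 'z) cat_scheme \<Rightarrow> bool" where
  "cocomplete U C \<longleftrightarrow>
     (\<forall>(J :: ('u, 'u) cat) D. small_category U J \<and> is_functor J C D \<longrightarrow>
        (\<exists>L \<iota>. is_colimit J C D L \<iota>))"

definition is_generator :: "('o, 'm, 'z) cat_scheme \<Rightarrow> 'o \<Rightarrow> bool" where
  "is_generator C G \<longleftrightarrow> G \<in> Ob C \<and>
     (\<forall>A \<in> Ob C. \<forall>B \<in> Ob C. \<forall>f \<in> Hom C A B. \<forall>g \<in> Hom C A B.
        (\<forall>h \<in> Hom C G A. f \<cdot>\<^bsub>C\<^esub> h = g \<cdot>\<^bsub>C\<^esub> h) \<longrightarrow> f = g)"

definition short_exact :: "('o, 'm, 'k) lincat \<Rightarrow> 'm \<Rightarrow> 'm \<Rightarrow> bool" where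
  "short_exact C f g \<longleftrightarrow> is_kernel C g f \<and> is_cokernel C f g"

text \<open>
  Exactness of the functor \<open>colim\<close> on diagrams of small filtered shape \<open>J\<close>: short exact sequences
  of diagrams (which are the pointwise ones) go to short exact sequences.
\<close>

definition exact_filtered_colimits :: "'u set \<Rightarrow> ('o, 'm, 'k) lincat \<Rightarrow> bool" where
  "exact_filtered_colimits U C \<longleftrightarrow>
     (\<forall>(J :: ('u, 'u) cat) D1 D2 D3 \<alpha> \<beta> L1 L2 L3 \<iota>1 \<iota>2 \<iota>3 a b.
        small_category U J \<and> filtered_category J \<and>
        is_functor J C D1 \<and> is_functor J C D2 \<and> is_functor J C D3 \<and>
        nat_trans J C D1 D2 \<alpha> \<and> nat_trans J C D2 D3 \<beta> \<and>
        (\<forall>j \<in> Ob J. short_exact C (\<alpha> j) (\<beta> j)) \<and>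
        is_colimit J C D1 L1 \<iota>1 \<and> is_colimit J C D2 L2 \<iota>2 \<and> is_colimit J C D3 L3 \<iota>3 \<and>
        a \<in> Hom C L1 L2 \<and> (\<forall>j \<in> Ob J. a \<cdot>\<^bsub>C\<^esub> \<iota>1 j = \<iota>2 j \<cdot>\<^bsub>C\<^esub> \<alpha> j) \<and>
        b \<in> Hom C L2 L3 \<and> (\<forall>j \<in> Ob J. b \<cdot>\<^bsub>C\<^esub> \<iota>2 j = \<iota>3 j \<cdot>\<^bsub>C\<^esub> \<beta> j)
        \<longrightarrow> short_exact C a b)"

text \<open>
  As usual a category relative to a universe has small hom-sets; the collection of objects is not
  restricted.
\<close>

definition grothendieck_category :: "'u set \<Rightarrow> 'k ring \<Rightarrow> ('o, 'm, 'k) lincat \<Rightarrow> bool" where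
  "grothendieck_category U k C \<longleftrightarrow>
     abelian_category k C \<and> locally_small U C \<and> cocomplete U C \<and>
     (\<exists>G. is_generator C G) \<and> exact_filtered_colimits U C"


section \<open>Linear sites and LC morphisms\<close>

text \<open>
  Families of morphisms into an object, and in particular sieves, are sets of arrows; the value
  of a sieve \<open>R\<close> at \<open>B\<close> is \<open>R \<inter> Hom C B A\<close>.
\<close>

definition arrows_to :: "('o, 'm, 'z) cat_scheme \<Rightarrow> 'o \<Rightarrow> 'm set" where
  "arrows_to C A = {f \<in> Ar C. Tgt C f = A}"

definition lin_sieve :: "'k ring \<Rightarrow> ('o, 'm, 'k) lincat \<Rightarrow> 'o \<Rightarrow> 'm set \<Rightarrow> bool" where
  "lin_sieve k C A R \<longleftrightarrow>
     R \<subseteq> arrows_to C A \<and>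
     (\<forall>B \<in> Ob C. submodule (R \<inter> Hom C B A) k (hom_module C B A)) \<and>
     (\<forall>f \<in> R. \<forall>g \<in> arrows_to C (Src C f). f \<cdot>\<^bsub>C\<^esub> g \<in> R)"

definition generated_sieve :: "'k ring \<Rightarrow> ('o, 'm, 'k) lincat \<Rightarrow> 'o \<Rightarrow> 'm set \<Rightarrow> 'm set" where
  "generated_sieve k C A P = \<Inter> {R. lin_sieve k C A R \<and> P \<subseteq> R}"

definition pullback_sieve :: "('o, 'm, 'z) cat_scheme \<Rightarrow> 'm \<Rightarrow> 'm set \<Rightarrow> 'm set" where
  "pullback_sieve C g R = {f \<in> arrows_to C (Src C g). g \<cdot>\<^bsub>C\<^esub> f \<in> R}"

type_synonym ('o, 'm) cover_system = "'o \<Rightarrow> 'm set set"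

definition covering_family ::
  "'k ring \<Rightarrow> ('o, 'm, 'k) lincat \<Rightarrow> ('o, 'm) cover_system \<Rightarrow> 'o \<Rightarrow> 'm set \<Rightarrow> bool" where
  "covering_family k C T A P \<longleftrightarrow> P \<subseteq> arrows_to C A \<and> generated_sieve k C A P \<in> T A"

definition grothendieck_topology ::
  "'k ring \<Rightarrow> ('o, 'm, 'k) lincat \<Rightarrow> ('o, 'm) cover_system \<Rightarrow> bool" where
  "grothendieck_topology k C T \<longleftrightarrow>
     T \<in> (\<Pi>\<^sub>E A \<in> Ob C. {\<R>. \<R> \<subseteq> {R. lin_sieve k C A R}}) \<and>
     (\<forall>A \<in> Ob C. arrows_to C A \<in> T A) \<and>
     (\<forall>A \<in> Ob C. \<forall>R \<in> T A. \<forall>g \<in> arrows_to C A. pullback_sieve C g R \<in> T (Src C g)) \<and>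
     (\<forall>A \<in> Ob C. \<forall>R. \<forall>S \<in> T A. lin_sieve k C A R \<longrightarrow>
        (\<forall>g \<in> S. pullback_sieve C g R \<in> T (Src C g)) \<longrightarrow> R \<in> T A)"

definition small_lin_site ::
  "'u set \<Rightarrow> 'k ring \<Rightarrow> ('u, 'u, 'k) lincat \<Rightarrow> ('u, 'u) cover_system \<Rightarrow> bool" where
  "small_lin_site U k \<a> T \<longleftrightarrow>
     small_category U \<a> \<and> lin_category k \<a> \<and> grothendieck_topology k \<a> T"

definition jointly_epi :: "('o, 'm, 'z) cat_scheme \<Rightarrow> 'o \<Rightarrow> 'm set \<Rightarrow> bool" where
  "jointly_epi C A P \<longleftrightarrow>
     (\<forall>B \<in> Ob C. \<forall>g \<in> Hom C A B. \<forall>h \<in> Hom C A B. (\<forall>f \<in> P. g \<cdot>\<^bsub>C\<^esub> f = h \<cdot>\<^bsub>C\<^esub> f) \<longrightarrow> g = h)"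

text \<open>
  A family is jointly epimorphic iff the sieve it generates is, so the covering families of this
  cover system are exactly the jointly epimorphic families.
\<close>

definition canonical_topology :: "'k ring \<Rightarrow> ('o, 'm, 'k) lincat \<Rightarrow> ('o, 'm) cover_system" where
  "canonical_topology k C = (\<lambda>A \<in> Ob C. {R. lin_sieve k C A R \<and> jointly_epi C A R})"

definition LC_morphism ::
  "'k ring \<Rightarrow> ('o1, 'm1, 'k) lincat \<Rightarrow> ('o1, 'm1) cover_system \<Rightarrow>
   ('o2, 'm2, 'k) lincat \<Rightarrow> ('o2, 'm2) cover_system \<Rightarrow> ('o1, 'm1, 'o2, 'm2) func \<Rightarrow> bool" where
  "LC_morphism k \<a> Ta \<c> Tc f \<longleftrightarrow>
     lin_functor k \<a> \<c> f \<and>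
     \<comment> \<open>(G)\<close>
     (\<forall>C \<in> Ob \<c>. \<exists>P. covering_family k \<c> Tc C P \<and> (\<forall>p \<in> P. \<exists>A \<in> Ob \<a>. Src \<c> p = FO f A)) \<and>
     \<comment> \<open>(F)\<close>
     (\<forall>A \<in> Ob \<a>. \<forall>A' \<in> Ob \<a>. \<forall>c \<in> Hom \<c> (FO f A) (FO f A').
        \<exists>P. covering_family k \<a> Ta A P \<and>
          (\<forall>p \<in> P. \<exists>h \<in> Hom \<a> (Src \<a> p) A'. c \<cdot>\<^bsub>\<c>\<^esub> FA f p = FA f h)) \<and>
     \<comment> \<open>(FF)\<close>
     (\<forall>A \<in> Ob \<a>. \<forall>A' \<in> Ob \<a>. \<forall>a \<in> Hom \<a> A A'. FA f a = ArZero \<c> (FO f A) (FO f A') \<longrightarrow>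
        (\<exists>P. covering_family k \<a> Ta A P \<and> (\<forall>p \<in> P. a \<cdot>\<^bsub>\<a>\<^esub> p = ArZero \<a> (Src \<a> p) A'))) \<and>
     \<comment> \<open>\<open>Ta\<close> is the inverse image of \<open>Tc\<close>\<close>
     (\<forall>A \<in> Ob \<a>. \<forall>R. lin_sieve k \<a> A R \<longrightarrow>
        (R \<in> Ta A \<longleftrightarrow> covering_family k \<c> Tc (FO f A) (FA f ` R)))"


section \<open>Filtered bicolimits\<close>

text \<open>
  A pseudofunctor \<open>F\<close> from a category \<open>I\<close> to linear categories: \<open>PComp F b a\<close> and \<open>PUnit F i\<close> are
  the families of components of the structure isomorphisms \<open>F(b) F(a) \<Rightarrow> F(b a)\<close> and
  \<open>1 \<Rightarrow> F(1_i)\<close>.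
\<close>

record ('i, 'a, 'o, 'm, 'k) psfunctor =
  PObj :: "'i \<Rightarrow> ('o, 'm, 'k) lincat"
  PArr :: "'a \<Rightarrow> ('o, 'm, 'o, 'm) func"
  PComp :: "'a \<Rightarrow> 'a \<Rightarrow> 'o \<Rightarrow> 'm"
  PUnit :: "'i \<Rightarrow> 'o \<Rightarrow> 'm"

definition lin_pseudofunctor ::
  "'k ring \<Rightarrow> ('i, 'a) cat \<Rightarrow> ('i, 'a, 'o, 'm, 'k) psfunctor \<Rightarrow> bool" where
  "lin_pseudofunctor k I F \<longleftrightarrow>
     is_category I \<and>
     (\<forall>i \<in> Ob I. lin_category k (PObj F i)) \<and>
     (\<forall>a \<in> Ar I. lin_functor k (PObj F (Src I a)) (PObj F (Tgt I a)) (PArr F a)) \<and>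
     (\<forall>a \<in> Ar I. \<forall>b \<in> Ar I. Tgt I a = Src I b \<longrightarrow>
        nat_iso (PObj F (Src I a)) (PObj F (Tgt I b))
          (comp_func (PObj F (Src I a)) (PArr F b) (PArr F a)) (PArr F (b \<cdot>\<^bsub>I\<^esub> a)) (PComp F b a)) \<and>
     (\<forall>i \<in> Ob I.
        nat_iso (PObj F i) (PObj F i) (id_func (PObj F i)) (PArr F (Ide I i)) (PUnit F i)) \<and>
     (\<forall>a \<in> Ar I. \<forall>b \<in> Ar I. \<forall>c \<in> Ar I. Tgt I a = Src I b \<longrightarrow> Tgt I b = Src I c \<longrightarrow>
        (\<forall>x \<in> Ob (PObj F (Src I a)).
           PComp F (c \<cdot>\<^bsub>I\<^esub> b) a x \<cdot>\<^bsub>PObj F (Tgt I c)\<^esub> PComp F c b (FO (PArr F a) x) =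
           PComp F c (b \<cdot>\<^bsub>I\<^esub> a) x \<cdot>\<^bsub>PObj F (Tgt I c)\<^esub> FA (PArr F c) (PComp F b a x))) \<and>
     (\<forall>a \<in> Ar I. \<forall>x \<in> Ob (PObj F (Src I a)).
        PComp F a (Ide I (Src I a)) x \<cdot>\<^bsub>PObj F (Tgt I a)\<^esub> FA (PArr F a) (PUnit F (Src I a) x)
          = Ide (PObj F (Tgt I a)) (FO (PArr F a) x) \<and>
        PComp F (Ide I (Tgt I a)) a x \<cdot>\<^bsub>PObj F (Tgt I a)\<^esub> PUnit F (Tgt I a) (FO (PArr F a) x)
          = Ide (PObj F (Tgt I a)) (FO (PArr F a) x))"

text \<open>
  A linear pseudonatural transformation \<open>s\<close> from \<open>F\<close> to the constant 2-functor at \<open>D\<close>: linear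
  functors \<open>s_i : F(i) \<rightarrow> D\<close> and, for \<open>a : i \<rightarrow> j\<close>, isomorphisms \<open>s_a : s_i \<Rightarrow> s_j F(a)\<close>,
  compatible with composition and identities.
\<close>

record ('i, 'a, 'o, 'm, 'd, 'e) psnat =
  NObj :: "'i \<Rightarrow> ('o, 'm, 'd, 'e) func"
  NArr :: "'a \<Rightarrow> 'o \<Rightarrow> 'e"

definition lin_psnat ::
  "'k ring \<Rightarrow> ('i, 'a) cat \<Rightarrow> ('i, 'a, 'o, 'm, 'k) psfunctor \<Rightarrow> ('d, 'e, 'k) lincat
     \<Rightarrow> ('i, 'a, 'o, 'm, 'd, 'e) psnat \<Rightarrow> bool" where
  "lin_psnat k I F D s \<longleftrightarrow>
     NObj s \<in> extensional (Ob I) \<and> NArr s \<in> extensional (Ar I) \<and>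
     (\<forall>i \<in> Ob I. lin_functor k (PObj F i) D (NObj s i)) \<and>
     (\<forall>a \<in> Ar I. nat_iso (PObj F (Src I a)) D (NObj s (Src I a))
        (comp_func (PObj F (Src I a)) (NObj s (Tgt I a)) (PArr F a)) (NArr s a)) \<and>
     (\<forall>a \<in> Ar I. \<forall>b \<in> Ar I. Tgt I a = Src I b \<longrightarrow>
        (\<forall>x \<in> Ob (PObj F (Src I a)).
           NArr s (b \<cdot>\<^bsub>I\<^esub> a) x =
           FA (NObj s (Tgt I b)) (PComp F b a x) \<cdot>\<^bsub>D\<^esub>
             (NArr s b (FO (PArr F a) x) \<cdot>\<^bsub>D\<^esub> NArr s a x))) \<and>
     (\<forall>i \<in> Ob I. \<forall>x \<in> Ob (PObj F i). NArr s (Ide I i) x = FA (NObj s i) (PUnit F i x))"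

definition modification ::
  "('i, 'a) cat \<Rightarrow> ('i, 'a, 'o, 'm, 'k) psfunctor \<Rightarrow> ('d, 'e, 'k) lincat
     \<Rightarrow> ('i, 'a, 'o, 'm, 'd, 'e) psnat \<Rightarrow> ('i, 'a, 'o, 'm, 'd, 'e) psnat
     \<Rightarrow> ('i \<Rightarrow> 'o \<Rightarrow> 'e) \<Rightarrow> bool" where
  "modification I F D s t \<mu> \<longleftrightarrow>
     \<mu> \<in> extensional (Ob I) \<and>
     (\<forall>i \<in> Ob I. nat_trans (PObj F i) D (NObj s i) (NObj t i) (\<mu> i)) \<and>
     (\<forall>a \<in> Ar I. \<forall>x \<in> Ob (PObj F (Src I a)).
        NArr t a x \<cdot>\<^bsub>D\<^esub> \<mu> (Src I a) x = \<mu> (Tgt I a) (FO (PArr F a) x) \<cdot>\<^bsub>D\<^esub> NArr s a x)"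

definition psnat_cat ::
  "'k ring \<Rightarrow> ('i, 'a) cat \<Rightarrow> ('i, 'a, 'o, 'm, 'k) psfunctor \<Rightarrow> ('d, 'e, 'k) lincat
     \<Rightarrow> (('i, 'a, 'o, 'm, 'd, 'e) psnat,
         ('i, 'a, 'o, 'm, 'd, 'e) psnat \<times> ('i \<Rightarrow> 'o \<Rightarrow> 'e) \<times> ('i, 'a, 'o, 'm, 'd, 'e) psnat) cat" where
  "psnat_cat k I F D =
     \<lparr> Ob = {s. lin_psnat k I F D s},
       Ar = {(s, \<mu>, t). lin_psnat k I F D s \<and> lin_psnat k I F D t \<and> modification I F D s t \<mu>},
       Src = (\<lambda>(s, \<mu>, t). s),
       Tgt = (\<lambda>(s, \<mu>, t). t),
       Cmp = (\<lambda>(s', \<nu>, t') (s, \<mu>, t).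
                (s, (\<lambda>i \<in> Ob I. \<lambda>x \<in> Ob (PObj F i). \<nu> i x \<cdot>\<^bsub>D\<^esub> \<mu> i x), t')),
       Ide = (\<lambda>s. (s, (\<lambda>i \<in> Ob I. \<lambda>x \<in> Ob (PObj F i). Ide D (FO (NObj s i) x)), s)) \<rparr>"

text \<open>The category \<open>Cat(k)(L, D)\<close> of linear functors and natural transformations.\<close>

definition lin_functor_cat ::
  "'k ring \<Rightarrow> ('o, 'm, 'k) lincat \<Rightarrow> ('d, 'e, 'k) lincat
     \<Rightarrow> (('o, 'm, 'd, 'e) func,
         ('o, 'm, 'd, 'e) func \<times> ('o \<Rightarrow> 'e) \<times> ('o, 'm, 'd, 'e) func) cat" where
  "lin_functor_cat k L D =
     \<lparr> Ob = {H. lin_functor k L D H},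
       Ar = {(H, \<tau>, K). lin_functor k L D H \<and> lin_functor k L D K \<and> nat_trans L D H K \<tau>},
       Src = (\<lambda>(H, \<tau>, K). H),
       Tgt = (\<lambda>(H, \<tau>, K). K),
       Cmp = (\<lambda>(H', \<sigma>, K') (H, \<tau>, K). (H, (\<lambda>x \<in> Ob L. \<sigma> x \<cdot>\<^bsub>D\<^esub> \<tau> x), K')),
       Ide = (\<lambda>H. (H, (\<lambda>x \<in> Ob L. Ide D (FO H x)), H)) \<rparr>"

text \<open>Composition with a pseudonatural transformation \<open>s\<close> from \<open>F\<close> to the constant at \<open>L\<close>.\<close>

definition whisker_psnat ::
  "('i, 'a) cat \<Rightarrow> ('i, 'a, 'o, 'm, 'k) psfunctor \<Rightarrow> ('i, 'a, 'o, 'm, 'l, 'n) psnat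
     \<Rightarrow> ('l, 'n, 'd, 'e) func \<Rightarrow> ('i, 'a, 'o, 'm, 'd, 'e) psnat" where
  "whisker_psnat I F s H =
     \<lparr> NObj = (\<lambda>i \<in> Ob I. comp_func (PObj F i) H (NObj s i)),
       NArr = (\<lambda>a \<in> Ar I. \<lambda>x \<in> Ob (PObj F (Src I a)). FA H (NArr s a x)) \<rparr>"

definition precomp_psnat ::
  "'k ring \<Rightarrow> ('i, 'a) cat \<Rightarrow> ('i, 'a, 'o, 'm, 'k) psfunctor \<Rightarrow> ('l, 'n, 'k) lincat
     \<Rightarrow> ('i, 'a, 'o, 'm, 'l, 'n) psnat \<Rightarrow> ('d, 'e, 'k) lincat
     \<Rightarrow> (('l, 'n, 'd, 'e) func,
         ('l, 'n, 'd, 'e) func \<times> ('l \<Rightarrow> 'e) \<times> ('l, 'n, 'd, 'e) func,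
         ('i, 'a, 'o, 'm, 'd, 'e) psnat,
         ('i, 'a, 'o, 'm, 'd, 'e) psnat \<times> ('i \<Rightarrow> 'o \<Rightarrow> 'e) \<times> ('i, 'a, 'o, 'm, 'd, 'e) psnat) func" where
  "precomp_psnat k I F L s D =
     \<lparr> FO = (\<lambda>H \<in> Ob (lin_functor_cat k L D). whisker_psnat I F s H),
       FA = (\<lambda>(H, \<tau>, K) \<in> Ar (lin_functor_cat k L D).
               (whisker_psnat I F s H,
                (\<lambda>i \<in> Ob I. \<lambda>x \<in> Ob (PObj F i). \<tau> (FO (NObj s i) x)),
                whisker_psnat I F s K)) \<rparr>"

text \<open>
  HOL cannot quantify over types inside a formula, so the types of objects and of arrows of the
  test categories \<open>D\<close> are a parameter, to be left as free type variables.
\<close>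

definition is_lin_filtered_bicolimit ::
  "('d \<times> 'e) itself \<Rightarrow> 'k ring \<Rightarrow> ('i, 'a) cat \<Rightarrow> ('i, 'a, 'o, 'm, 'k) psfunctor
     \<Rightarrow> ('l, 'n, 'k) lincat \<Rightarrow> ('i, 'a, 'o, 'm, 'l, 'n) psnat \<Rightarrow> bool" where
  "is_lin_filtered_bicolimit (_ :: ('d \<times> 'e) itself) k I F L s \<longleftrightarrow>
     filtered_category I \<and> lin_pseudofunctor k I F \<and> lin_category k L \<and> lin_psnat k I F L s \<and>
     (\<forall>D :: ('d, 'e, 'k) lincat. lin_category k D \<longrightarrow>
        is_equivalence (lin_functor_cat k L D) (psnat_cat k I F D) (precomp_psnat k I F L s D))"


section \<open>The category of small site presentations\<close>

text \<open>
  An object is a triple \<open>(\<a>, T, u)\<close> consisting of a small linear site and an LC morphism to \<open>C\<close>.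
  The operations of the record \<open>\<a>\<close> are unconstrained outside its objects and arrows; records that
  differ only there yield isomorphic objects of \<open>site_presentations\<close>.
\<close>

type_synonym ('u, 'o, 'm, 'k) presentation =
  "('u, 'u, 'k) lincat \<times> ('u, 'u) cover_system \<times> ('u, 'u, 'o, 'm) func"

type_synonym ('u, 'o, 'm, 'k) presentation_arrow =
  "('u, 'o, 'm, 'k) presentation \<times> ('u, 'u, 'u, 'u) func \<times> ('u, 'o, 'm, 'k) presentation"

definition is_presentation ::
  "'u set \<Rightarrow> 'k ring \<Rightarrow> ('o, 'm, 'k) lincat \<Rightarrow> ('u, 'o, 'm, 'k) presentation \<Rightarrow> bool" where
  "is_presentation U k C = (\<lambda>(\<a>, T, u).
     small_lin_site U k \<a> T \<and> LC_morphism k \<a> T C (canonical_topology k C) u)"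

definition is_presentation_arrow ::
  "'k ring \<Rightarrow> ('u, 'o, 'm, 'k) presentation \<Rightarrow> ('u, 'u, 'u, 'u) func
     \<Rightarrow> ('u, 'o, 'm, 'k) presentation \<Rightarrow> bool" where
  "is_presentation_arrow k = (\<lambda>(\<a>, Ta, ua) f (\<b>, Tb, ub).
     LC_morphism k \<a> Ta \<b> Tb f \<and> comp_func \<a> ub f = ua)"

definition site_presentations ::
  "'u set \<Rightarrow> 'k ring \<Rightarrow> ('o, 'm, 'k) lincat
     \<Rightarrow> (('u, 'o, 'm, 'k) presentation, ('u, 'o, 'm, 'k) presentation_arrow) cat" where
  "site_presentations U k C =
     \<lparr> Ob = {p. is_presentation U k C p},
       Ar = {(p, f, q). is_presentation U k C p \<and> is_presentation U k C q \<and>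
                        is_presentation_arrow k p f q},
       Src = (\<lambda>(p, f, q). p),
       Tgt = (\<lambda>(p, f, q). q),
       Cmp = (\<lambda>(p', g, q') (p, f, q). (p, comp_func (fst p) g f, q')),
       Ide = (\<lambda>p. (p, id_func (fst p), p)) \<rparr>"

text \<open>A strict functor from \<open>I\<close> to linear categories, as a pseudofunctor with identity 2-cells.\<close>

definition strict_psfunctor ::
  "('i, 'a) cat \<Rightarrow> ('i \<Rightarrow> ('o, 'm, 'k) lincat) \<Rightarrow> ('a \<Rightarrow> ('o, 'm, 'o, 'm) func)
     \<Rightarrow> ('i, 'a, 'o, 'm, 'k) psfunctor" where
  "strict_psfunctor I X \<phi> =
     \<lparr> PObj = X, PArr = \<phi>,
       PComp = (\<lambda>b a. \<lambda>x \<in> Ob (X (Src I a)). Ide (X (Tgt I b)) (FO (\<phi> b) (FO (\<phi> a) x))),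
       PUnit = (\<lambda>i. \<lambda>x \<in> Ob (X i). Ide (X i) x) \<rparr>"

definition presentation_functor ::
  "'u set \<Rightarrow> 'k ring \<Rightarrow> ('o, 'm, 'k) lincat
     \<Rightarrow> (('u, 'o, 'm, 'k) presentation, ('u, 'o, 'm, 'k) presentation_arrow, 'u, 'u, 'k) psfunctor" where
  "presentation_functor U k C =
     strict_psfunctor (site_presentations U k C) (\<lambda>(\<a>, T, u). \<a>) (\<lambda>(p, f, q). f)"

text \<open>
  The functors \<open>u : \<a> \<rightarrow> C\<close> form a strictly natural cocone, since the arrows \<open>f\<close> of
  \<open>site_presentations\<close> commute strictly with them.
\<close>

definition presentation_cocone ::
  "'u set \<Rightarrow> 'k ring \<Rightarrow> ('o, 'm, 'k) lincat
     \<Rightarrow> (('u, 'o, 'm, 'k) presentation, ('u, 'o, 'm, 'k) presentation_arrow, 'u, 'u, 'o, 'm) psnat" where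
  "presentation_cocone U k C =
     \<lparr> NObj = (\<lambda>(\<a>, T, u) \<in> Ob (site_presentations U k C). u),
       NArr = (\<lambda>((\<a>, T, u), f, q) \<in> Ar (site_presentations U k C).
                 \<lambda>x \<in> Ob \<a>. Ide C (FO u x)) \<rparr>"

end

(*
  For a small set S of objects of C containing a locally generating family, the full subcategory on S with the
  jointly epimorphic sieves is a site presentation; exactness of filtered colimits is what makes these sieves
  stable under pullback. A presentation u with values in S has exactly one arrow to this one, namely u itself,
  because the functors commute strictly with the functors to C. Hence these full subcategories are cofinal among
  the presentations, and any finite diagram in C lies in one of them.

  Let s be a pseudonatural transformation to the constant 2-functor at D. An arrow f : u_i x -> u_j y of C lifts
  to a full subcategory n above i and j, and conjugating s_n(f) with the structure isomorphisms of s gives an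
  arrow s_i x -> s_j y. It does not depend on n, is functorial and linear in f, and gives both the functor
  C -> D that corresponds to s and its comparison with s.
*)
theory Submission
  imports Defs
begin

section \<open>Categories and functors\<close>

text \<open>The functor \<open>u\<close> of a presentation is only locally full and locally faithful
  and may identify objects, so an arrow of \<open>C\<close> between values of \<open>u\<close> may
  have no lift to the site, and different points may have the same value. Inclusions of full
  subcategories have none of these defects and reach any prescribed object of \<open>C\<close> on
  the nose; this is why all comparisons are made at such indices. The topology of a presentation is
  the inverse image of the canonical one. Hence the covering conditions on arrows between
  presentations say that explicit families in \<open>C\<close> are jointly epimorphic, and they are
  proved by testing arrows of \<open>C\<close> against successive families. Two constructions have
  to be coded by elements of \<open>U\<close>: the full subcategories, since sites are small, and
  the poset of finite subsets of a sieve, since cocompleteness and exactness concern index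
  categories in \<open>U\<close>. A pseudonatural transformation determines a value at an object of
  \<open>C\<close> only up to isomorphism. A representative of each object is therefore fixed, and
  uniqueness of the induced arrows replaces coherence computations.\<close>

locale category =
  fixes C :: "('o, 'm, 'z) cat_scheme" (structure)
  assumes category: "is_category C"
begin

lemma Src_Ob [simp]: "f \<in> Ar C \<Longrightarrow> Src C f \<in> Ob C"
  and Tgt_Ob [simp]: "f \<in> Ar C \<Longrightarrow> Tgt C f \<in> Ob C"
  and Ide_Hom: "A \<in> Ob C \<Longrightarrow> Ide C A \<in> Hom C A A"
  and Cmp_Hom': "f \<in> Ar C \<Longrightarrow> g \<in> Ar C \<Longrightarrow> Tgt C f = Src C g \<Longrightarrow> g \<cdot> f \<in> Hom C (Src C f) (Tgt C g)"
  and Cmp_Ide [simp]: "f \<in> Ar C \<Longrightarrow> Src C f = A \<Longrightarrow> f \<cdot> Ide C A = f"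
  and Ide_Cmp [simp]: "f \<in> Ar C \<Longrightarrow> Tgt C f = A \<Longrightarrow> Ide C A \<cdot> f = f"
  and Cmp_assoc [simp]: "f \<in> Ar C \<Longrightarrow> g \<in> Ar C \<Longrightarrow> h \<in> Ar C \<Longrightarrow> Tgt C f = Src C g \<Longrightarrow>
    Tgt C g = Src C h \<Longrightarrow> (h \<cdot> g) \<cdot> f = h \<cdot> (g \<cdot> f)"
  using category unfolding is_category_def by blast+

lemma Ide_simps [simp]:
  assumes "A \<in> Ob C"
  shows "Ide C A \<in> Ar C" "Src C (Ide C A) = A" "Tgt C (Ide C A) = A"
  using Ide_Hom[OF assms] by (auto simp: Hom_def)

lemma Cmp_simps [simp]:
  assumes "f \<in> Ar C" "g \<in> Ar C" "Tgt C f = Src C g"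
  shows "g \<cdot> f \<in> Ar C" "Src C (g \<cdot> f) = Src C f" "Tgt C (g \<cdot> f) = Tgt C g"
  using Cmp_Hom'[OF assms] by (auto simp: Hom_def)

lemma Cmp_Hom: "f \<in> Hom C A B \<Longrightarrow> g \<in> Hom C B D \<Longrightarrow> g \<cdot> f \<in> Hom C A D"
  by (simp add: Hom_def)

lemma is_isoI:
  assumes "f \<in> Hom C A B" "g \<in> Hom C B A" "g \<cdot> f = Ide C A" "f \<cdot> g = Ide C B"
  shows "is_iso C f"
  using assms by (auto simp: is_iso_def Hom_def)

lemma is_isoE:
  assumes "is_iso C f" "f \<in> Hom C A B"
  obtains g where "g \<in> Hom C B A" "g \<cdot> f = Ide C A" "f \<cdot> g = Ide C B"
  using assms by (auto simp: is_iso_def Hom_def)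

lemma iso_cancel_left:
  assumes "is_iso C f" "f \<cdot> g = f \<cdot> h" "g \<in> Ar C" "h \<in> Ar C" "Tgt C g = Src C f" "Tgt C h = Src C f"
  shows "g = h"
proof -
  have "f \<in> Ar C" using assms by (simp add: is_iso_def)
  then obtain d where d: "d \<in> Ar C" "Src C d = Tgt C f" "Tgt C d = Src C f" "d \<cdot> f = Ide C (Src C f)"
    using assms(1) by (auto simp: is_iso_def Hom_def)
  have "(d \<cdot> f) \<cdot> g = (d \<cdot> f) \<cdot> h"
    using assms d(1,2) \<open>f \<in> Ar C\<close> by simp
  then show ?thesis using assms d by simp
qed

lemma is_iso_Ide [simp]: "A \<in> Ob C \<Longrightarrow> is_iso C (Ide C A)"
  by (rule is_isoI[where g = "Ide C A"]) (auto simp: Hom_def)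

end

locale functor_between = X: category X + Y: category Y
  for X :: "('o1, 'm1, 'y) cat_scheme" and Y :: "('o2, 'm2, 'z) cat_scheme" +
  fixes F :: "('o1, 'm1, 'o2, 'm2) func"
  assumes is_functor: "is_functor X Y F"
begin

lemma FO_Ob [simp]: "A \<in> Ob X \<Longrightarrow> FO F A \<in> Ob Y"
  and FA_Ide [simp]: "A \<in> Ob X \<Longrightarrow> FA F (Ide X A) = Ide Y (FO F A)"
  and FA_Cmp [simp]: "f \<in> Ar X \<Longrightarrow> g \<in> Ar X \<Longrightarrow> Tgt X f = Src X g \<Longrightarrow>
    FA F (g \<cdot>\<^bsub>X\<^esub> f) = FA F g \<cdot>\<^bsub>Y\<^esub> FA F f"
  and FO_ext: "FO F \<in> extensional (Ob X)"
  and FA_ext: "FA F \<in> extensional (Ar X)"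
  using is_functor unfolding is_functor_def by (auto simp: PiE_iff)

lemma FA_Ar [simp]: "f \<in> Ar X \<Longrightarrow> FA F f \<in> Ar Y"
  and Src_FA [simp]: "f \<in> Ar X \<Longrightarrow> Src Y (FA F f) = FO F (Src X f)"
  and Tgt_FA [simp]: "f \<in> Ar X \<Longrightarrow> Tgt Y (FA F f) = FO F (Tgt X f)"
  using is_functor unfolding is_functor_def by (auto simp: Hom_def)

end

lemma is_functorI:
  assumes "\<And>A. A \<in> Ob X \<Longrightarrow> FO F A \<in> Ob Y" "FO F \<in> extensional (Ob X)" "FA F \<in> extensional (Ar X)"
    and "\<And>f. f \<in> Ar X \<Longrightarrow> FA F f \<in> Hom Y (FO F (Src X f)) (FO F (Tgt X f))"
    and "\<And>A. A \<in> Ob X \<Longrightarrow> FA F (Ide X A) = Ide Y (FO F A)"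
    and "\<And>f g. f \<in> Ar X \<Longrightarrow> g \<in> Ar X \<Longrightarrow> Tgt X f = Src X g \<Longrightarrow>
      FA F (g \<cdot>\<^bsub>X\<^esub> f) = FA F g \<cdot>\<^bsub>Y\<^esub> FA F f"
  shows "is_functor X Y F"
  using assms unfolding is_functor_def by (auto simp: PiE_iff Hom_def)

lemma comp_func_simps [simp]:
  "A \<in> Ob X \<Longrightarrow> FO (comp_func X G F) A = FO G (FO F A)"
  "f \<in> Ar X \<Longrightarrow> FA (comp_func X G F) f = FA G (FA F f)"
  by (simp_all add: comp_func_def compose_def)

lemma id_func_simps [simp]:
  "A \<in> Ob X \<Longrightarrow> FO (id_func X) A = A"
  "f \<in> Ar X \<Longrightarrow> FA (id_func X) f = f"
  by (simp_all add: id_func_def)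

lemma func_eqI:
  fixes F G :: "('o1, 'm1, 'o2, 'm2) func"
  assumes "FO F \<in> extensional A" "FO G \<in> extensional A" "FA F \<in> extensional B" "FA G \<in> extensional B"
    "\<And>x. x \<in> A \<Longrightarrow> FO F x = FO G x" "\<And>f. f \<in> B \<Longrightarrow> FA F f = FA G f"
  shows "F = G"
proof -
  have "FO F = FO G" "FA F = FA G"
    using assms by (auto intro: extensionalityI)
  then show ?thesis by (cases F, cases G) simp
qed

lemma comp_func_ext [simp]:
  "FO (comp_func X G F) \<in> extensional (Ob X)" "FA (comp_func X G F) \<in> extensional (Ar X)"
  by (simp_all add: comp_func_def compose_def)

lemma id_func_ext [simp]:
  "FO (id_func X) \<in> extensional (Ob X)" "FA (id_func X) \<in> extensional (Ar X)"
  by (simp_all add: id_func_def)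

lemma is_functor_comp:
  assumes "functor_between X Y F" "functor_between Y Z G"
  shows "functor_between X Z (comp_func X G F)"
proof -
  interpret F: functor_between X Y F by fact
  interpret G: functor_between Y Z G by fact
  show ?thesis by unfold_locales (auto intro!: is_functorI simp: Hom_def)
qed

lemma is_functor_id:
  assumes "category X"
  shows "functor_between X X (id_func X)"
proof -
  interpret category X by fact
  show ?thesis by unfold_locales (auto intro!: is_functorI simp: Hom_def)
qed

lemma comp_func_assoc:
  assumes "functor_between W X F" "functor_between X Y G"
  shows "comp_func W H (comp_func W G F) = comp_func W (comp_func X H G) F"
proof -
  interpret F: functor_between W X F by fact
  show ?thesis by (rule func_eqI[where A = "Ob W" and B = "Ar W"]) auto
qed

lemma comp_func_id:
  assumes "functor_between X Y F"
  shows "comp_func X F (id_func X) = F" "comp_func X (id_func Y) F = F"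
proof -
  interpret F: functor_between X Y F by fact
  show "comp_func X F (id_func X) = F" "comp_func X (id_func Y) F = F"
    by (rule func_eqI[where A = "Ob X" and B = "Ar X"]; simp add: F.FO_ext F.FA_ext)+
qed

text \<open>A quasi-inverse is chosen: \<open>go B\<close> is a preimage of \<open>B\<close> up to
  the isomorphism \<open>e B\<close> with inverse \<open>d B\<close>, and an arrow is conjugated by
  these and lifted by fullness. Each identity needed in \<open>X\<close> follows by faithfulness,
  because in \<open>Y\<close> it is a cancellation of \<open>d\<close> against
  \<open>e\<close>.\<close>

lemma equivalenceI:
  assumes "functor_between X Y F"
    and full: "\<And>A B g. A \<in> Ob X \<Longrightarrow> B \<in> Ob X \<Longrightarrow> g \<in> Hom Y (FO F A) (FO F B) \<Longrightarrow>
      \<exists>f \<in> Hom X A B. FA F f = g"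
    and faithful: "\<And>f g. f \<in> Ar X \<Longrightarrow> g \<in> Ar X \<Longrightarrow> Src X f = Src X g \<Longrightarrow> Tgt X f = Tgt X g \<Longrightarrow>
      FA F f = FA F g \<Longrightarrow> f = g"
    and surj: "\<And>B. B \<in> Ob Y \<Longrightarrow> \<exists>A \<in> Ob X. \<exists>e \<in> Hom Y (FO F A) B. is_iso Y e"
  shows "is_equivalence X Y F"
proof -
  interpret F: functor_between X Y F by fact
  have "\<forall>B. \<exists>A e d. B \<in> Ob Y \<longrightarrow> A \<in> Ob X \<and> e \<in> Hom Y (FO F A) B \<and> d \<in> Hom Y B (FO F A) \<and>
      d \<cdot>\<^bsub>Y\<^esub> e = Ide Y (FO F A) \<and> e \<cdot>\<^bsub>Y\<^esub> d = Ide Y B"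
    using surj F.Y.is_isoE by metis
  then obtain go e d where go: "B \<in> Ob Y \<Longrightarrow> go B \<in> Ob X \<and> e B \<in> Hom Y (FO F (go B)) B \<and>
      d B \<in> Hom Y B (FO F (go B)) \<and> d B \<cdot>\<^bsub>Y\<^esub> e B = Ide Y (FO F (go B)) \<and> e B \<cdot>\<^bsub>Y\<^esub> d B = Ide Y B" for B
    by metis
  have go_simps [simp]: "go B \<in> Ob X" "e B \<in> Ar Y" "d B \<in> Ar Y" "Src Y (e B) = FO F (go B)"
    "Tgt Y (e B) = B" "Src Y (d B) = B" "Tgt Y (d B) = FO F (go B)"
    "d B \<cdot>\<^bsub>Y\<^esub> e B = Ide Y (FO F (go B))" "e B \<cdot>\<^bsub>Y\<^esub> d B = Ide Y B" if "B \<in> Ob Y" for B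
    using go[OF that] by (auto simp: Hom_def)
  have de [simp]: "d B \<cdot>\<^bsub>Y\<^esub> (e B \<cdot>\<^bsub>Y\<^esub> g) = g" if "B \<in> Ob Y" "g \<in> Ar Y" "Tgt Y g = FO F (go B)" for g B
    using that by (simp flip: F.Y.Cmp_assoc)
  have ed [simp]: "e B \<cdot>\<^bsub>Y\<^esub> (d B \<cdot>\<^bsub>Y\<^esub> g) = g" if "B \<in> Ob Y" "g \<in> Ar Y" "Tgt Y g = B" for g B
    using that by (simp flip: F.Y.Cmp_assoc)
  have "\<forall>A B g. \<exists>f. A \<in> Ob X \<longrightarrow> B \<in> Ob X \<longrightarrow> g \<in> Hom Y (FO F A) (FO F B) \<longrightarrow>
      f \<in> Hom X A B \<and> FA F f = g"
    using full by meson
  then obtain fu where fu: "A \<in> Ob X \<Longrightarrow> B \<in> Ob X \<Longrightarrow> g \<in> Hom Y (FO F A) (FO F B) \<Longrightarrow>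
      fu A B g \<in> Hom X A B \<and> FA F (fu A B g) = g" for A B g
    by metis
  define ga where "ga g = fu (go (Src Y g)) (go (Tgt Y g)) (d (Tgt Y g) \<cdot>\<^bsub>Y\<^esub> (g \<cdot>\<^bsub>Y\<^esub> e (Src Y g)))" for g
  have ga [simp]: "ga g \<in> Ar X" "Src X (ga g) = go (Src Y g)" "Tgt X (ga g) = go (Tgt Y g)"
    "FA F (ga g) = d (Tgt Y g) \<cdot>\<^bsub>Y\<^esub> (g \<cdot>\<^bsub>Y\<^esub> e (Src Y g))" if "g \<in> Ar Y" for g
    using fu[of "go (Src Y g)" "go (Tgt Y g)" "d (Tgt Y g) \<cdot>\<^bsub>Y\<^esub> (g \<cdot>\<^bsub>Y\<^esub> e (Src Y g))"] that
    by (auto simp: ga_def Hom_def)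
  define G where "G = \<lparr>FO = restrict go (Ob Y), FA = restrict ga (Ar Y)\<rparr>"
  have G [simp]: "B \<in> Ob Y \<Longrightarrow> FO G B = go B" "g \<in> Ar Y \<Longrightarrow> FA G g = ga g" for B g
    by (simp_all add: G_def)
  have "is_functor Y X G"
  proof (rule is_functorI)
    show "FO G \<in> extensional (Ob Y)" "FA G \<in> extensional (Ar Y)" by (simp_all add: G_def)
  qed (auto simp: Hom_def intro!: faithful)
  define \<eta> where "\<eta> = (\<lambda>A \<in> Ob X. fu A (go (FO F A)) (d (FO F A)))"
  have \<eta> [simp]: "\<eta> A \<in> Ar X" "Src X (\<eta> A) = A" "Tgt X (\<eta> A) = go (FO F A)" "FA F (\<eta> A) = d (FO F A)"
    if "A \<in> Ob X" for A
    using fu[of A "go (FO F A)" "d (FO F A)"] that by (auto simp: Hom_def \<eta>_def)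
  \<comment> \<open>A lift of \<open>e (FO F A)\<close> is inverse to \<open>\<eta> A\<close>, again
    by faithfulness.\<close>
  have iso: "is_iso X (\<eta> A)" if A: "A \<in> Ob X" for A
  proof -
    obtain g where g: "g \<in> Hom X (go (FO F A)) A" "FA F g = e (FO F A)"
      using full[of "go (FO F A)" A "e (FO F A)"] A by (auto simp: Hom_def)
    show ?thesis
      by (rule F.X.is_isoI[OF _ g(1)]; (rule faithful)?) (use A g in \<open>auto simp: Hom_def\<close>)
  qed
  have "nat_iso X X (id_func X) (comp_func X G F) \<eta>"
    unfolding nat_iso_def nat_trans_def
  proof (intro conjI ballI iso)
    show "\<eta> \<in> extensional (Ob X)" by (simp add: \<eta>_def)
  qed (auto simp: Hom_def intro!: faithful)
  moreover have "nat_iso Y Y (comp_func Y F G) (id_func Y) (restrict e (Ob Y))"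
    unfolding nat_iso_def nat_trans_def
  proof (intro conjI ballI)
    show "is_iso Y (restrict e (Ob Y) B)" if "B \<in> Ob Y" for B
      using that by (auto simp: Hom_def intro!: F.Y.is_isoI[where g = "d B"])
  qed (auto simp: Hom_def)
  ultimately show ?thesis
    unfolding is_equivalence_def using \<open>is_functor Y X G\<close> F.is_functor by blast
qed

section \<open>Linear categories and sieves\<close>

locale linear_category = category C for C :: "('o, 'm, 'k) lincat" (structure) +
  fixes k :: "'k ring"
  assumes linear: "lin_category k C"
begin

abbreviation plus_Ar :: "'m \<Rightarrow> 'm \<Rightarrow> 'm" (infixl \<open>\<^bold>+\<close> 65) where
  "plus_Ar \<equiv> ArAdd C"

lemma hom_module: "A \<in> Ob C \<Longrightarrow> B \<in> Ob C \<Longrightarrow> module k (hom_module C A B)"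
  using linear by (auto simp: lin_category_def)

text \<open>Written as multiplication by -1, so that compatibility with composition is a case of the
  law for scalars.\<close>

definition neg :: "'m \<Rightarrow> 'm" where
  "neg f = ArSmult C (\<ominus>\<^bsub>k\<^esub> \<one>\<^bsub>k\<^esub>) f"

lemma hom_module_facts:
  assumes "A \<in> Ob C" "B \<in> Ob C"
  shows zero_Hom: "ArZero C A B \<in> Hom C A B"
    and add_Hom: "\<And>f g. f \<in> Hom C A B \<Longrightarrow> g \<in> Hom C A B \<Longrightarrow> f \<^bold>+ g \<in> Hom C A B"
    and smult_Hom: "\<And>f r. f \<in> Hom C A B \<Longrightarrow> r \<in> carrier k \<Longrightarrow> ArSmult C r f \<in> Hom C A B"
    and neg_Hom: "\<And>f. f \<in> Hom C A B \<Longrightarrow> neg f \<in> Hom C A B"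
    and add_zero': "\<And>f. f \<in> Hom C A B \<Longrightarrow> f \<^bold>+ ArZero C A B = f"
    and zero_add': "\<And>f. f \<in> Hom C A B \<Longrightarrow> ArZero C A B \<^bold>+ f = f"
    and add_neg': "\<And>f. f \<in> Hom C A B \<Longrightarrow> f \<^bold>+ neg f = ArZero C A B"
    and add_assoc': "\<And>f g h. f \<in> Hom C A B \<Longrightarrow> g \<in> Hom C A B \<Longrightarrow> h \<in> Hom C A B \<Longrightarrow>
          (f \<^bold>+ g) \<^bold>+ h = f \<^bold>+ (g \<^bold>+ h)"
    and add_comm': "\<And>f g. f \<in> Hom C A B \<Longrightarrow> g \<in> Hom C A B \<Longrightarrow> f \<^bold>+ g = g \<^bold>+ f"
    and add_idem': "\<And>f. f \<in> Hom C A B \<Longrightarrow> f \<^bold>+ f = f \<Longrightarrow> f = ArZero C A B"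
proof -
  interpret M: module k "hom_module C A B" using assms by (rule hom_module)
  have [simp]: "carrier (hom_module C A B) = Hom C A B" "zero (hom_module C A B) = ArZero C A B"
    "add (hom_module C A B) = ArAdd C" "smult (hom_module C A B) = ArSmult C"
    by (simp_all add: hom_module_def)
  show "ArZero C A B \<in> Hom C A B" using M.zero_closed by simp
  show "f \<^bold>+ g \<in> Hom C A B" if "f \<in> Hom C A B" "g \<in> Hom C A B" for f g
    using M.add.m_closed[of f g] that by simp
  show sm: "ArSmult C r f \<in> Hom C A B" if "f \<in> Hom C A B" "r \<in> carrier k" for f r
    using M.smult_closed[of r f] that by simp
  then show "neg f \<in> Hom C A B" if "f \<in> Hom C A B" for f
    using that by (simp add: neg_def)
  show "f \<^bold>+ ArZero C A B = f" "ArZero C A B \<^bold>+ f = f" if "f \<in> Hom C A B" for f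
    using M.add.r_one[of f] M.add.l_one[of f] that by simp_all
  show "f \<^bold>+ neg f = ArZero C A B" if "f \<in> Hom C A B" for f
    using M.smult_l_minus[of "\<one>\<^bsub>k\<^esub>" f] M.r_neg[of f] M.smult_one[of f] that
    by (simp add: neg_def)
  show "(f \<^bold>+ g) \<^bold>+ h = f \<^bold>+ (g \<^bold>+ h)" if "f \<in> Hom C A B" "g \<in> Hom C A B" "h \<in> Hom C A B" for f g h
    using M.add.m_assoc[of f g h] that by simp
  show "f \<^bold>+ g = g \<^bold>+ f" if "f \<in> Hom C A B" "g \<in> Hom C A B" for f g
    using M.add.m_comm[of f g] that by simp
  show "f = ArZero C A B" if "f \<in> Hom C A B" "f \<^bold>+ f = f" for f
    using M.add.l_cancel_one[of f f] that by simp
qed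

lemma zero_simps [simp]:
  assumes "A \<in> Ob C" "B \<in> Ob C"
  shows "ArZero C A B \<in> Ar C" "Src C (ArZero C A B) = A" "Tgt C (ArZero C A B) = B"
  using zero_Hom[OF assms] by (auto simp: Hom_def)

lemma add_simps [simp]:
  assumes "f \<in> Ar C" "g \<in> Ar C" "Src C f = Src C g" "Tgt C f = Tgt C g"
  shows "f \<^bold>+ g \<in> Ar C" "Src C (f \<^bold>+ g) = Src C g" "Tgt C (f \<^bold>+ g) = Tgt C g"
  using add_Hom[of "Src C g" "Tgt C g" f g] assms by (auto simp: Hom_def)

lemma smult_simps [simp]:
  assumes "f \<in> Ar C" "r \<in> carrier k"
  shows "ArSmult C r f \<in> Ar C" "Src C (ArSmult C r f) = Src C f" "Tgt C (ArSmult C r f) = Tgt C f"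
  using smult_Hom[of "Src C f" "Tgt C f" f r] assms by (auto simp: Hom_def)

lemma neg_simps [simp]:
  assumes "f \<in> Ar C"
  shows "neg f \<in> Ar C" "Src C (neg f) = Src C f" "Tgt C (neg f) = Tgt C f"
  using neg_Hom[of "Src C f" "Tgt C f" f] assms by (auto simp: Hom_def)

lemma add_zero [simp]: "f \<in> Ar C \<Longrightarrow> Src C f = A \<Longrightarrow> Tgt C f = B \<Longrightarrow> f \<^bold>+ ArZero C A B = f"
  and zero_add [simp]: "f \<in> Ar C \<Longrightarrow> Src C f = A \<Longrightarrow> Tgt C f = B \<Longrightarrow> ArZero C A B \<^bold>+ f = f"
  and add_neg [simp]: "f \<in> Ar C \<Longrightarrow> f \<^bold>+ neg f = ArZero C (Src C f) (Tgt C f)"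
  and add_assoc: "f \<in> Ar C \<Longrightarrow> g \<in> Ar C \<Longrightarrow> h \<in> Ar C \<Longrightarrow> Src C f = Src C g \<Longrightarrow> Tgt C f = Tgt C g
    \<Longrightarrow> Src C g = Src C h \<Longrightarrow> Tgt C g = Tgt C h \<Longrightarrow> (f \<^bold>+ g) \<^bold>+ h = f \<^bold>+ (g \<^bold>+ h)"
  and add_comm: "f \<in> Ar C \<Longrightarrow> g \<in> Ar C \<Longrightarrow> Src C f = Src C g \<Longrightarrow> Tgt C f = Tgt C g
    \<Longrightarrow> f \<^bold>+ g = g \<^bold>+ f"
  and add_idem: "f \<in> Ar C \<Longrightarrow> f \<^bold>+ f = f \<Longrightarrow> f = ArZero C (Src C f) (Tgt C f)"
  by (auto intro!: add_zero' zero_add' add_neg' add_assoc' add_comm' add_idem' simp: Hom_def)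

lemma Cmp_add: "f \<in> Ar C \<Longrightarrow> f' \<in> Ar C \<Longrightarrow> g \<in> Ar C \<Longrightarrow> Src C f = Src C f' \<Longrightarrow> Tgt C f = Src C g \<Longrightarrow>
      Tgt C f' = Src C g \<Longrightarrow> g \<cdot> (f \<^bold>+ f') = (g \<cdot> f) \<^bold>+ (g \<cdot> f')"
  and add_Cmp: "f \<in> Ar C \<Longrightarrow> g \<in> Ar C \<Longrightarrow> g' \<in> Ar C \<Longrightarrow> Tgt C g = Tgt C g' \<Longrightarrow> Tgt C f = Src C g \<Longrightarrow>
      Src C g' = Src C g \<Longrightarrow> (g \<^bold>+ g') \<cdot> f = (g \<cdot> f) \<^bold>+ (g' \<cdot> f)"
  and Cmp_smult: "f \<in> Ar C \<Longrightarrow> g \<in> Ar C \<Longrightarrow> Tgt C f = Src C g \<Longrightarrow> r \<in> carrier k \<Longrightarrow>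
      g \<cdot> ArSmult C r f = ArSmult C r (g \<cdot> f)"
  and smult_Cmp: "f \<in> Ar C \<Longrightarrow> g \<in> Ar C \<Longrightarrow> Tgt C f = Src C g \<Longrightarrow> r \<in> carrier k \<Longrightarrow>
      ArSmult C r g \<cdot> f = ArSmult C r (g \<cdot> f)"
  using linear unfolding lin_category_def Hom_def
  by (smt (verit) Src_Ob Tgt_Ob mem_Collect_eq)+

lemma Cmp_zero [simp]: "g \<in> Ar C \<Longrightarrow> A \<in> Ob C \<Longrightarrow> Src C g = B \<Longrightarrow> g \<cdot> ArZero C A B = ArZero C A (Tgt C g)"
  using add_idem[of "g \<cdot> ArZero C A B"] Cmp_add[of "ArZero C A B" "ArZero C A B" g] by force

lemma zero_Cmp [simp]: "f \<in> Ar C \<Longrightarrow> B \<in> Ob C \<Longrightarrow> Tgt C f = A \<Longrightarrow> ArZero C A B \<cdot> f = ArZero C (Src C f) B"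
  using add_idem[of "ArZero C A B \<cdot> f"] add_Cmp[of f "ArZero C A B" "ArZero C A B"] by force

text \<open>The locale does not state that \<open>k\<close> is a ring; the module structure on a
  hom-set contains this, so an object of \<open>C\<close> has to be at hand.\<close>

lemma cring: "A \<in> Ob C \<Longrightarrow> cring k"
  using hom_module by (auto simp: module_def)

lemma minus_one_closed: "A \<in> Ob C \<Longrightarrow> \<ominus>\<^bsub>k\<^esub> \<one>\<^bsub>k\<^esub> \<in> carrier k"
proof -
  assume "A \<in> Ob C"
  then interpret cring k by (rule cring)
  show ?thesis by simp
qed

lemma Cmp_neg: "f \<in> Ar C \<Longrightarrow> g \<in> Ar C \<Longrightarrow> Tgt C f = Src C g \<Longrightarrow> g \<cdot> neg f = neg (g \<cdot> f)"
  and neg_Cmp: "f \<in> Ar C \<Longrightarrow> g \<in> Ar C \<Longrightarrow> Tgt C f = Src C g \<Longrightarrow> neg g \<cdot> f = neg (g \<cdot> f)"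
  by (simp_all add: neg_def Cmp_smult smult_Cmp minus_one_closed[OF Src_Ob[of f]])

lemma diff_eq_zero_iff:
  assumes "f \<in> Ar C" "g \<in> Ar C" "Src C f = Src C g" "Tgt C f = Tgt C g"
  shows "f \<^bold>+ neg g = ArZero C (Src C g) (Tgt C g) \<longleftrightarrow> f = g"
proof
  assume "f \<^bold>+ neg g = ArZero C (Src C g) (Tgt C g)"
  then have "(f \<^bold>+ neg g) \<^bold>+ g = g" using assms by simp
  moreover have "(f \<^bold>+ neg g) \<^bold>+ g = f \<^bold>+ (g \<^bold>+ neg g)"
    using assms add_comm[of g "neg g"] by (simp add: add_assoc)
  ultimately show "f = g" using assms by simp
qed (use assms in simp)

text \<open>A submodule must also contain negatives; they are obtained as multiples by the scalar
  -1.\<close>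

lemma lin_sieveI:
  assumes "A \<in> Ob C" "\<And>f. f \<in> R \<Longrightarrow> f \<in> Ar C \<and> Tgt C f = A"
    and zero: "\<And>B. B \<in> Ob C \<Longrightarrow> ArZero C B A \<in> R"
    and add: "\<And>f g. f \<in> R \<Longrightarrow> g \<in> R \<Longrightarrow> Src C f = Src C g \<Longrightarrow> f \<^bold>+ g \<in> R"
    and smult: "\<And>f r. f \<in> R \<Longrightarrow> r \<in> carrier k \<Longrightarrow> ArSmult C r f \<in> R"
    and Cmp: "\<And>f g. f \<in> R \<Longrightarrow> g \<in> Ar C \<Longrightarrow> Tgt C g = Src C f \<Longrightarrow> f \<cdot> g \<in> R"
  shows "lin_sieve k C A R"
  unfolding lin_sieve_def
proof (intro conjI ballI)
  show "R \<subseteq> arrows_to C A" using assms by (auto simp: arrows_to_def)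
  show "f \<cdot> g \<in> R" if "f \<in> R" "g \<in> arrows_to C (Src C f)" for f g
    using that Cmp by (auto simp: arrows_to_def)
  fix B assume B: "B \<in> Ob C"
  interpret M: module k "hom_module C B A" using B assms(1) by (rule hom_module)
  have [simp]: "carrier (hom_module C B A) = Hom C B A" "zero (hom_module C B A) = ArZero C B A"
    "add (hom_module C B A) = ArAdd C" "smult (hom_module C B A) = ArSmult C"
    by (simp_all add: hom_module_def)
  have cl: "f \<^bold>+ g \<in> R \<inter> Hom C B A" if "f \<in> R \<inter> Hom C B A" "g \<in> R \<inter> Hom C B A" for f g
    using that add add_Hom[of B A f g] B assms(1) by (auto simp: Hom_def)
  have sm: "ArSmult C r f \<in> R \<inter> Hom C B A" if "f \<in> R \<inter> Hom C B A" "r \<in> carrier k" for f r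
    using that smult smult_Hom[of B A f r] B assms(1) by (auto simp: Hom_def)
  have inv: "\<ominus>\<^bsub>hom_module C B A\<^esub> f \<in> R \<inter> Hom C B A" if "f \<in> R \<inter> Hom C B A" for f
    using M.smult_l_minus[of "\<one>\<^bsub>k\<^esub>" f] M.smult_one[of f] that sm[OF that, of "\<ominus>\<^bsub>k\<^esub> \<one>\<^bsub>k\<^esub>"] by simp
  show "submodule (R \<inter> Hom C B A) k (hom_module C B A)"
  proof (rule M.submoduleI)
    show "R \<inter> Hom C B A \<subseteq> carrier (hom_module C B A)" by simp
    show "\<zero>\<^bsub>hom_module C B A\<^esub> \<in> R \<inter> Hom C B A" using zero B zero_Hom[OF B assms(1)] by simp
  qed (use cl sm inv in simp_all)
qed

lemma
  assumes "lin_sieve k C A R" "A \<in> Ob C"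
  shows lin_sieveD: "\<And>f. f \<in> R \<Longrightarrow> f \<in> Ar C \<and> Tgt C f = A"
    and lin_sieve_zero: "\<And>B. B \<in> Ob C \<Longrightarrow> ArZero C B A \<in> R"
    and lin_sieve_add: "\<And>f g. f \<in> R \<Longrightarrow> g \<in> R \<Longrightarrow> Src C f = Src C g \<Longrightarrow> f \<^bold>+ g \<in> R"
    and lin_sieve_smult: "\<And>f r. f \<in> R \<Longrightarrow> r \<in> carrier k \<Longrightarrow> ArSmult C r f \<in> R"
    and lin_sieve_Cmp: "\<And>f g. f \<in> R \<Longrightarrow> g \<in> Ar C \<Longrightarrow> Tgt C g = Src C f \<Longrightarrow> f \<cdot> g \<in> R"
proof -
  have sub: "submodule (R \<inter> Hom C B A) k (hom_module C B A)" if "B \<in> Ob C" for B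
    using assms that by (auto simp: lin_sieve_def)
  have R: "f \<in> Ar C \<and> Tgt C f = A" if "f \<in> R" for f
    using that assms by (auto simp: lin_sieve_def arrows_to_def)
  show "f \<in> Ar C \<and> Tgt C f = A" if "f \<in> R" for f using R that .
  show "ArZero C B A \<in> R" if "B \<in> Ob C" for B
    using subgroup.one_closed[OF submodule.axioms(1)[OF sub[OF that]]]
    by (simp add: hom_module_def)
  show "f \<^bold>+ g \<in> R" if "f \<in> R" "g \<in> R" "Src C f = Src C g" for f g
    using subgroup.m_closed[OF submodule.axioms(1)[OF sub], of "Src C f" f g] R that
    by (simp add: hom_module_def Hom_def)
  show "ArSmult C r f \<in> R" if "f \<in> R" "r \<in> carrier k" for f r
    using submodule.smult_closed[OF sub, of "Src C f" r f] R that
    by (simp add: hom_module_def Hom_def)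
  show "f \<cdot> g \<in> R" if "f \<in> R" "g \<in> Ar C" "Tgt C g = Src C f" for f g
    using assms that by (auto simp: lin_sieve_def arrows_to_def)
qed

lemma lin_sieve_arrows_to: "A \<in> Ob C \<Longrightarrow> lin_sieve k C A (arrows_to C A)"
  by (rule lin_sieveI) (auto simp: arrows_to_def)

lemma lin_sieve_generated:
  assumes "A \<in> Ob C" "P \<subseteq> arrows_to C A"
  shows "lin_sieve k C A (generated_sieve k C A P)" "P \<subseteq> generated_sieve k C A P"
proof -
  let ?\<S> = "{R. lin_sieve k C A R \<and> P \<subseteq> R}"
  have *: "arrows_to C A \<in> ?\<S>" using lin_sieve_arrows_to assms by simp
  show "P \<subseteq> generated_sieve k C A P" by (auto simp: generated_sieve_def)
  show "lin_sieve k C A (generated_sieve k C A P)"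
    unfolding generated_sieve_def
  proof (rule lin_sieveI[OF assms(1)])
    show "f \<in> Ar C \<and> Tgt C f = A" if "f \<in> \<Inter> ?\<S>" for f
      using that * by (auto simp: arrows_to_def)
  qed (use assms(1) in \<open>auto intro: lin_sieve_zero lin_sieve_add lin_sieve_smult lin_sieve_Cmp\<close>)
qed

lemma generated_sieve_minimal: "lin_sieve k C A R \<Longrightarrow> P \<subseteq> R \<Longrightarrow> generated_sieve k C A P \<subseteq> R"
  by (auto simp: generated_sieve_def)

text \<open>This sieve compares a family with the sieve that it generates: if \<open>g\<close> and
  \<open>h\<close> agree on the family, then by minimality the generated sieve lies in this one, and
  \<open>g\<close> and \<open>h\<close> agree on it too.\<close>

lemma lin_sieve_equalizer:
  assumes "g \<in> Hom C A B" "h \<in> Hom C A B"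
  shows "lin_sieve k C A {f \<in> arrows_to C A. g \<cdot> f = h \<cdot> f}"
proof (rule lin_sieveI)
  show "A \<in> Ob C" using assms by (auto simp: Hom_def)
qed (use assms in \<open>auto simp: arrows_to_def Hom_def Cmp_add Cmp_smult simp flip: Cmp_assoc\<close>)

lemma lin_sieve_pullback:
  assumes "lin_sieve k C A R" "g \<in> Ar C" "Tgt C g = A"
  shows "lin_sieve k C (Src C g) (pullback_sieve C g R)"
proof -
  have A: "A \<in> Ob C" using assms by auto
  note R = lin_sieve_zero[OF assms(1) A] lin_sieve_add[OF assms(1) A] lin_sieve_smult[OF assms(1) A]
    lin_sieve_Cmp[OF assms(1) A]
  show ?thesis
    by (rule lin_sieveI) (use assms R in \<open>auto simp: pullback_sieve_def arrows_to_def Cmp_add Cmp_smult simp flip: Cmp_assoc\<close>)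
qed

section \<open>Jointly epimorphic families and the canonical topology\<close>

lemma jointly_epi_mono: "jointly_epi C A P \<Longrightarrow> P \<subseteq> Q \<Longrightarrow> jointly_epi C A Q"
  by (force simp: jointly_epi_def)

text \<open>Two arrows agree on \<open>P\<close> exactly when their difference kills
  \<open>P\<close>, so in a linear category only arrows that vanish on \<open>P\<close> have to be
  tested.\<close>

lemma jointly_epiI:
  assumes "\<And>B h. h \<in> Hom C A B \<Longrightarrow> (\<And>f. f \<in> P \<Longrightarrow> h \<cdot> f = ArZero C (Src C f) B) \<Longrightarrow> h = ArZero C A B"
    and "P \<subseteq> arrows_to C A"
  shows "jointly_epi C A P"
  unfolding jointly_epi_def
proof (intro ballI impI)
  fix B g h assume gh: "g \<in> Hom C A B" "h \<in> Hom C A B" "\<forall>f \<in> P. g \<cdot> f = h \<cdot> f"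
  have "g \<^bold>+ neg h = ArZero C A B"
  proof (rule assms(1))
    show "g \<^bold>+ neg h \<in> Hom C A B" using gh by (auto simp: Hom_def)
    show "(g \<^bold>+ neg h) \<cdot> f = ArZero C (Src C f) B" if "f \<in> P" for f
      using gh that assms(2) by (auto simp: Hom_def arrows_to_def add_Cmp neg_Cmp)
  qed
  then show "g = h" using gh diff_eq_zero_iff[of g h] by (auto simp: Hom_def)
qed

lemma jointly_epiD:
  assumes "jointly_epi C A P" "P \<subseteq> arrows_to C A" "h \<in> Hom C A B"
    and "\<And>f. f \<in> P \<Longrightarrow> h \<cdot> f = ArZero C (Src C f) B"
  shows "h = ArZero C A B"
proof -
  have "A \<in> Ob C" "B \<in> Ob C" using assms(3) by (auto simp: Hom_def)
  moreover have "h \<cdot> f = ArZero C A B \<cdot> f" if "f \<in> P" for f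
    using assms(2,4) that \<open>B \<in> Ob C\<close> by (auto simp: arrows_to_def)
  ultimately show ?thesis
    using assms(1,3) zero_Hom[of A B] by (auto simp: jointly_epi_def)
qed

text \<open>An arrow that kills \<open>Q\<close> kills every \<open>p \<cdot> r\<close>, hence every
  \<open>p\<close>, hence is zero. This yields the transitivity axiom for the topologies on full
  subcategories.\<close>

lemma jointly_epi_trans:
  assumes "jointly_epi C A P" "P \<subseteq> arrows_to C A" "Q \<subseteq> arrows_to C A"
    and "\<And>p. p \<in> P \<Longrightarrow> \<exists>R \<subseteq> arrows_to C (Src C p). jointly_epi C (Src C p) R \<and> (\<forall>r \<in> R. p \<cdot> r \<in> Q)"
  shows "jointly_epi C A Q"
proof (rule jointly_epiI[OF _ assms(3)])
  fix B h assume h: "h \<in> Hom C A B" "\<And>f. f \<in> Q \<Longrightarrow> h \<cdot> f = ArZero C (Src C f) B"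
  show "h = ArZero C A B"
  proof (rule jointly_epiD[OF assms(1,2) h(1)])
    fix p assume p: "p \<in> P"
    then obtain R where R: "R \<subseteq> arrows_to C (Src C p)" "jointly_epi C (Src C p) R" "\<forall>r \<in> R. p \<cdot> r \<in> Q"
      using assms(4) by blast
    have p': "p \<in> Ar C" "Tgt C p = A" using assms(2) p by (auto simp: arrows_to_def)
    show "h \<cdot> p = ArZero C (Src C p) B"
    proof (rule jointly_epiD[OF R(2,1)])
      show "h \<cdot> p \<in> Hom C (Src C p) B" using h p' by (auto simp: Hom_def)
      show "h \<cdot> p \<cdot> r = ArZero C (Src C r) B" if "r \<in> R" for r
        using h(1) h(2)[of "p \<cdot> r"] R(1,3) that p' by (auto simp: Hom_def arrows_to_def)
    qed
  qed
qed

lemma jointly_epi_generated: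
  assumes "A \<in> Ob C" "P \<subseteq> arrows_to C A"
  shows "jointly_epi C A (generated_sieve k C A P) \<longleftrightarrow> jointly_epi C A P"
proof
  assume *: "jointly_epi C A (generated_sieve k C A P)"
  show "jointly_epi C A P"
    unfolding jointly_epi_def
  proof (intro ballI impI)
    fix B g h assume gh: "g \<in> Hom C A B" "h \<in> Hom C A B" "\<forall>f \<in> P. g \<cdot> f = h \<cdot> f" and B: "B \<in> Ob C"
    then have "generated_sieve k C A P \<subseteq> {f \<in> arrows_to C A. g \<cdot> f = h \<cdot> f}"
      using assms by (intro generated_sieve_minimal lin_sieve_equalizer) auto
    then have "\<forall>f \<in> generated_sieve k C A P. g \<cdot> f = h \<cdot> f" by blast
    then show "g = h" using * gh(1,2) B unfolding jointly_epi_def by blast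
  qed
next
  assume "jointly_epi C A P"
  then show "jointly_epi C A (generated_sieve k C A P)"
    using lin_sieve_generated(2)[OF assms] by (rule jointly_epi_mono)
qed

lemma covering_family_canonical:
  assumes "A \<in> Ob C"
  shows "covering_family k C (canonical_topology k C) A P \<longleftrightarrow> P \<subseteq> arrows_to C A \<and> jointly_epi C A P"
  using jointly_epi_generated[OF assms] lin_sieve_generated(1)[OF assms] assms
  by (auto simp: covering_family_def canonical_topology_def)

lemma jointly_epi_Ide:
  assumes "A \<in> Ob C" "Ide C A \<in> P"
  shows "jointly_epi C A P"
  unfolding jointly_epi_def
proof (intro ballI impI)
  fix B g h assume gh: "g \<in> Hom C A B" "h \<in> Hom C A B" "\<forall>f \<in> P. g \<cdot> f = h \<cdot> f"
  then have "g \<cdot> Ide C A = h \<cdot> Ide C A" using assms by blast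
  then show "g = h" using gh by (simp add: Hom_def)
qed

end

section \<open>Small sets\<close>

lemma small_subset: "small U Y \<Longrightarrow> X \<subseteq> Y \<Longrightarrow> small U X"
  unfolding small_def by (meson card_of_mono1 ordLeq_ordLess_trans)

lemma small_image: "small U X \<Longrightarrow> small U (f ` X)"
  unfolding small_def by (meson card_of_image ordLeq_ordLess_trans)

lemma small_finite:
  assumes "universe U" "finite X"
  shows "small U X"
proof -
  have "|X| <o natLeq"
    using assms(2) finite_iff_ordLess_natLeq by blast
  then show ?thesis
    using assms(1) ordLess_transitive unfolding small_def universe_def by blast
qed

lemma universe_infinite: "universe U \<Longrightarrow> infinite U"
  unfolding universe_def by (meson finite_iff_ordLess_natLeq not_ordLess_ordLeq ordLess_imp_ordLeq)

text \<open>This is where regularity of the cardinal of \<open>U\<close> enters.\<close>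

lemma small_UN:
  assumes "universe U" "small U X" "\<And>x. x \<in> X \<Longrightarrow> small U (F x)"
  shows "small U (\<Union>x \<in> X. F x)"
  unfolding small_def
proof (rule card_of_UNION_ordLess_infinite_Field_regularCard)
  show "Cinfinite |U|" using universe_infinite[OF assms(1)] unfolding cinfinite_def
    by (metis Field_card_of card_of_Card_order)
qed (use assms in \<open>auto simp: universe_def small_def\<close>)

lemma small_Un:
  assumes "universe U" "small U X" "small U Y"
  shows "small U (X \<union> Y)"
  using assms universe_infinite unfolding small_def by (metis card_of_Un_ordLess_infinite)

lemma small_embedding:
  assumes "small U X"
  obtains f where "inj_on f X" "f ` X \<subseteq> U"
proof -
  have "|X| \<le>o |U|" using assms ordLess_imp_ordLeq unfolding small_def by blast
  then show ?thesis using that card_of_ordLeq[of X U] by blast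
qed

text \<open>\<open>universe\<close> bounds the power sets of subsets of \<open>U\<close> only, so
  \<open>X\<close> is first moved into \<open>U\<close>.\<close>

lemma small_Pow:
  assumes "universe U" "small U X"
  shows "small U (Pow X)"
proof -
  obtain f where f: "inj_on f X" "f ` X \<subseteq> U" using small_embedding[OF assms(2)] .
  have "|f ` X| <o |U|" using assms(2) small_image unfolding small_def by blast
  then have "small U (Pow (f ` X))" using assms(1) f unfolding universe_def small_def by blast
  moreover have "Pow X = (\<lambda>Y. inv_into X f ` Y) ` Pow (f ` X)"
  proof (intro equalityI subsetI)
    fix Y assume "Y \<in> Pow X"
    moreover then have "Y = inv_into X f ` f ` Y" using f by (simp add: inv_into_image_cancel)
    ultimately show "Y \<in> (\<lambda>Y. inv_into X f ` Y) ` Pow (f ` X)" by blast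
  qed (auto intro: inv_into_into)
  ultimately show ?thesis using small_image by metis
qed

text \<open>The directed poset of finite subsets of \<open>R\<close>, coded inside \<open>U\<close>
  so that it can serve as the shape of a colimit: \<open>e (F, G)\<close> is the inclusion of
  \<open>F\<close> in \<open>G\<close>, and an object is coded by its own identity
  \<open>e (F, F)\<close>. The map \<open>\<phi>\<close> recovers a subset from its code; the
  properties listed are all that is used later.\<close>

lemma finite_subsets_category:
  fixes U :: "'u set" and R :: "'a set"
  assumes "universe U" "small U R"
  obtains J :: "('u, 'u) cat" and \<phi>
  where "small_category U J" "filtered_category J"
    "\<And>j. j \<in> Ob J \<Longrightarrow> finite (\<phi> j) \<and> \<phi> j \<subseteq> R"
    "\<And>F. finite F \<Longrightarrow> F \<subseteq> R \<Longrightarrow> \<exists>j \<in> Ob J. \<phi> j = F"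
    "\<And>a. a \<in> Ar J \<Longrightarrow> \<phi> (Src J a) \<subseteq> \<phi> (Tgt J a)"
    "\<And>i j. i \<in> Ob J \<Longrightarrow> j \<in> Ob J \<Longrightarrow> \<phi> i \<subseteq> \<phi> j \<Longrightarrow> Hom J i j \<noteq> {}"
proof -
  \<comment> \<open>That there are few pairs of subsets of \<open>R\<close> rests on the strong
    limit property of the cardinal of \<open>U\<close>.\<close>
  define X where "X = {(F, G). finite G \<and> G \<subseteq> R \<and> F \<subseteq> G}"
  have "X \<subseteq> (\<Union>F \<in> Pow R. Pair F ` Pow R)" by (auto simp: X_def)
  moreover have "small U (\<Union>F \<in> Pow R. Pair F ` Pow R)"
    using assms by (intro small_UN small_image small_Pow)
  ultimately have X: "small U X" by (rule small_subset[rotated])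
  then obtain e where e: "inj_on e X" "e ` X \<subseteq> U" using small_embedding by blast
  define d where "d = inv_into X e"
  have d: "d (e p) = p" if "p \<in> X" for p using that e by (simp add: d_def)
  have dG [simp]: "d (e (F, G)) = (F, G)" if "finite G" "G \<subseteq> R" "F \<subseteq> G" for F G
    using that by (intro d) (simp add: X_def)
  define J where "J = \<lparr>Ob = {e (F, F) | F. finite F \<and> F \<subseteq> R}, Ar = e ` X,
    Src = (\<lambda>a. let F = fst (d a) in e (F, F)), Tgt = (\<lambda>a. let F = snd (d a) in e (F, F)),
    Cmp = (\<lambda>b a. e (fst (d a), snd (d b))), Ide = (\<lambda>A. A)\<rparr>"
  have Ob: "Ob J = {e (F, F) | F. finite F \<and> F \<subseteq> R}"
    and Ar: "Ar J = {e (F, G) | F G. finite G \<and> G \<subseteq> R \<and> F \<subseteq> G}"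
    and [simp]: "Src J = (\<lambda>a. let F = fst (d a) in e (F, F))" "Tgt J = (\<lambda>a. let F = snd (d a) in e (F, F))"
    "Cmp J = (\<lambda>b a. e (fst (d a), snd (d b)))" "Ide J = (\<lambda>A. A)"
    by (auto simp: J_def X_def)
  have [simp]: "e (F, F) = e (G, G) \<longleftrightarrow> F = G" if "finite F" "F \<subseteq> R" "finite G" "G \<subseteq> R" for F G
    using that by (metis dG order_refl prod.inject)
  have ObI [simp]: "e (F, F) \<in> Ob J" if "finite F" "F \<subseteq> R" for F
    using that by (auto simp: Ob)
  have sub: "finite F" "F \<subseteq> R" if "F \<subseteq> G" "finite G" "G \<subseteq> R" for F G
    using that finite_subset by auto
  have hom: "e (F, G) \<in> Hom J (e (F, F)) (e (G, G))" if "finite G" "G \<subseteq> R" "F \<subseteq> G" for F G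
    using that unfolding Hom_def by (auto simp: Ar)
  have ex: "\<exists>F. f = e (F, F) \<and> finite F \<and> F \<subseteq> R" if "f \<in> Ob J" for f
    using that by (auto simp: Ob)
  have exA: "\<exists>F G. f = e (F, G) \<and> finite F \<and> F \<subseteq> R \<and> finite G \<and> G \<subseteq> R \<and> F \<subseteq> G" if "f \<in> Ar J" for f
  proof -
    from that obtain F G where "f = e (F, G)" "finite G" "G \<subseteq> R" "F \<subseteq> G" by (auto simp: Ar)
    then show ?thesis using sub[of F G] by blast
  qed
  have hom_unique: "f = g" if "f \<in> Hom J i j" "g \<in> Hom J i j" for f g i j
  proof -
    have "f \<in> Ar J" "g \<in> Ar J" "Src J f = Src J g" "Tgt J f = Tgt J g"
      using that by (auto simp: Hom_def)
    then show ?thesis using exA[of f] exA[of g] by auto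
  qed
  have cat: "is_category J"
    unfolding is_category_def
  proof (intro conjI ballI impI)
    fix f assume f: "f \<in> Ar J"
    then obtain F G where FG: "f = e (F, G)" "finite F" "F \<subseteq> R" "finite G" "G \<subseteq> R" "F \<subseteq> G"
      using exA by blast
    then show "Src J f \<in> Ob J" "Tgt J f \<in> Ob J" "f \<cdot>\<^bsub>J\<^esub> Ide J (Src J f) = f"
      "Ide J (Tgt J f) \<cdot>\<^bsub>J\<^esub> f = f"
      by auto
    fix g assume g: "g \<in> Ar J" and fg: "Tgt J f = Src J g"
    then obtain H K where HK: "g = e (H, K)" "finite H" "H \<subseteq> R" "finite K" "K \<subseteq> R" "H \<subseteq> K"
      using exA by blast
    have H: "H = G" using fg FG HK by simp
    have FK: "F \<subseteq> K" using H FG HK by blast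
    show "g \<cdot>\<^bsub>J\<^esub> f \<in> Hom J (Src J f) (Tgt J g)"
      using hom[OF HK(4,5) FK] FG HK by simp
    fix h assume h: "h \<in> Ar J" "Tgt J g = Src J h"
    then obtain K' L where L: "h = e (K', L)" "finite K'" "K' \<subseteq> R" "finite L" "L \<subseteq> R" "K' \<subseteq> L"
      using exA by blast
    have K: "K' = K" using h HK L by simp
    have FL: "F \<subseteq> L" "H \<subseteq> L" using FK K L HK by blast+
    show "h \<cdot>\<^bsub>J\<^esub> g \<cdot>\<^bsub>J\<^esub> f = h \<cdot>\<^bsub>J\<^esub> (g \<cdot>\<^bsub>J\<^esub> f)"
      using FG HK L FL FK by simp
  next
    fix A assume "A \<in> Ob J"
    then show "Ide J A \<in> Hom J A A" using ex[of A] hom by auto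
  qed
  have up: "\<exists>l \<in> Ob J. Hom J i l \<noteq> {} \<and> Hom J j l \<noteq> {}" if ij: "i \<in> Ob J" "j \<in> Ob J" for i j
  proof -
    obtain F G where FG: "i = e (F, F)" "finite F" "F \<subseteq> R" "j = e (G, G)" "finite G" "G \<subseteq> R"
      using ex[OF ij(1)] ex[OF ij(2)] by blast
    have "e (F \<union> G, F \<union> G) \<in> Ob J" unfolding Ob using FG by blast
    moreover have "e (F, F \<union> G) \<in> Hom J i (e (F \<union> G, F \<union> G))"
      "e (G, F \<union> G) \<in> Hom J j (e (F \<union> G, F \<union> G))"
      unfolding FG using FG by (auto intro!: hom)
    ultimately show ?thesis by blast
  qed
  have filt: "filtered_category J"
    unfolding filtered_category_def
  proof (intro conjI ballI cat up)
    show "Ob J \<noteq> {}" by (auto simp: Ob intro: exI[of _ "{}"])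
    fix i j f g assume "i \<in> Ob J" "j \<in> Ob J" "f \<in> Hom J i j" "g \<in> Hom J i j"
    then have "Ide J j \<in> Hom J j j" "f = g" using hom_unique cat by (auto simp: is_category_def)
    then show "\<exists>l \<in> Ob J. \<exists>h \<in> Hom J j l. h \<cdot>\<^bsub>J\<^esub> f = h \<cdot>\<^bsub>J\<^esub> g"
      using \<open>j \<in> Ob J\<close> by blast
  qed
  have small: "small_category U J"
  proof -
    have "Ob J \<subseteq> Ar J" by (auto simp: Ob Ar)
    moreover have "Ar J \<subseteq> U" "small U (Ar J)" using e(2) small_image[OF X] by (auto simp: J_def)
    ultimately show ?thesis
      using cat small_subset by (auto simp: small_category_def)
  qed
  show ?thesis
  proof (rule that[where \<phi> = "\<lambda>j. fst (d j)", OF small filt])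
    show "finite (fst (d j)) \<and> fst (d j) \<subseteq> R" if "j \<in> Ob J" for j
      using ex[OF that] by auto
    show "\<exists>j \<in> Ob J. fst (d j) = F" if "finite F" "F \<subseteq> R" for F
      by (rule bexI[where x = "e (F, F)"]) (use that in \<open>auto simp: Ob\<close>)
    show "fst (d (Src J a)) \<subseteq> fst (d (Tgt J a))" if "a \<in> Ar J" for a
      using exA[OF that] by auto
    show "Hom J i j \<noteq> {}" if ij: "i \<in> Ob J" "j \<in> Ob J" "fst (d i) \<subseteq> fst (d j)" for i j
    proof -
      obtain F G where "i = e (F, F)" "finite F" "F \<subseteq> R" "j = e (G, G)" "finite G" "G \<subseteq> R"
        using ex[OF ij(1)] ex[OF ij(2)] by blast
      then show ?thesis using ij(3) hom[of G F] by auto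
    qed
  qed
qed

section \<open>Abelian categories\<close>

locale abelian_cat = linear_category C k for C :: "('o, 'm, 'k) lincat" (structure) and k +
  assumes abelian: "abelian_category k C"
begin

lemma is_monoI:
  assumes "f \<in> Ar C"
    and "\<And>h. h \<in> Ar C \<Longrightarrow> Tgt C h = Src C f \<Longrightarrow> f \<cdot> h = ArZero C (Src C h) (Tgt C f) \<Longrightarrow>
      h = ArZero C (Src C h) (Src C f)"
  shows "is_mono C f"
  unfolding is_mono_def
proof (intro conjI ballI impI assms(1))
  fix X g h assume gh: "g \<in> Hom C X (Src C f)" "h \<in> Hom C X (Src C f)" "f \<cdot> g = f \<cdot> h"
  then show "g = h"
    using assms(2)[of "g \<^bold>+ neg h"] assms(1) diff_eq_zero_iff[of g h]
    by (auto simp: Hom_def Cmp_add Cmp_neg)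
qed

lemma is_epiI:
  assumes "f \<in> Ar C"
    and "\<And>h. h \<in> Ar C \<Longrightarrow> Src C h = Tgt C f \<Longrightarrow> h \<cdot> f = ArZero C (Src C f) (Tgt C h) \<Longrightarrow>
      h = ArZero C (Tgt C f) (Tgt C h)"
  shows "is_epi C f"
  unfolding is_epi_def
proof (intro conjI ballI impI assms(1))
  fix X g h assume gh: "g \<in> Hom C (Tgt C f) X" "h \<in> Hom C (Tgt C f) X" "g \<cdot> f = h \<cdot> f"
  then show "g = h"
    using assms(2)[of "g \<^bold>+ neg h"] assms(1) diff_eq_zero_iff[of g h]
    by (auto simp: Hom_def add_Cmp neg_Cmp)
qed

lemma is_monoD:
  "is_mono C f \<Longrightarrow> g \<in> Ar C \<Longrightarrow> h \<in> Ar C \<Longrightarrow> Tgt C g = Src C f \<Longrightarrow> Tgt C h = Src C f \<Longrightarrow>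
    Src C g = Src C h \<Longrightarrow> f \<cdot> g = f \<cdot> h \<Longrightarrow> g = h"
  by (simp add: is_mono_def Hom_def) (metis Src_Ob)

lemma is_epiD:
  "is_epi C f \<Longrightarrow> g \<in> Ar C \<Longrightarrow> h \<in> Ar C \<Longrightarrow> Src C g = Tgt C f \<Longrightarrow> Src C h = Tgt C f \<Longrightarrow>
    Tgt C g = Tgt C h \<Longrightarrow> g \<cdot> f = h \<cdot> f \<Longrightarrow> g = h"
  by (simp add: is_epi_def Hom_def) (metis Tgt_Ob)

lemma mono_zeroD:
  assumes "is_mono C f" "h \<in> Ar C" "Tgt C h = Src C f" "f \<cdot> h = ArZero C (Src C h) (Tgt C f)"
  shows "h = ArZero C (Src C h) (Src C f)"
proof (rule is_monoD[OF assms(1)])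
  have "f \<in> Ar C" using assms(1) by (simp add: is_mono_def)
  then show "f \<cdot> h = f \<cdot> ArZero C (Src C h) (Src C f)" "ArZero C (Src C h) (Src C f) \<in> Ar C"
    "Tgt C (ArZero C (Src C h) (Src C f)) = Src C f" "Src C h = Src C (ArZero C (Src C h) (Src C f))"
    using assms by simp_all
qed (use assms in auto)

lemma epi_zeroD:
  assumes "is_epi C f" "h \<in> Ar C" "Src C h = Tgt C f" "h \<cdot> f = ArZero C (Src C f) (Tgt C h)"
  shows "h = ArZero C (Tgt C f) (Tgt C h)"
proof (rule is_epiD[OF assms(1)])
  have "f \<in> Ar C" using assms(1) by (simp add: is_epi_def)
  then show "h \<cdot> f = ArZero C (Tgt C f) (Tgt C h) \<cdot> f" "ArZero C (Tgt C f) (Tgt C h) \<in> Ar C"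
    "Src C (ArZero C (Tgt C f) (Tgt C h)) = Tgt C f" "Tgt C h = Tgt C (ArZero C (Tgt C f) (Tgt C h))"
    using assms by simp_all
qed (use assms in auto)

lemma is_kernel_mono: "is_kernel C f i \<Longrightarrow> is_mono C i"
proof (rule is_monoI)
  assume i: "is_kernel C f i"
  then show iAr: "i \<in> Ar C" by (simp add: is_kernel_def)
  fix h assume h: "h \<in> Ar C" "Tgt C h = Src C i" "i \<cdot> h = ArZero C (Src C h) (Tgt C i)"
  have f: "f \<in> Ar C" "Tgt C i = Src C f" using i by (auto simp: is_kernel_def)
  let ?z = "ArZero C (Src C h) (Tgt C i)"
  have "\<exists>!u. u \<in> Hom C (Src C ?z) (Src C i) \<and> i \<cdot> u = ?z"
  proof -
    have "?z \<in> Ar C" "Tgt C ?z = Src C f" "f \<cdot> ?z = ArZero C (Src C ?z) (Tgt C f)"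
      using h f iAr by simp_all
    then show ?thesis using i unfolding is_kernel_def by blast
  qed
  moreover have "h \<in> Hom C (Src C ?z) (Src C i) \<and> i \<cdot> h = ?z"
    "ArZero C (Src C h) (Src C i) \<in> Hom C (Src C ?z) (Src C i) \<and> i \<cdot> ArZero C (Src C h) (Src C i) = ?z"
    using h f iAr by (simp_all add: Hom_def)
  ultimately show "h = ArZero C (Src C h) (Src C i)" by blast
qed

lemma is_cokernel_epi: "is_cokernel C f p \<Longrightarrow> is_epi C p"
proof (rule is_epiI)
  assume p: "is_cokernel C f p"
  then show pAr: "p \<in> Ar C" by (simp add: is_cokernel_def)
  fix h assume h: "h \<in> Ar C" "Src C h = Tgt C p" "h \<cdot> p = ArZero C (Src C p) (Tgt C h)"
  have f: "f \<in> Ar C" "Src C p = Tgt C f" using p by (auto simp: is_cokernel_def)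
  let ?z = "ArZero C (Src C p) (Tgt C h)"
  have "\<exists>!u. u \<in> Hom C (Tgt C p) (Tgt C ?z) \<and> u \<cdot> p = ?z"
  proof -
    have "?z \<in> Ar C" "Src C ?z = Tgt C f" "?z \<cdot> f = ArZero C (Src C f) (Tgt C ?z)"
      using h f pAr by simp_all
    then show ?thesis using p unfolding is_cokernel_def by blast
  qed
  moreover have "h \<in> Hom C (Tgt C p) (Tgt C ?z) \<and> h \<cdot> p = ?z"
    "ArZero C (Tgt C p) (Tgt C h) \<in> Hom C (Tgt C p) (Tgt C ?z) \<and> ArZero C (Tgt C p) (Tgt C h) \<cdot> p = ?z"
    using h f pAr by (simp_all add: Hom_def)
  ultimately show "h = ArZero C (Tgt C p) (Tgt C h)" by blast
qed

lemma kernelE: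
  assumes "f \<in> Ar C"
  obtains i where "is_kernel C f i" "is_mono C i" "i \<in> Ar C" "Tgt C i = Src C f"
    "f \<cdot> i = ArZero C (Src C i) (Tgt C f)"
    "\<And>h. h \<in> Ar C \<Longrightarrow> Tgt C h = Src C f \<Longrightarrow> f \<cdot> h = ArZero C (Src C h) (Tgt C f) \<Longrightarrow>
      \<exists>u \<in> Hom C (Src C h) (Src C i). i \<cdot> u = h"
proof -
  obtain i where i: "is_kernel C f i" using assms abelian by (auto simp: abelian_category_def)
  show ?thesis
    by (rule that[OF i is_kernel_mono[OF i]]) (use i in \<open>unfold is_kernel_def, blast+\<close>)
qed

lemma cokernelE:
  assumes "f \<in> Ar C"
  obtains p where "is_cokernel C f p" "is_epi C p" "p \<in> Ar C" "Src C p = Tgt C f"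
    "p \<cdot> f = ArZero C (Src C f) (Tgt C p)"
    "\<And>h. h \<in> Ar C \<Longrightarrow> Src C h = Tgt C f \<Longrightarrow> h \<cdot> f = ArZero C (Src C f) (Tgt C h) \<Longrightarrow>
      \<exists>u \<in> Hom C (Tgt C p) (Tgt C h). u \<cdot> p = h"
proof -
  obtain p where p: "is_cokernel C f p" using assms abelian by (auto simp: abelian_category_def)
  show ?thesis
    by (rule that[OF p is_cokernel_epi[OF p]]) (use p in \<open>unfold is_cokernel_def, blast+\<close>)
qed

text \<open>In an abelian category \<open>m\<close> is a kernel of some \<open>f\<close>, and the
  last premise applied to this \<open>f\<close> says that \<open>f\<close> kills \<open>h\<close>.
  The premise is about every \<open>q\<close> that kills \<open>m\<close> because \<open>f\<close>
  is only known to exist.\<close>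

lemma mono_factor:
  assumes "is_mono C m" "h \<in> Ar C" "Tgt C h = Tgt C m"
    and "\<And>q. q \<in> Ar C \<Longrightarrow> Src C q = Tgt C m \<Longrightarrow> q \<cdot> m = ArZero C (Src C m) (Tgt C q) \<Longrightarrow>
      q \<cdot> h = ArZero C (Src C h) (Tgt C q)"
  obtains u where "u \<in> Ar C" "Src C u = Src C h" "Tgt C u = Src C m" "m \<cdot> u = h"
proof -
  obtain f where "is_kernel C f m" using assms abelian by (auto simp: abelian_category_def)
  then have f: "f \<in> Ar C" "Tgt C m = Src C f" "f \<cdot> m = ArZero C (Src C m) (Tgt C f)"
    "\<And>h. h \<in> Ar C \<Longrightarrow> Tgt C h = Src C f \<Longrightarrow> f \<cdot> h = ArZero C (Src C h) (Tgt C f) \<Longrightarrow>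
      \<exists>u \<in> Hom C (Src C h) (Src C m). m \<cdot> u = h"
    unfolding is_kernel_def by blast+
  from f(4)[of h] show ?thesis using assms(2-) f(1-3) that by (auto simp: Hom_def)
qed

text \<open>Dual to \<open>mono_factor\<close>: \<open>e\<close> is a cokernel of some arrow, and by
  the last premise \<open>h\<close> vanishes on that arrow.\<close>

lemma epi_factor:
  assumes "is_epi C e" "h \<in> Ar C" "Src C h = Src C e"
    and "\<And>q. q \<in> Ar C \<Longrightarrow> Tgt C q = Src C e \<Longrightarrow> e \<cdot> q = ArZero C (Src C q) (Tgt C e) \<Longrightarrow>
      h \<cdot> q = ArZero C (Src C q) (Tgt C h)"
  obtains u where "u \<in> Ar C" "Src C u = Tgt C e" "Tgt C u = Tgt C h" "u \<cdot> e = h"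
proof -
  obtain f where "is_cokernel C f e" using assms abelian by (auto simp: abelian_category_def)
  then have f: "f \<in> Ar C" "Src C e = Tgt C f" "e \<cdot> f = ArZero C (Src C f) (Tgt C e)"
    "\<And>h. h \<in> Ar C \<Longrightarrow> Src C h = Tgt C f \<Longrightarrow> h \<cdot> f = ArZero C (Src C f) (Tgt C h) \<Longrightarrow>
      \<exists>u \<in> Hom C (Tgt C e) (Tgt C h). u \<cdot> e = h"
    unfolding is_cokernel_def by blast+
  from f(4)[of h] show ?thesis using assms(2-) f(1-3) that by (auto simp: Hom_def)
qed

text \<open>Every \<open>p\<close> that kills \<open>m\<close> factors through \<open>q\<close>, so
  an arrow killed by \<open>q\<close> passes the test of \<open>mono_factor\<close>. This completes
  a monomorphism to a short exact sequence, the form in which exactness of filtered colimits is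
  given.\<close>

lemma mono_is_kernel_of_cokernel:
  assumes "is_mono C m" "is_cokernel C m q"
  shows "is_kernel C q m"
  unfolding is_kernel_def
proof (intro conjI ballI impI)
  show q: "q \<in> Ar C" and m: "m \<in> Ar C" and qm: "Tgt C m = Src C q"
    "q \<cdot> m = ArZero C (Src C m) (Tgt C q)"
    using assms by (auto simp: is_cokernel_def)
  fix h assume h: "h \<in> Ar C" "Tgt C h = Src C q" "q \<cdot> h = ArZero C (Src C h) (Tgt C q)"
  obtain u where u: "u \<in> Ar C" "Src C u = Src C h" "Tgt C u = Src C m" "m \<cdot> u = h"
  proof (rule mono_factor[OF assms(1) h(1)])
    show "Tgt C h = Tgt C m" using h qm by simp
    fix p assume p: "p \<in> Ar C" "Src C p = Tgt C m" "p \<cdot> m = ArZero C (Src C m) (Tgt C p)"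
    then obtain v where v: "v \<in> Hom C (Tgt C q) (Tgt C p)" "v \<cdot> q = p"
      using assms(2) unfolding is_cokernel_def by blast
    have "p \<cdot> h = v \<cdot> (q \<cdot> h)" using v q h by (auto simp: Hom_def)
    then show "p \<cdot> h = ArZero C (Src C h) (Tgt C p)" using v h by (simp add: Hom_def)
  qed
  show "\<exists>!u. u \<in> Hom C (Src C h) (Src C m) \<and> m \<cdot> u = h"
  proof (rule ex1I)
    show "u \<in> Hom C (Src C h) (Src C m) \<and> m \<cdot> u = h" using u by (simp add: Hom_def)
    show "v = u" if "v \<in> Hom C (Src C h) (Src C m) \<and> m \<cdot> v = h" for v
      using is_monoD[OF assms(1), of v u] u that by (simp add: Hom_def)
  qed
qed

text \<open>\<open>m\<close> is the kernel of the cokernel \<open>q\<close> of \<open>f\<close>. If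
  \<open>w\<close> kills \<open>e\<close>, then \<open>f\<close> factors through the smaller
  subobject \<open>m \<cdot> n\<close>, where \<open>n\<close> is the kernel of \<open>w\<close>.
  Whatever kills \<open>m \<cdot> n\<close> kills \<open>f\<close>, so it factors through
  \<open>q\<close> and kills \<open>m\<close>. Hence \<open>m\<close> factors through
  \<open>m \<cdot> n\<close>, so \<open>n\<close> has a right inverse, and \<open>w\<close> is
  zero.\<close>

lemma image_factorization:
  assumes f: "f \<in> Ar C"
  obtains m e where "is_mono C m" "is_epi C e" "m \<in> Ar C" "e \<in> Ar C" "Src C m = Tgt C e"
    "Src C e = Src C f" "Tgt C m = Tgt C f" "m \<cdot> e = f"
proof -
  obtain q where q: "q \<in> Ar C" "Src C q = Tgt C f" "q \<cdot> f = ArZero C (Src C f) (Tgt C q)"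
    and q_univ: "\<And>h. h \<in> Ar C \<Longrightarrow> Src C h = Tgt C f \<Longrightarrow> h \<cdot> f = ArZero C (Src C f) (Tgt C h) \<Longrightarrow>
      \<exists>u \<in> Hom C (Tgt C q) (Tgt C h). u \<cdot> q = h"
    using cokernelE[OF f] by blast
  obtain m where m: "is_mono C m" "m \<in> Ar C" "Tgt C m = Src C q" "q \<cdot> m = ArZero C (Src C m) (Tgt C q)"
    and m_univ: "\<And>h. h \<in> Ar C \<Longrightarrow> Tgt C h = Src C q \<Longrightarrow> q \<cdot> h = ArZero C (Src C h) (Tgt C q) \<Longrightarrow>
      \<exists>u \<in> Hom C (Src C h) (Src C m). m \<cdot> u = h"
    using kernelE[OF q(1)] by blast
  obtain e where e: "e \<in> Ar C" "Src C e = Src C f" "Tgt C e = Src C m" "m \<cdot> e = f"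
    using m_univ[of f] f q by (auto simp: Hom_def)
  have "is_epi C e"
  proof (rule is_epiI[OF e(1)])
    fix w assume w: "w \<in> Ar C" "Src C w = Tgt C e" "w \<cdot> e = ArZero C (Src C e) (Tgt C w)"
    obtain n where n: "is_mono C n" "n \<in> Ar C" "Tgt C n = Src C w" "w \<cdot> n = ArZero C (Src C n) (Tgt C w)"
      and n_univ: "\<And>h. h \<in> Ar C \<Longrightarrow> Tgt C h = Src C w \<Longrightarrow> w \<cdot> h = ArZero C (Src C h) (Tgt C w) \<Longrightarrow>
        \<exists>u \<in> Hom C (Src C h) (Src C n). n \<cdot> u = h"
      using kernelE[OF w(1)] by blast
    obtain e' where e': "e' \<in> Ar C" "Src C e' = Src C e" "Tgt C e' = Src C n" "n \<cdot> e' = e"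
      using n_univ[of e] w e by (auto simp: Hom_def)
    have mn: "is_mono C (m \<cdot> n)"
    proof (rule is_monoI)
      show "m \<cdot> n \<in> Ar C" using m n w e by simp
      fix h assume h: "h \<in> Ar C" "Tgt C h = Src C (m \<cdot> n)" "(m \<cdot> n) \<cdot> h = ArZero C (Src C h) (Tgt C (m \<cdot> n))"
      then have "n \<cdot> h = ArZero C (Src C (n \<cdot> h)) (Src C m)"
        using m n w e by (intro mono_zeroD[OF m(1)]) auto
      then show "h = ArZero C (Src C h) (Src C (m \<cdot> n))"
        using mono_zeroD[OF n(1) h(1)] m n w e h by simp
    qed
    obtain z where z: "z \<in> Ar C" "Src C z = Src C m" "Tgt C z = Src C n" "(m \<cdot> n) \<cdot> z = m"
    proof (rule mono_factor[OF mn m(2)])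
      show "Tgt C m = Tgt C (m \<cdot> n)" using m n w e by simp
      fix v assume v: "v \<in> Ar C" "Src C v = Tgt C (m \<cdot> n)"
        "v \<cdot> (m \<cdot> n) = ArZero C (Src C (m \<cdot> n)) (Tgt C v)"
      have "v \<cdot> f = (v \<cdot> (m \<cdot> n)) \<cdot> e'" using v(1,2) m(2,3) n(2,3) w(1,2) e e' by simp
      also have "\<dots> = ArZero C (Src C f) (Tgt C v)" unfolding v(3) using v(1) m n w e e' by simp
      finally obtain v' where v': "v' \<in> Ar C" "Src C v' = Tgt C q" "Tgt C v' = Tgt C v" "v' \<cdot> q = v"
        using q_univ[of v] v m n w e q by (auto simp: Hom_def)
      show "v \<cdot> m = ArZero C (Src C m) (Tgt C v)"
        unfolding v'(4)[symmetric] using v'(1-3) m q by simp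
    qed (use m n w e in auto)
    have nz: "n \<cdot> z = Ide C (Src C m)"
      by (rule is_monoD[OF m(1)]; use z m(2,3) n(2,3) w(1,2) e(1-3) in simp)
    have "w = w \<cdot> (n \<cdot> z)" unfolding nz using w(1,2) e(1-3) by simp
    also have "\<dots> = (w \<cdot> n) \<cdot> z" using z(1-3) m(2,3) n(2,3) w(1,2) e(1-3) by simp
    finally have "w = (w \<cdot> n) \<cdot> z" .
    then show "w = ArZero C (Tgt C e) (Tgt C w)" unfolding n(4) using z n w e by simp
  qed
  then show ?thesis using that m e q by metis
qed

text \<open>The condition says that \<open>x\<close> factors through the image of \<open>s\<close>; \<open>e\<close> is the pullback of \<open>s\<close> along \<open>x\<close>.\<close>

lemma lift_along_image:
  assumes s: "s \<in> Ar C" and x: "x \<in> Ar C" "Tgt C x = Tgt C s"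
    and cok: "\<And>q. q \<in> Ar C \<Longrightarrow> Src C q = Tgt C s \<Longrightarrow> q \<cdot> s = ArZero C (Src C s) (Tgt C q) \<Longrightarrow>
      q \<cdot> x = ArZero C (Src C x) (Tgt C q)"
  obtains e t where "is_epi C e" "e \<in> Ar C" "t \<in> Ar C" "Src C e = Src C t" "Tgt C e = Src C x"
    "Tgt C t = Src C s" "x \<cdot> e = s \<cdot> t"
proof -
  obtain m e where me: "is_mono C m" "is_epi C e" "m \<in> Ar C" "e \<in> Ar C" "Src C m = Tgt C e"
    "Src C e = Src C s" "Tgt C m = Tgt C s" "m \<cdot> e = s"
    using image_factorization[OF s] .
  obtain x' where x': "x' \<in> Ar C" "Src C x' = Src C x" "Tgt C x' = Src C m" "m \<cdot> x' = x"
  proof (rule mono_factor[OF me(1) x(1)])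
    show "Tgt C x = Tgt C m" using x me by simp
    fix q assume q: "q \<in> Ar C" "Src C q = Tgt C m" "q \<cdot> m = ArZero C (Src C m) (Tgt C q)"
    have "q \<cdot> s = (q \<cdot> m) \<cdot> e" using q(1,2) me by simp
    also have "\<dots> = ArZero C (Src C s) (Tgt C q)" unfolding q(3) using q(1,2) me by simp
    finally show "q \<cdot> x = ArZero C (Src C x) (Tgt C q)" using cok q me by simp
  qed
  obtain B i1 i2 p1 p2 where B: "is_biproduct C (Src C x) (Src C s) B i1 i2 p1 p2"
    using abelian s x unfolding abelian_category_def by (meson Src_Ob)
  have bp [simp]: "B \<in> Ob C" "i1 \<in> Ar C" "i2 \<in> Ar C" "p1 \<in> Ar C" "p2 \<in> Ar C"
    "Src C i1 = Src C x" "Src C i2 = Src C s" "Tgt C i1 = B" "Tgt C i2 = B" "Src C p1 = B" "Src C p2 = B"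
    "Tgt C p1 = Src C x" "Tgt C p2 = Src C s" "p1 \<cdot> i1 = Ide C (Src C x)" "p2 \<cdot> i2 = Ide C (Src C s)"
    "p1 \<cdot> i2 = ArZero C (Src C s) (Src C x)" "p2 \<cdot> i1 = ArZero C (Src C x) (Src C s)"
    using B by (auto simp: is_biproduct_def Hom_def)
  \<comment> \<open>The kernel \<open>\<kappa>\<close> of \<open>\<phi>\<close> is the pullback of
    \<open>e\<close> along \<open>x'\<close>, with projections \<open>p1 \<cdot> \<kappa>\<close>
    and \<open>p2 \<cdot> \<kappa>\<close>.\<close>
  define \<phi> where "\<phi> = (x' \<cdot> p1) \<^bold>+ neg (e \<cdot> p2)"
  have \<phi> [simp]: "\<phi> \<in> Ar C" "Src C \<phi> = B" "Tgt C \<phi> = Src C m"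
    using x' me by (auto simp: \<phi>_def)
  have \<phi>i2: "\<phi> \<cdot> i2 = neg e"
    using x' me s x by (simp add: \<phi>_def add_Cmp neg_Cmp)
  have neg_zero: "h = ArZero C (Src C h) (Tgt C h)" if "neg h = ArZero C (Src C h) (Tgt C h)" "h \<in> Ar C" for h
    using that add_neg[of h] by simp
  \<comment> \<open>On the second summand \<open>\<phi>\<close> is the negative of \<open>e\<close>,
    so a \<open>w\<close> for which \<open>w \<cdot> \<phi>\<close> vanishes there kills the
    epimorphism \<open>e\<close>.\<close>
  have zero_left: "w = ArZero C (Src C m) (Tgt C w)"
    if w: "w \<in> Ar C" "Src C w = Src C m" "(w \<cdot> \<phi>) \<cdot> i2 = ArZero C (Src C s) (Tgt C w)" for w
  proof -
    have "neg (w \<cdot> e) = ArZero C (Src C s) (Tgt C w)"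
      using w \<phi>i2 me by (simp add: Cmp_neg)
    then have "w \<cdot> e = ArZero C (Src C e) (Tgt C w)"
      using neg_zero[of "w \<cdot> e"] w me by simp
    then show ?thesis using epi_zeroD[OF me(2) w(1)] w me by simp
  qed
  have \<phi>_epi: "is_epi C \<phi>"
  proof (rule is_epiI)
    fix w assume w: "w \<in> Ar C" "Src C w = Tgt C \<phi>" "w \<cdot> \<phi> = ArZero C (Src C \<phi>) (Tgt C w)"
    have *: "(w \<cdot> \<phi>) \<cdot> i2 = ArZero C (Src C s) (Tgt C w)" unfolding w(3) using w(1) s by simp
    show "w = ArZero C (Tgt C \<phi>) (Tgt C w)" using zero_left[OF w(1) _ *] w(2) by simp
  qed simp
  obtain \<kappa> where \<kappa>: "\<kappa> \<in> Ar C" "Tgt C \<kappa> = Src C \<phi>" "\<phi> \<cdot> \<kappa> = ArZero C (Src C \<kappa>) (Tgt C \<phi>)"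
    and \<kappa>_univ: "\<And>h. h \<in> Ar C \<Longrightarrow> Tgt C h = Src C \<phi> \<Longrightarrow> \<phi> \<cdot> h = ArZero C (Src C h) (Tgt C \<phi>) \<Longrightarrow>
      \<exists>u \<in> Hom C (Src C h) (Src C \<kappa>). \<kappa> \<cdot> u = h"
    using kernelE[OF \<phi>(1)] by blast
  have eq: "x' \<cdot> (p1 \<cdot> \<kappa>) = e \<cdot> (p2 \<cdot> \<kappa>)"
  proof -
    have "(x' \<cdot> (p1 \<cdot> \<kappa>)) \<^bold>+ neg (e \<cdot> (p2 \<cdot> \<kappa>)) = \<phi> \<cdot> \<kappa>"
      using x' me s x \<kappa>(1,2) by (simp add: \<phi>_def add_Cmp neg_Cmp)
    then show ?thesis
      using diff_eq_zero_iff[of "x' \<cdot> (p1 \<cdot> \<kappa>)" "e \<cdot> (p2 \<cdot> \<kappa>)"] x' me s x \<kappa> by simp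
  qed
  have "x \<cdot> (p1 \<cdot> \<kappa>) = (m \<cdot> x') \<cdot> (p1 \<cdot> \<kappa>)" using x'(4) by simp
  also have "\<dots> = m \<cdot> (x' \<cdot> (p1 \<cdot> \<kappa>))" using x'(1-3) me(3) x(1) \<kappa>(1,2) by simp
  also have "\<dots> = (m \<cdot> e) \<cdot> (p2 \<cdot> \<kappa>)" unfolding eq using me(3-7) s \<kappa>(1,2) by simp
  also have "\<dots> = s \<cdot> (p2 \<cdot> \<kappa>)" using me(8) by simp
  finally have xe: "x \<cdot> (p1 \<cdot> \<kappa>) = s \<cdot> (p2 \<cdot> \<kappa>)" .
  \<comment> \<open>If \<open>h\<close> kills \<open>p1 \<cdot> \<kappa>\<close>, then
    \<open>h \<cdot> p1\<close> vanishes on the kernel of the epimorphism \<open>\<phi>\<close> and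
    is of the form \<open>u \<cdot> \<phi>\<close>. Restriction to the second summand shows that
    \<open>u\<close> is zero, and restriction to the first that \<open>h\<close> is zero.\<close>
  have "is_epi C (p1 \<cdot> \<kappa>)"
  proof (rule is_epiI)
    show "p1 \<cdot> \<kappa> \<in> Ar C" using \<kappa> by simp
    fix h assume h: "h \<in> Ar C" "Src C h = Tgt C (p1 \<cdot> \<kappa>)"
      "h \<cdot> (p1 \<cdot> \<kappa>) = ArZero C (Src C (p1 \<cdot> \<kappa>)) (Tgt C h)"
    have h': "Src C h = Src C x" using h \<kappa> by simp
    obtain u where u: "u \<in> Ar C" "Src C u = Tgt C \<phi>" "Tgt C u = Tgt C h" "u \<cdot> \<phi> = h \<cdot> p1"
    proof (rule epi_factor[OF \<phi>_epi, of "h \<cdot> p1"])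
      fix y assume y: "y \<in> Ar C" "Tgt C y = Src C \<phi>" "\<phi> \<cdot> y = ArZero C (Src C y) (Tgt C \<phi>)"
      then obtain z where z: "z \<in> Ar C" "Src C z = Src C y" "Tgt C z = Src C \<kappa>" "\<kappa> \<cdot> z = y"
        using \<kappa>_univ by (auto simp: Hom_def)
      have "(h \<cdot> p1) \<cdot> y = (h \<cdot> p1) \<cdot> (\<kappa> \<cdot> z)" using z(4) by simp
      also have "\<dots> = (h \<cdot> (p1 \<cdot> \<kappa>)) \<cdot> z" using z(1,3) h(1) h' \<kappa>(1,2) by simp
      also have "\<dots> = ArZero C (Src C y) (Tgt C (h \<cdot> p1))"
        unfolding h(3) using z(1-3) h(1) h' \<kappa>(1,2) by simp
      finally show "(h \<cdot> p1) \<cdot> y = ArZero C (Src C y) (Tgt C (h \<cdot> p1))" .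
    qed (use h(1) h' in auto)
    have *: "(u \<cdot> \<phi>) \<cdot> i2 = ArZero C (Src C s) (Tgt C u)"
      unfolding u(4) using h(1) h' u(3) s x by simp
    have u0: "u = ArZero C (Src C m) (Tgt C u)" using zero_left[OF u(1) _ *] u(2) by simp
    have "h = (h \<cdot> p1) \<cdot> i1" using h(1) h' by simp
    also have "\<dots> = u \<cdot> (\<phi> \<cdot> i1)" unfolding u(4)[symmetric] using u(1,2) by simp
    also have "\<dots> = ArZero C (Src C x) (Tgt C h)"
      by (subst u0) (use u(1,3) x(1) h(1) me(3) in simp)
    finally show "h = ArZero C (Tgt C (p1 \<cdot> \<kappa>)) (Tgt C h)" using \<kappa> by simp
  qed
  then show ?thesis using that[of "p1 \<cdot> \<kappa>" "p2 \<cdot> \<kappa>"] xe \<kappa> by simp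
qed

end

section \<open>Filtered colimits and the stability of jointly epimorphic sieves\<close>

text \<open>An arrow out of a quotient is determined by its composite with the epimorphism
  \<open>\<beta> j\<close>, so the functor laws for the induced arrows can be checked in
  \<open>D\<close>. This makes pointwise cokernels and pointwise images into diagrams.\<close>

lemma (in abelian_cat) quotient_functor:
  assumes "functor_between J C D"
    and \<beta>: "\<And>j. j \<in> Ob J \<Longrightarrow> is_epi C (\<beta> j)" "\<And>j. j \<in> Ob J \<Longrightarrow> Src C (\<beta> j) = FO D j"
    and ex: "\<And>a. a \<in> Ar J \<Longrightarrow> \<exists>t \<in> Hom C (Tgt C (\<beta> (Src J a))) (Tgt C (\<beta> (Tgt J a))).
      t \<cdot> \<beta> (Src J a) = \<beta> (Tgt J a) \<cdot> FA D a"
  obtains D' where "functor_between J C D'" "\<And>j. j \<in> Ob J \<Longrightarrow> FO D' j = Tgt C (\<beta> j)"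
    "\<And>a. a \<in> Ar J \<Longrightarrow> FA D' a \<cdot> \<beta> (Src J a) = \<beta> (Tgt J a) \<cdot> FA D a"
proof -
  interpret D: functor_between J C D by fact
  have \<beta>' [simp]: "\<beta> j \<in> Ar C" "Src C (\<beta> j) = FO D j" if "j \<in> Ob J" for j
    using \<beta> that by (auto simp: is_epi_def)
  obtain t where t: "\<And>a. a \<in> Ar J \<Longrightarrow> t a \<in> Hom C (Tgt C (\<beta> (Src J a))) (Tgt C (\<beta> (Tgt J a)))"
    "\<And>a. a \<in> Ar J \<Longrightarrow> t a \<cdot> \<beta> (Src J a) = \<beta> (Tgt J a) \<cdot> FA D a"
    using ex by metis
  have t' [simp]: "t a \<in> Ar C" "Src C (t a) = Tgt C (\<beta> (Src J a))" "Tgt C (t a) = Tgt C (\<beta> (Tgt J a))"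
    if "a \<in> Ar J" for a
    using t(1)[OF that] by (auto simp: Hom_def)
  define D' where "D' = \<lparr>FO = (\<lambda>j \<in> Ob J. Tgt C (\<beta> j)), FA = restrict t (Ar J)\<rparr>"
  have D' [simp]: "FO D' \<in> extensional (Ob J)" "FA D' \<in> extensional (Ar J)"
    "\<And>j. j \<in> Ob J \<Longrightarrow> FO D' j = Tgt C (\<beta> j)" "\<And>a. a \<in> Ar J \<Longrightarrow> FA D' a = t a"
    by (simp_all add: D'_def)
  have "is_functor J C D'"
  proof (rule is_functorI)
    fix A assume A: "A \<in> Ob J"
    have "t (Ide J A) = Ide C (Tgt C (\<beta> A))"
      by (rule is_epiD[OF \<beta>(1)[OF A]]) (use A t(2)[of "Ide J A"] in simp_all)
    then show "FA D' (Ide J A) = Ide C (FO D' A)" using A by simp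
  next
    fix f g assume fg: "f \<in> Ar J" "g \<in> Ar J" "Tgt J f = Src J g"
    have "t (g \<cdot>\<^bsub>J\<^esub> f) = t g \<cdot> t f"
    proof (rule is_epiD[OF \<beta>(1)[of "Src J f"]])
      have "(t g \<cdot> t f) \<cdot> \<beta> (Src J f) = t g \<cdot> (\<beta> (Src J g) \<cdot> FA D f)"
        using fg t(2)[of f] by simp
      also have "\<dots> = (t g \<cdot> \<beta> (Src J g)) \<cdot> FA D f"
        using fg by simp
      also have "\<dots> = t (g \<cdot>\<^bsub>J\<^esub> f) \<cdot> \<beta> (Src J f)"
        using fg t(2)[of g] t(2)[of "g \<cdot>\<^bsub>J\<^esub> f"] by simp
      finally show "t (g \<cdot>\<^bsub>J\<^esub> f) \<cdot> \<beta> (Src J f) = (t g \<cdot> t f) \<cdot> \<beta> (Src J f)" by simp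
    qed (use fg in simp_all)
    then show "FA D' (g \<cdot>\<^bsub>J\<^esub> f) = FA D' g \<cdot> FA D' f" using fg by simp
  qed (auto simp: Hom_def)
  then have "functor_between J C D'" by unfold_locales
  then show ?thesis by (rule that) (use t(2) in auto)
qed

section \<open>Filtered colimits in a Grothendieck category\<close>

locale grothendieck_cat = abelian_cat C k for C :: "('o, 'm, 'k) lincat" (structure) and k +
  fixes U :: "'u set"
  assumes universe: "universe U" and grothendieck: "grothendieck_category U k C"
begin

lemma colimitE:
  assumes "small_category U (J :: ('u, 'u) cat)" "functor_between J C D"
  obtains L \<iota> where "is_colimit J C D L \<iota>"
proof -
  have "cocomplete U C" using grothendieck by (simp add: grothendieck_category_def)
  then show ?thesis
    using assms that unfolding cocomplete_def functor_between_def functor_between_axioms_def by blast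
qed

text \<open>Exactness is given for short exact sequences of diagrams, so the cokernels of the
  \<open>\<alpha> j\<close> are made into a third diagram \<open>D3\<close>; then \<open>a\<close>
  is the first arrow of a short exact sequence of colimits.\<close>

lemma filtered_colimit_mono:
  assumes J: "small_category U (J :: ('u, 'u) cat)" "filtered_category J"
    and D: "functor_between J C D1" "functor_between J C D2"
    and \<alpha>: "nat_trans J C D1 D2 \<alpha>" "\<And>j. j \<in> Ob J \<Longrightarrow> is_mono C (\<alpha> j)"
    and L: "is_colimit J C D1 L1 \<iota>1" "is_colimit J C D2 L2 \<iota>2"
    and a: "a \<in> Hom C L1 L2" "\<And>j. j \<in> Ob J \<Longrightarrow> a \<cdot> \<iota>1 j = \<iota>2 j \<cdot> \<alpha> j"
  shows "is_mono C a"
proof -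
  interpret D1: functor_between J C D1 by fact
  interpret D2: functor_between J C D2 by fact
  have \<alpha>_simps [simp]: "\<alpha> j \<in> Ar C" "Src C (\<alpha> j) = FO D1 j" "Tgt C (\<alpha> j) = FO D2 j" if "j \<in> Ob J" for j
    using \<alpha>(1) that by (auto simp: nat_trans_def Hom_def)
  have \<alpha>_nat: "FA D2 a \<cdot> \<alpha> (Src J a) = \<alpha> (Tgt J a) \<cdot> FA D1 a" if "a \<in> Ar J" for a
    using \<alpha>(1) that by (auto simp: nat_trans_def)
  have "\<forall>j. \<exists>p. j \<in> Ob J \<longrightarrow> is_cokernel C (\<alpha> j) p"
    using abelian \<alpha>_simps(1) unfolding abelian_category_def by blast
  then obtain \<beta>0 where "\<And>j. j \<in> Ob J \<Longrightarrow> is_cokernel C (\<alpha> j) (\<beta>0 j)" by metis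
  \<comment> \<open>The restriction makes \<open>\<beta>\<close> extensional, as
    \<open>nat_trans\<close> demands.\<close>
  then obtain \<beta> where \<beta>_ext: "\<beta> \<in> extensional (Ob J)"
    and \<beta>: "\<And>j. j \<in> Ob J \<Longrightarrow> is_cokernel C (\<alpha> j) (\<beta> j)"
    using that[of "restrict \<beta>0 (Ob J)"] by auto
  have \<beta>_simps [simp]: "\<beta> j \<in> Ar C" "Src C (\<beta> j) = FO D2 j"
    "\<beta> j \<cdot> \<alpha> j = ArZero C (FO D1 j) (Tgt C (\<beta> j))" if "j \<in> Ob J" for j
    using \<beta>[OF that] that by (auto simp: is_cokernel_def)
  have \<beta>_univ: "\<exists>u \<in> Hom C (Tgt C (\<beta> j)) (Tgt C h). u \<cdot> \<beta> j = h"
    if "j \<in> Ob J" "h \<in> Ar C" "Src C h = FO D2 j" "h \<cdot> \<alpha> j = ArZero C (FO D1 j) (Tgt C h)" for j h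
  proof -
    have "\<exists>!u. u \<in> Hom C (Tgt C (\<beta> j)) (Tgt C h) \<and> u \<cdot> \<beta> j = h"
      using \<beta>[OF that(1)] that unfolding is_cokernel_def by simp
    then show ?thesis by blast
  qed
  have \<beta>_trans: "\<exists>t \<in> Hom C (Tgt C (\<beta> (Src J a))) (Tgt C (\<beta> (Tgt J a))).
      t \<cdot> \<beta> (Src J a) = \<beta> (Tgt J a) \<cdot> FA D2 a" if a: "a \<in> Ar J" for a
  proof -
    have "(\<beta> (Tgt J a) \<cdot> FA D2 a) \<cdot> \<alpha> (Src J a) = (\<beta> (Tgt J a) \<cdot> \<alpha> (Tgt J a)) \<cdot> FA D1 a"
      using a \<alpha>_nat[OF a] by (simp del: \<beta>_simps(3))
    also have "\<dots> = ArZero C (FO D1 (Src J a)) (Tgt C (\<beta> (Tgt J a)))"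
      using a by simp
    finally show ?thesis
      using a \<beta>_univ[of "Src J a" "\<beta> (Tgt J a) \<cdot> FA D2 a"] by simp
  qed
  obtain D3 where D3: "functor_between J C D3" "\<And>j. j \<in> Ob J \<Longrightarrow> FO D3 j = Tgt C (\<beta> j)"
    "\<And>a. a \<in> Ar J \<Longrightarrow> FA D3 a \<cdot> \<beta> (Src J a) = \<beta> (Tgt J a) \<cdot> FA D2 a"
    by (rule quotient_functor[OF D(2) is_cokernel_epi[OF \<beta>] \<beta>_simps(2) \<beta>_trans]) (assumption | (rule that; blast))+
  interpret D3: functor_between J C D3 by fact
  have \<beta>_nat: "nat_trans J C D2 D3 \<beta>"
    using \<beta>_ext D3(2,3) by (auto simp: nat_trans_def Hom_def)
  obtain L3 \<iota>3 where L3: "is_colimit J C D3 L3 \<iota>3" using colimitE[OF J(1) D3(1)] .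
  have \<iota>3 [simp]: "\<iota>3 j \<in> Ar C" "Src C (\<iota>3 j) = Tgt C (\<beta> j)" "Tgt C (\<iota>3 j) = L3" "L3 \<in> Ob C"
    if "j \<in> Ob J" for j
    using L3 that D3(2) by (auto simp: is_colimit_def is_cocone_def Hom_def)
  have \<iota>3_nat: "\<iota>3 (Tgt J a) \<cdot> FA D3 a = \<iota>3 (Src J a)" if "a \<in> Ar J" for a
    using L3 that by (auto simp: is_colimit_def is_cocone_def)
  have "is_cocone J C D2 L3 (\<lambda>j. \<iota>3 j \<cdot> \<beta> j)"
    unfolding is_cocone_def
  proof (intro conjI ballI)
    show "L3 \<in> Ob C" using L3 by (auto simp: is_colimit_def is_cocone_def)
    show "\<iota>3 j \<cdot> \<beta> j \<in> Hom C (FO D2 j) L3" if "j \<in> Ob J" for j using that by (simp add: Hom_def)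
    fix a assume a: "a \<in> Ar J"
    have "(\<iota>3 (Tgt J a) \<cdot> \<beta> (Tgt J a)) \<cdot> FA D2 a = (\<iota>3 (Tgt J a) \<cdot> FA D3 a) \<cdot> \<beta> (Src J a)"
      using a D3(2) D3(3)[OF a] by simp
    then show "(\<iota>3 (Tgt J a) \<cdot> \<beta> (Tgt J a)) \<cdot> FA D2 a = \<iota>3 (Src J a) \<cdot> \<beta> (Src J a)"
      using \<iota>3_nat[OF a] by simp
  qed
  then obtain b where b: "b \<in> Hom C L2 L3" "\<forall>j \<in> Ob J. b \<cdot> \<iota>2 j = \<iota>3 j \<cdot> \<beta> j"
    using L(2) unfolding is_colimit_def by blast
  have se: "\<forall>j \<in> Ob J. short_exact C (\<alpha> j) (\<beta> j)"
    using mono_is_kernel_of_cokernel \<alpha>(2) \<beta> by (auto simp: short_exact_def)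
  have "exact_filtered_colimits U C" using grothendieck by (simp add: grothendieck_category_def)
  then have "short_exact C a b"
    unfolding exact_filtered_colimits_def
    using J D1.is_functor D2.is_functor D3.is_functor \<alpha>(1) \<beta>_nat se L L3 a b by blast
  then show ?thesis using is_kernel_mono by (auto simp: short_exact_def)
qed

text \<open>\<open>s\<close> is the arrow from the direct sum of the sources of \<open>F\<close>,
  built up from a zero object by one biproduct at a time. Its source need not belong to
  \<open>S\<close>, so it cannot itself be expected in \<open>R\<close>; the last clause is the
  substitute, a statement about its composites with arrows from objects of \<open>S\<close>.\<close>

lemma finite_family_sum:
  assumes "finite F" "F \<subseteq> R" "X \<in> Ob C"
    and R: "\<And>r. r \<in> R \<Longrightarrow> r \<in> Ar C \<and> Tgt C r = X"
      "\<And>A. A \<in> S \<Longrightarrow> A \<in> Ob C \<Longrightarrow> ArZero C A X \<in> R"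
      "\<And>r r'. r \<in> R \<Longrightarrow> r' \<in> R \<Longrightarrow> Src C r = Src C r' \<Longrightarrow> Src C r \<in> S \<Longrightarrow> r \<^bold>+ r' \<in> R"
      "\<And>r y. r \<in> R \<Longrightarrow> y \<in> Ar C \<Longrightarrow> Tgt C y = Src C r \<Longrightarrow> Src C y \<in> S \<Longrightarrow> r \<cdot> y \<in> R"
  shows "\<exists>s \<in> arrows_to C X.
    (\<forall>q \<in> Ar C. Src C q = X \<longrightarrow> (q \<cdot> s = ArZero C (Src C s) (Tgt C q) \<longleftrightarrow>
      (\<forall>r \<in> F. q \<cdot> r = ArZero C (Src C r) (Tgt C q)))) \<and>
    (\<forall>y \<in> Ar C. Tgt C y = Src C s \<longrightarrow> Src C y \<in> S \<longrightarrow> s \<cdot> y \<in> R)"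
  using assms(1,2)
proof (induction F)
  case empty
  obtain Z where Z: "is_zero_object C Z" using abelian by (auto simp: abelian_category_def)
  then have ZOb: "Z \<in> Ob C" by (simp add: is_zero_object_def)
  have s: "ArZero C Z X \<in> arrows_to C X" using ZOb assms(3) by (simp add: arrows_to_def)
  show ?case
    by (rule bexI[OF _ s]) (use ZOb assms(3) R in auto)
next
  case (insert r F)
  then obtain s where s: "s \<in> Ar C" "Tgt C s = X"
    and s1: "\<And>q. q \<in> Ar C \<Longrightarrow> Src C q = X \<Longrightarrow> q \<cdot> s = ArZero C (Src C s) (Tgt C q) \<longleftrightarrow>
      (\<forall>r \<in> F. q \<cdot> r = ArZero C (Src C r) (Tgt C q))"
    and s2: "\<And>y. y \<in> Ar C \<Longrightarrow> Tgt C y = Src C s \<Longrightarrow> Src C y \<in> S \<Longrightarrow> s \<cdot> y \<in> R"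
    by (auto simp: arrows_to_def)
  have r: "r \<in> R" "r \<in> Ar C" "Tgt C r = X" using insert.prems R by auto
  obtain B i1 i2 p1 p2 where B: "is_biproduct C (Src C s) (Src C r) B i1 i2 p1 p2"
    using abelian s r unfolding abelian_category_def by (meson Src_Ob)
  have bp [simp]: "B \<in> Ob C" "i1 \<in> Ar C" "i2 \<in> Ar C" "p1 \<in> Ar C" "p2 \<in> Ar C"
    "Src C i1 = Src C s" "Src C i2 = Src C r" "Tgt C i1 = B" "Tgt C i2 = B" "Src C p1 = B" "Src C p2 = B"
    "Tgt C p1 = Src C s" "Tgt C p2 = Src C r" "p1 \<cdot> i1 = Ide C (Src C s)" "p2 \<cdot> i2 = Ide C (Src C r)"
    "p1 \<cdot> i2 = ArZero C (Src C r) (Src C s)" "p2 \<cdot> i1 = ArZero C (Src C s) (Src C r)"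
    using B by (auto simp: is_biproduct_def Hom_def)
  define s' where "s' = (s \<cdot> p1) \<^bold>+ (r \<cdot> p2)"
  have s' [simp]: "s' \<in> Ar C" "Src C s' = B" "Tgt C s' = X"
    using s r by (auto simp: s'_def)
  have si: "s' \<cdot> i1 = s" "s' \<cdot> i2 = r"
    using s r assms(3) by (simp_all add: s'_def add_Cmp)
  show ?case
  proof (intro bexI[of _ s'] conjI ballI impI iffI)
    fix q assume q: "q \<in> Ar C" "Src C q = X"
    { assume *: "q \<cdot> s' = ArZero C (Src C s') (Tgt C q)"
      have "q \<cdot> s = (q \<cdot> s') \<cdot> i1" "q \<cdot> r = (q \<cdot> s') \<cdot> i2" using q s r si by simp_all
      then have "q \<cdot> s = ArZero C (Src C s) (Tgt C q)" "q \<cdot> r = ArZero C (Src C r) (Tgt C q)"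
        unfolding * using q by simp_all
      then show "q \<cdot> x = ArZero C (Src C x) (Tgt C q)" if "x \<in> insert r F" for x
        using s1[OF q] that by auto }
    { assume *: "\<forall>r \<in> insert r F. q \<cdot> r = ArZero C (Src C r) (Tgt C q)"
      then have "q \<cdot> s = ArZero C (Src C s) (Tgt C q)" using s1[OF q] by simp
      moreover have "q \<cdot> s' = ((q \<cdot> s) \<cdot> p1) \<^bold>+ ((q \<cdot> r) \<cdot> p2)"
        using q s r by (simp add: s'_def Cmp_add)
      ultimately show "q \<cdot> s' = ArZero C (Src C s') (Tgt C q)"
        using * q s r by simp }
  next
    fix y assume y: "y \<in> Ar C" "Tgt C y = Src C s'" "Src C y \<in> S"
    have "s \<cdot> (p1 \<cdot> y) \<in> R" "r \<cdot> (p2 \<cdot> y) \<in> R" using y r s by (auto intro: s2 R(4))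
    then have "(s \<cdot> (p1 \<cdot> y)) \<^bold>+ (r \<cdot> (p2 \<cdot> y)) \<in> R"
      using y r s by (intro R(3)) auto
    then show "s' \<cdot> y \<in> R" using y s r by (simp add: s'_def add_Cmp)
  next
    show "s' \<in> arrows_to C X" by (simp add: arrows_to_def)
  qed
qed

text \<open>
  Let \<open>R\<close> be the value on the objects of \<open>S\<close> of a jointly epimorphic sieve on \<open>X\<close>, and let \<open>h\<close> kill
  all \<open>f : Y \<rightarrow> X'\<close> with \<open>g f \<in> R\<close>. For a finite \<open>F \<subseteq> R\<close> let \<open>q F\<close> be the joint cokernel of \<open>F\<close> and
  \<open>m F \<cdot> e F\<close> the image factorization of \<open>q F \<cdot> g\<close>. Then \<open>h\<close> factors through all \<open>e F\<close>, hence through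
  the colimit of the images, which vanishes since by exactness of filtered colimits it embeds into the
  colimit of the cokernels.
\<close>

lemma jointly_epi_pullback:
  assumes S: "S \<subseteq> Ob C" "small U S"
    and gen: "\<And>X. X \<in> Ob C \<Longrightarrow> jointly_epi C X {f \<in> arrows_to C X. Src C f \<in> S}"
    and R: "\<And>r. r \<in> R \<Longrightarrow> r \<in> Ar C \<and> Tgt C r = X \<and> Src C r \<in> S"
      "\<And>A. A \<in> S \<Longrightarrow> ArZero C A X \<in> R"
      "\<And>r r'. r \<in> R \<Longrightarrow> r' \<in> R \<Longrightarrow> Src C r = Src C r' \<Longrightarrow> r \<^bold>+ r' \<in> R"
      "\<And>r y. r \<in> R \<Longrightarrow> y \<in> Ar C \<Longrightarrow> Tgt C y = Src C r \<Longrightarrow> Src C y \<in> S \<Longrightarrow> r \<cdot> y \<in> R"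
    and epi: "jointly_epi C X R" and g: "g \<in> Hom C X' X"
  shows "jointly_epi C X' {f \<in> arrows_to C X'. Src C f \<in> S \<and> g \<cdot> f \<in> R}"
proof (rule jointly_epiI)
  fix B h assume h: "h \<in> Hom C X' B"
    and h0: "\<And>f. f \<in> {f \<in> arrows_to C X'. Src C f \<in> S \<and> g \<cdot> f \<in> R} \<Longrightarrow> h \<cdot> f = ArZero C (Src C f) B"
  have g' [simp]: "g \<in> Ar C" "Src C g = X'" "Tgt C g = X" using g by (auto simp: Hom_def)
  have h' [simp]: "h \<in> Ar C" "Src C h = X'" "Tgt C h = B" using h by (auto simp: Hom_def)
  have Ob [simp]: "X \<in> Ob C" "X' \<in> Ob C" "B \<in> Ob C" using Src_Ob[of g] Tgt_Ob[of g] Tgt_Ob[of h] by auto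
  have "locally_small U C" using grothendieck by (simp add: grothendieck_category_def)
  then have "small U (\<Union>A \<in> S. Hom C A X)"
    using S by (intro small_UN universe) (auto simp: locally_small_def)
  then have "small U R"
    by (rule small_subset) (use R(1) in \<open>auto simp: Hom_def\<close>)
  then obtain J :: "('u, 'u) cat" and \<phi>
    where J: "small_category U J" "filtered_category J"
      and \<phi>: "\<And>j. j \<in> Ob J \<Longrightarrow> finite (\<phi> j) \<and> \<phi> j \<subseteq> R"
        "\<And>F. finite F \<Longrightarrow> F \<subseteq> R \<Longrightarrow> \<exists>j \<in> Ob J. \<phi> j = F"
        "\<And>a. a \<in> Ar J \<Longrightarrow> \<phi> (Src J a) \<subseteq> \<phi> (Tgt J a)"
        "\<And>i j. i \<in> Ob J \<Longrightarrow> j \<in> Ob J \<Longrightarrow> \<phi> i \<subseteq> \<phi> j \<Longrightarrow> Hom J i j \<noteq> {}"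
    using finite_subsets_category[OF universe] by blast
  interpret J: category J using J by unfold_locales (simp add: small_category_def)
  \<comment> \<open>\<open>s j\<close> is the map from the direct sum of the finite family
    \<open>\<phi> j\<close>, and its cokernel, chosen below as \<open>q j\<close>, is the joint
    cokernel of that family.\<close>
  define P where "P j s \<longleftrightarrow> s \<in> arrows_to C X \<and>
    (\<forall>q \<in> Ar C. Src C q = X \<longrightarrow> (q \<cdot> s = ArZero C (Src C s) (Tgt C q) \<longleftrightarrow>
      (\<forall>r \<in> \<phi> j. q \<cdot> r = ArZero C (Src C r) (Tgt C q)))) \<and>
    (\<forall>y \<in> Ar C. Tgt C y = Src C s \<longrightarrow> Src C y \<in> S \<longrightarrow> s \<cdot> y \<in> R)" for j s
  have "\<exists>s. P j s" if "j \<in> Ob J" for j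
    unfolding P_def using finite_family_sum[of "\<phi> j" R X S] \<phi>(1)[OF that] R by auto
  then obtain s where P: "P j (s j)" if "j \<in> Ob J" for j by metis
  have s_Ar: "\<And>j. j \<in> Ob J \<Longrightarrow> s j \<in> arrows_to C X"
    and s1: "\<And>j q. j \<in> Ob J \<Longrightarrow> q \<in> Ar C \<Longrightarrow> Src C q = X \<Longrightarrow> q \<cdot> s j = ArZero C (Src C (s j)) (Tgt C q) \<longleftrightarrow>
      (\<forall>r \<in> \<phi> j. q \<cdot> r = ArZero C (Src C r) (Tgt C q))"
    and s2: "\<And>j y. j \<in> Ob J \<Longrightarrow> y \<in> Ar C \<Longrightarrow> Tgt C y = Src C (s j) \<Longrightarrow> Src C y \<in> S \<Longrightarrow> s j \<cdot> y \<in> R"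
    using P unfolding P_def by blast+
  have s [simp]: "s j \<in> Ar C" "Tgt C (s j) = X" if "j \<in> Ob J" for j
    using s_Ar[OF that] by (auto simp: arrows_to_def)
  define P' where "P' j q \<longleftrightarrow> is_epi C q \<and> q \<in> Ar C \<and> Src C q = X \<and>
      q \<cdot> s j = ArZero C (Src C (s j)) (Tgt C q) \<and>
      (\<forall>p \<in> Ar C. Src C p = X \<longrightarrow> p \<cdot> s j = ArZero C (Src C (s j)) (Tgt C p) \<longrightarrow>
        (\<exists>u \<in> Hom C (Tgt C q) (Tgt C p). u \<cdot> q = p))" for j q
  have "\<exists>q. P' j q" if "j \<in> Ob J" for j
    unfolding P'_def using cokernelE[OF s(1)[OF that]] s(2)[OF that] by metis
  then obtain q where P': "P' j (q j)" if "j \<in> Ob J" for j by metis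
  have q_epi: "\<And>j. j \<in> Ob J \<Longrightarrow> is_epi C (q j)"
    and q [simp]: "\<And>j. j \<in> Ob J \<Longrightarrow> q j \<in> Ar C" "\<And>j. j \<in> Ob J \<Longrightarrow> Src C (q j) = X"
    and qs: "\<And>j. j \<in> Ob J \<Longrightarrow> q j \<cdot> s j = ArZero C (Src C (s j)) (Tgt C (q j))"
    and q_univ: "\<And>j p. j \<in> Ob J \<Longrightarrow> p \<in> Ar C \<Longrightarrow> Src C p = X \<Longrightarrow>
      p \<cdot> s j = ArZero C (Src C (s j)) (Tgt C p) \<Longrightarrow> \<exists>u \<in> Hom C (Tgt C (q j)) (Tgt C p). u \<cdot> q j = p"
    using P' unfolding P'_def by blast+
  have q_r: "q j \<cdot> r = ArZero C (Src C r) (Tgt C (q j))" if "j \<in> Ob J" "r \<in> \<phi> j" for j r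
    using iffD1[OF s1[OF that(1) q(1)[OF that(1)] q(2)[OF that(1)]] qs[OF that(1)]] that(2) by blast
  define M where "M j m e \<longleftrightarrow> is_mono C m \<and> is_epi C e \<and> m \<in> Ar C \<and> e \<in> Ar C \<and> Src C m = Tgt C e \<and>
    Src C e = X' \<and> Tgt C m = Tgt C (q j) \<and> m \<cdot> e = q j \<cdot> g" for j m e
  have "\<exists>m e. M j m e" if "j \<in> Ob J" for j
  proof -
    have "q j \<cdot> g \<in> Ar C" using that by simp
    then obtain m e where "is_mono C m" "is_epi C e" "m \<in> Ar C" "e \<in> Ar C" "Src C m = Tgt C e"
      "Src C e = Src C (q j \<cdot> g)" "Tgt C m = Tgt C (q j \<cdot> g)" "m \<cdot> e = q j \<cdot> g"
      by (rule image_factorization)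
    then show ?thesis using that by (intro exI[of _ m] exI[of _ e]) (simp add: M_def)
  qed
  then obtain m0 e where m0: "M j (m0 j) (e j)" if "j \<in> Ob J" for j by metis
  define m where "m = restrict m0 (Ob J)"
  have m_ext: "m \<in> extensional (Ob J)" by (simp add: m_def)
  have me: "M j (m j) (e j)" if "j \<in> Ob J" for j using m0 that by (simp add: m_def)
  have m_mono: "is_mono C (m j)" and e_epi: "is_epi C (e j)"
    and me_eq: "m j \<cdot> e j = q j \<cdot> g"
    and me_simps [simp]: "m j \<in> Ar C" "e j \<in> Ar C" "Src C (m j) = Tgt C (e j)" "Src C (e j) = X'"
    "Tgt C (m j) = Tgt C (q j)" if "j \<in> Ob J" for j
    using me[OF that] by (auto simp: M_def)
  \<comment> \<open>Constant diagrams. The cokernels \<open>q j\<close> are quotients of the one at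
    \<open>X\<close> and the images \<open>e j\<close> of the one at \<open>X'\<close>, so
    \<open>quotient_functor\<close> applies to both.\<close>
  define K where "K X = \<lparr>FO = (\<lambda>j \<in> Ob J. X), FA = (\<lambda>a \<in> Ar J. Ide C X)\<rparr>" for X
  have K: "functor_between J C (K X)" if "X \<in> Ob C" for X
    by unfold_locales (use that in \<open>auto intro!: is_functorI simp: K_def Hom_def\<close>)
  have K_simps [simp]: "j \<in> Ob J \<Longrightarrow> FO (K X) j = X" "a \<in> Ar J \<Longrightarrow> FA (K X) a = Ide C X" for j a X
    by (simp_all add: K_def)
  have q_trans: "\<exists>t \<in> Hom C (Tgt C (q i)) (Tgt C (q j)). t \<cdot> q i = q j"
    if "i \<in> Ob J" "j \<in> Ob J" "\<phi> i \<subseteq> \<phi> j" for i j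
  proof -
    have "q j \<cdot> s i = ArZero C (Src C (s i)) (Tgt C (q j))"
      by (rule iffD2[OF s1[OF that(1) q(1)[OF that(2)] q(2)[OF that(2)]]]) (use q_r that in blast)
    then show ?thesis by (rule q_univ[OF that(1) q(1)[OF that(2)] q(2)[OF that(2)]])
  qed
  have Kq: "Src C (q j) = FO (K X) j" if "j \<in> Ob J" for j using that by simp
  have Kq_trans: "\<exists>t \<in> Hom C (Tgt C (q (Src J a))) (Tgt C (q (Tgt J a))).
      t \<cdot> q (Src J a) = q (Tgt J a) \<cdot> FA (K X) a" if "a \<in> Ar J" for a
    using q_trans[of "Src J a" "Tgt J a"] \<phi>(3)[OF that] that by simp
  obtain Q where Q: "functor_between J C Q" "\<And>j. j \<in> Ob J \<Longrightarrow> FO Q j = Tgt C (q j)"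
    "\<And>a. a \<in> Ar J \<Longrightarrow> FA Q a \<cdot> q (Src J a) = q (Tgt J a) \<cdot> FA (K X) a"
    by (rule quotient_functor[OF K[OF Ob(1)] q_epi Kq Kq_trans]) (assumption | (rule that; blast))+
  interpret Q: functor_between J C Q by fact
  have Qq: "FA Q a \<cdot> q (Src J a) = q (Tgt J a)" if "a \<in> Ar J" for a
    using Q(3)[OF that] that by simp
  have Ke: "Src C (e j) = FO (K X') j" if "j \<in> Ob J" for j using that by simp
  \<comment> \<open>On arrows killed by \<open>e (Src J a)\<close> also
    \<open>q (Src J a) \<cdot> g\<close> vanishes, hence so does
    \<open>q (Tgt J a) \<cdot> g\<close>, which is \<open>m (Tgt J a) \<cdot> e (Tgt J a)\<close>;
    the monomorphism can be cancelled.\<close>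
  have Ke_trans: "\<exists>t \<in> Hom C (Tgt C (e (Src J a))) (Tgt C (e (Tgt J a))).
      t \<cdot> e (Src J a) = e (Tgt J a) \<cdot> FA (K X') a" if a: "a \<in> Ar J" for a
  proof -
    obtain v where "v \<in> Ar C" "Src C v = Tgt C (e (Src J a))" "Tgt C v = Tgt C (e (Tgt J a))"
      "v \<cdot> e (Src J a) = e (Tgt J a)"
    proof (rule epi_factor[OF e_epi[of "Src J a"], of "e (Tgt J a)"])
      fix p assume p: "p \<in> Ar C" "Tgt C p = Src C (e (Src J a))"
        "e (Src J a) \<cdot> p = ArZero C (Src C p) (Tgt C (e (Src J a)))"
      have "m (Tgt J a) \<cdot> (e (Tgt J a) \<cdot> p) = (m (Tgt J a) \<cdot> e (Tgt J a)) \<cdot> p"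
        using a p(1,2) by simp
      also have "\<dots> = (FA Q a \<cdot> q (Src J a)) \<cdot> (g \<cdot> p)"
        using a p(1,2) by (simp add: me_eq Qq)
      also have "\<dots> = FA Q a \<cdot> ((q (Src J a) \<cdot> g) \<cdot> p)"
        using a p(1,2) Q(2) by simp
      also have "\<dots> = FA Q a \<cdot> (m (Src J a) \<cdot> (e (Src J a) \<cdot> p))"
        using a p(1,2) by (simp flip: me_eq)
      also have "\<dots> = ArZero C (Src C p) (Tgt C (q (Tgt J a)))"
        unfolding p(3) using a p(1,2) Q(2) by simp
      finally show "e (Tgt J a) \<cdot> p = ArZero C (Src C p) (Tgt C (e (Tgt J a)))"
        using mono_zeroD[OF m_mono[of "Tgt J a"], of "e (Tgt J a) \<cdot> p"] a p(1,2) by simp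
    qed (use a in auto)
    then show ?thesis
      using a by (auto simp: Hom_def)
  qed
  obtain I where I: "functor_between J C I" "\<And>j. j \<in> Ob J \<Longrightarrow> FO I j = Tgt C (e j)"
    "\<And>a. a \<in> Ar J \<Longrightarrow> FA I a \<cdot> e (Src J a) = e (Tgt J a) \<cdot> FA (K X') a"
    by (rule quotient_functor[OF K[OF Ob(2)] e_epi Ke Ke_trans]) (assumption | (rule that; blast))+
  interpret I: functor_between J C I by fact
  have Ie: "FA I a \<cdot> e (Src J a) = e (Tgt J a)" if "a \<in> Ar J" for a
    using I(3)[OF that] that by simp
  have m_nat: "nat_trans J C I Q m"
    unfolding nat_trans_def
  proof (intro conjI ballI m_ext)
    show "m j \<in> Hom C (FO I j) (FO Q j)" if "j \<in> Ob J" for j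
      using that by (simp add: Hom_def I Q)
    fix a assume a: "a \<in> Ar J"
    show "FA Q a \<cdot> m (Src J a) = m (Tgt J a) \<cdot> FA I a"
    proof (rule is_epiD[OF e_epi[of "Src J a"]])
      have "(FA Q a \<cdot> m (Src J a)) \<cdot> e (Src J a) = FA Q a \<cdot> (q (Src J a) \<cdot> g)"
        using a Q(2) by (simp add: me_eq)
      also have "\<dots> = (FA Q a \<cdot> q (Src J a)) \<cdot> g" using a Q(2) by simp
      also have "\<dots> = m (Tgt J a) \<cdot> (FA I a \<cdot> e (Src J a))"
        using a by (simp add: me_eq Qq Ie)
      also have "\<dots> = (m (Tgt J a) \<cdot> FA I a) \<cdot> e (Src J a)"
        using a I(2) by simp
      finally show "(FA Q a \<cdot> m (Src J a)) \<cdot> e (Src J a) = (m (Tgt J a) \<cdot> FA I a) \<cdot> e (Src J a)" .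
    qed (use a I(2) Q(2) in auto)
  qed
  obtain LI \<iota>I where LI: "is_colimit J C I LI \<iota>I" using colimitE[OF J(1) I(1)] .
  obtain LQ \<iota>Q where LQ: "is_colimit J C Q LQ \<iota>Q" using colimitE[OF J(1) Q(1)] .
  have \<iota>I [simp]: "LI \<in> Ob C" "\<And>j. j \<in> Ob J \<Longrightarrow> \<iota>I j \<in> Ar C" "\<And>j. j \<in> Ob J \<Longrightarrow> Src C (\<iota>I j) = Tgt C (e j)"
    "\<And>j. j \<in> Ob J \<Longrightarrow> Tgt C (\<iota>I j) = LI"
    using LI I(2) by (auto simp: is_colimit_def is_cocone_def Hom_def)
  have \<iota>Q [simp]: "LQ \<in> Ob C" "\<And>j. j \<in> Ob J \<Longrightarrow> \<iota>Q j \<in> Ar C" "\<And>j. j \<in> Ob J \<Longrightarrow> Src C (\<iota>Q j) = Tgt C (q j)"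
    "\<And>j. j \<in> Ob J \<Longrightarrow> Tgt C (\<iota>Q j) = LQ"
    using LQ Q(2) by (auto simp: is_colimit_def is_cocone_def Hom_def)
  have \<iota>Q_nat: "\<iota>Q (Tgt J a) \<cdot> FA Q a = \<iota>Q (Src J a)" if "a \<in> Ar J" for a
    using LQ that by (auto simp: is_colimit_def is_cocone_def)
  have \<iota>Qq: "\<iota>Q i \<cdot> q i = \<iota>Q j \<cdot> q j" if ij: "i \<in> Ob J" "j \<in> Ob J" "\<phi> i \<subseteq> \<phi> j" for i j
  proof -
    obtain a where a: "a \<in> Ar J" "Src J a = i" "Tgt J a = j" using \<phi>(4)[OF ij] by (auto simp: Hom_def)
    have "\<iota>Q i \<cdot> q i = (\<iota>Q j \<cdot> FA Q a) \<cdot> q i" using \<iota>Q_nat[OF a(1)] a by simp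
    also have "\<dots> = \<iota>Q j \<cdot> (FA Q a \<cdot> q i)" using a ij Q(2) by simp
    finally show ?thesis using Qq[OF a(1)] a by simp
  qed
  \<comment> \<open>Any \<open>r\<close> in \<open>R\<close> lies in some finite family that
    contains \<open>\<phi> j\<close>, so \<open>\<iota>Q j \<cdot> q j\<close> kills all of
    \<open>R\<close>, which is jointly epimorphic.\<close>
  have \<iota>Q0: "\<iota>Q j = ArZero C (Tgt C (q j)) LQ" if j: "j \<in> Ob J" for j
  proof -
    have "\<iota>Q j \<cdot> q j = ArZero C X LQ"
    proof (rule jointly_epiD[OF epi])
      show "R \<subseteq> arrows_to C X" using R(1) by (auto simp: arrows_to_def)
      show "\<iota>Q j \<cdot> q j \<in> Hom C X LQ" using j by (simp add: Hom_def)
      fix r assume r: "r \<in> R"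
      have r' [simp]: "r \<in> Ar C" "Tgt C r = X" using R(1)[OF r] by auto
      obtain i where i: "i \<in> Ob J" "\<phi> i = insert r (\<phi> j)" using \<phi>(2)[of "insert r (\<phi> j)"] \<phi>(1)[OF j] r by auto
      have "\<phi> j \<subseteq> \<phi> i" using i(2) by blast
      then have "(\<iota>Q j \<cdot> q j) \<cdot> r = (\<iota>Q i \<cdot> q i) \<cdot> r" by (simp only: \<iota>Qq[OF j i(1)])
      also have "\<dots> = \<iota>Q i \<cdot> (q i \<cdot> r)" using i(1) by simp
      also have "\<dots> = ArZero C (Src C r) LQ"
        using q_r[OF i(1), of r] i by simp
      finally show "(\<iota>Q j \<cdot> q j) \<cdot> r = ArZero C (Src C r) LQ" .
    qed
    then show ?thesis using epi_zeroD[OF q_epi[OF j], of "\<iota>Q j"] j by simp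
  qed
  have "is_cocone J C I LQ (\<lambda>j. \<iota>Q j \<cdot> m j)"
    unfolding is_cocone_def
  proof (intro conjI ballI)
    show "\<iota>Q j \<cdot> m j \<in> Hom C (FO I j) LQ" if "j \<in> Ob J" for j
      using that by (simp add: Hom_def I)
    show "(\<iota>Q (Tgt J a) \<cdot> m (Tgt J a)) \<cdot> FA I a = \<iota>Q (Src J a) \<cdot> m (Src J a)" if "a \<in> Ar J" for a
      using that by (simp add: \<iota>Q0 I)
  qed simp
  then obtain a where a: "a \<in> Hom C LI LQ" "\<forall>j \<in> Ob J. a \<cdot> \<iota>I j = \<iota>Q j \<cdot> m j"
    using LI unfolding is_colimit_def by blast
  have a' [simp]: "a \<in> Ar C" "Src C a = LI" "Tgt C a = LQ" using a(1) by (auto simp: Hom_def)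
  have "is_mono C a"
    using filtered_colimit_mono[OF J I(1) Q(1) m_nat m_mono LI LQ a(1)] a(2) by blast
  then have \<iota>I0: "\<iota>I j = ArZero C (Tgt C (e j)) LI" if "j \<in> Ob J" for j
    using mono_zeroD[of a "\<iota>I j"] a(2) that by (simp add: \<iota>Q0)
  \<comment> \<open>If \<open>e j\<close> kills \<open>y\<close>, then \<open>q j\<close> kills
    \<open>g \<cdot> y\<close>, which therefore lifts along \<open>s j\<close> after an epimorphism
    \<open>c\<close>. For \<open>z\<close> with source in \<open>S\<close>, the composite of
    \<open>g\<close> with \<open>y \<cdot> (c \<cdot> z)\<close> then lies in \<open>R\<close>, so
    \<open>h\<close> kills \<open>y \<cdot> (c \<cdot> z)\<close>. Such \<open>z\<close> are jointly
    epimorphic and \<open>c\<close> is epi.\<close>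
  have h_kernel: "h \<cdot> y = ArZero C (Src C y) B"
    if j: "j \<in> Ob J" and y: "y \<in> Ar C" "Tgt C y = X'" "e j \<cdot> y = ArZero C (Src C y) (Tgt C (e j))" for j y
  proof -
    have "q j \<cdot> (g \<cdot> y) = (m j \<cdot> e j) \<cdot> y" using j y(1,2) by (simp add: me_eq)
    also have "\<dots> = m j \<cdot> (e j \<cdot> y)" using j y(1,2) by (simp del: me_eq)
    also have "\<dots> = ArZero C (Src C y) (Tgt C (q j))" unfolding y(3) using j y(1,2) by simp
    finally have qgy: "q j \<cdot> (g \<cdot> y) = ArZero C (Src C y) (Tgt C (q j))" .
    obtain c t where ct: "is_epi C c" "c \<in> Ar C" "t \<in> Ar C" "Src C c = Src C t" "Tgt C c = Src C y"
      "Tgt C t = Src C (s j)" "(g \<cdot> y) \<cdot> c = s j \<cdot> t"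
    proof (rule lift_along_image[OF s(1)[OF j], of "g \<cdot> y"])
      fix p assume p: "p \<in> Ar C" "Src C p = Tgt C (s j)" "p \<cdot> s j = ArZero C (Src C (s j)) (Tgt C p)"
      then obtain u where u: "u \<in> Ar C" "Src C u = Tgt C (q j)" "Tgt C u = Tgt C p" "u \<cdot> q j = p"
        using q_univ[OF j, of p] j by (auto simp: Hom_def)
      have "p \<cdot> (g \<cdot> y) = u \<cdot> (q j \<cdot> (g \<cdot> y))" unfolding u(4)[symmetric] using u(1-3) j y(1,2) by simp
      then show "p \<cdot> (g \<cdot> y) = ArZero C (Src C (g \<cdot> y)) (Tgt C p)" unfolding qgy using u(1-3) j y(1,2) by simp
    qed (use j y(1,2) in auto)
    have "h \<cdot> (y \<cdot> c) = ArZero C (Src C c) B"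
    proof (rule jointly_epiD[OF gen[of "Src C c"]])
      fix z assume "z \<in> {f \<in> arrows_to C (Src C c). Src C f \<in> S}"
      then have z: "z \<in> Ar C" "Tgt C z = Src C c" "Src C z \<in> S" by (auto simp: arrows_to_def)
      have "g \<cdot> (y \<cdot> (c \<cdot> z)) = ((g \<cdot> y) \<cdot> c) \<cdot> z" using z y(1,2) ct(1-6) by simp
      also have "\<dots> = s j \<cdot> (t \<cdot> z)" unfolding ct(7) using z ct(1-6) j by simp
      finally have "g \<cdot> (y \<cdot> (c \<cdot> z)) \<in> R" using s2[OF j, of "t \<cdot> z"] z ct(1-6) by simp
      then have "h \<cdot> (y \<cdot> (c \<cdot> z)) = ArZero C (Src C (y \<cdot> (c \<cdot> z))) B"
        using z y(1,2) ct(1-6) by (intro h0) (auto simp: arrows_to_def)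
      then show "h \<cdot> (y \<cdot> c) \<cdot> z = ArZero C (Src C z) B" using z y(1,2) ct(1-6) by simp
    qed (use y(1,2) ct(1-6) in \<open>auto simp: Hom_def\<close>)
    then show ?thesis
      using epi_zeroD[OF ct(1), of "h \<cdot> y"] y(1,2) ct(1-6) by simp
  qed
  have "\<exists>u. u \<in> Ar C \<and> Src C u = Tgt C (e j) \<and> Tgt C u = B \<and> u \<cdot> e j = h" if j: "j \<in> Ob J" for j
  proof -
    obtain u where "u \<in> Ar C" "Src C u = Tgt C (e j)" "Tgt C u = Tgt C h" "u \<cdot> e j = h"
      by (rule epi_factor[OF e_epi[OF j], of h]) (use h_kernel[OF j] j in auto)
    then show ?thesis by auto
  qed
  then obtain u where u: "\<And>j. j \<in> Ob J \<Longrightarrow> u j \<in> Ar C \<and> Src C (u j) = Tgt C (e j) \<and> Tgt C (u j) = B \<and> u j \<cdot> e j = h"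
    by metis
  have "is_cocone J C I B u"
    unfolding is_cocone_def
  proof (intro conjI ballI)
    show "u j \<in> Hom C (FO I j) B" if "j \<in> Ob J" for j
      using that u by (simp add: Hom_def I)
    fix a assume a: "a \<in> Ar J"
    note u1 = u[OF J.Src_Ob[OF a]] and u2 = u[OF J.Tgt_Ob[OF a]]
    show "u (Tgt J a) \<cdot> FA I a = u (Src J a)"
      by (rule is_epiD[OF e_epi[of "Src J a"]]) (use a u1 u2 I(2) Ie[OF a] in auto)
  qed simp
  then obtain w where w: "w \<in> Hom C LI B" "\<forall>j \<in> Ob J. w \<cdot> \<iota>I j = u j"
    using LI unfolding is_colimit_def by blast
  have w' [simp]: "w \<in> Ar C" "Src C w = LI" "Tgt C w = B" using w(1) by (auto simp: Hom_def)
  \<comment> \<open>A single index is enough to conclude, and a filtered category has one.\<close>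
  obtain j where j: "j \<in> Ob J" using J(2) by (auto simp: filtered_category_def)
  have "u j = ArZero C (Tgt C (e j)) B" using w(2) j by (simp add: \<iota>I0 flip: w(2)[rule_format])
  then have "u j \<cdot> e j = ArZero C X' B" using j by simp
  then show "h = ArZero C X' B" using u[OF j] by simp
qed (auto simp: arrows_to_def)

end

section \<open>Small site presentations\<close>

locale linear_functor = X: linear_category X k + Y: linear_category Y k + functor_between X Y F
  for X :: "('o1, 'm1, 'k) lincat" and Y :: "('o2, 'm2, 'k) lincat" and k :: "'k ring"
    and F :: "('o1, 'm1, 'o2, 'm2) func" +
  assumes lin_functor: "lin_functor k X Y F"
begin

lemma FA_add [simp]: "f \<in> Ar X \<Longrightarrow> g \<in> Ar X \<Longrightarrow> Src X f = Src X g \<Longrightarrow> Tgt X f = Tgt X g \<Longrightarrow>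
    FA F (ArAdd X f g) = ArAdd Y (FA F f) (FA F g)"
  and FA_smult [simp]: "f \<in> Ar X \<Longrightarrow> r \<in> carrier k \<Longrightarrow> FA F (ArSmult X r f) = ArSmult Y r (FA F f)"
  using lin_functor unfolding lin_functor_def Hom_def
  by (auto, metis (mono_tags, lifting) X.Src_Ob X.Tgt_Ob mem_Collect_eq)

lemma FA_zero [simp]: "A \<in> Ob X \<Longrightarrow> B \<in> Ob X \<Longrightarrow> FA F (ArZero X A B) = ArZero Y (FO F A) (FO F B)"
  using Y.add_idem[of "FA F (ArZero X A B)"] FA_add[of "ArZero X A B" "ArZero X A B"] by simp

text \<open>The version of \<open>lin_sieve_equalizer\<close> relative to a functor. It allows the
  image of a generated sieve to be tested on the generators alone.\<close>

lemma lin_sieve_equalizer_image: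
  assumes "A \<in> Ob X" "g \<in> Hom Y (FO F A) B" "h \<in> Hom Y (FO F A) B"
  shows "lin_sieve k X A {f \<in> arrows_to X A. g \<cdot>\<^bsub>Y\<^esub> FA F f = h \<cdot>\<^bsub>Y\<^esub> FA F f}"
proof (rule X.lin_sieveI[OF assms(1)])
  have B: "B \<in> Ob Y" using assms(2) by (auto simp: Hom_def)
  have gh: "g \<in> Ar Y" "h \<in> Ar Y" "Src Y g = FO F A" "Src Y h = FO F A" "Tgt Y g = B" "Tgt Y h = B"
    using assms by (auto simp: Hom_def)
  show "ArZero X D A \<in> {f \<in> arrows_to X A. g \<cdot>\<^bsub>Y\<^esub> FA F f = h \<cdot>\<^bsub>Y\<^esub> FA F f}" if "D \<in> Ob X" for D
    using that assms(1) gh by (simp add: arrows_to_def)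
  fix f assume "f \<in> {f \<in> arrows_to X A. g \<cdot>\<^bsub>Y\<^esub> FA F f = h \<cdot>\<^bsub>Y\<^esub> FA F f}"
  then have f: "f \<in> Ar X" "Tgt X f = A" "g \<cdot>\<^bsub>Y\<^esub> FA F f = h \<cdot>\<^bsub>Y\<^esub> FA F f"
    by (auto simp: arrows_to_def)
  show "f \<in> Ar X \<and> Tgt X f = A" using f by simp
  show "ArSmult X r f \<in> {f \<in> arrows_to X A. g \<cdot>\<^bsub>Y\<^esub> FA F f = h \<cdot>\<^bsub>Y\<^esub> FA F f}" if "r \<in> carrier k" for r
    using f gh that by (simp add: arrows_to_def Y.Cmp_smult)
  show "f \<cdot>\<^bsub>X\<^esub> f' \<in> {f \<in> arrows_to X A. g \<cdot>\<^bsub>Y\<^esub> FA F f = h \<cdot>\<^bsub>Y\<^esub> FA F f}"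
    if "f' \<in> Ar X" "Tgt X f' = Src X f" for f'
    using f gh that by (simp add: arrows_to_def flip: Y.Cmp_assoc)
  fix f' assume "f' \<in> {f \<in> arrows_to X A. g \<cdot>\<^bsub>Y\<^esub> FA F f = h \<cdot>\<^bsub>Y\<^esub> FA F f}" "Src X f = Src X f'"
  then show "ArAdd X f f' \<in> {f \<in> arrows_to X A. g \<cdot>\<^bsub>Y\<^esub> FA F f = h \<cdot>\<^bsub>Y\<^esub> FA F f}"
    using f gh by (simp add: arrows_to_def Y.Cmp_add)
qed

lemma jointly_epi_image_generated:
  assumes "A \<in> Ob X" "P \<subseteq> arrows_to X A"
  shows "jointly_epi Y (FO F A) (FA F ` generated_sieve k X A P) \<longleftrightarrow> jointly_epi Y (FO F A) (FA F ` P)"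
proof
  assume *: "jointly_epi Y (FO F A) (FA F ` generated_sieve k X A P)"
  show "jointly_epi Y (FO F A) (FA F ` P)"
    unfolding jointly_epi_def
  proof (intro ballI impI)
    fix B g h assume B: "B \<in> Ob Y" and gh: "g \<in> Hom Y (FO F A) B" "h \<in> Hom Y (FO F A) B"
      "\<forall>f \<in> FA F ` P. g \<cdot>\<^bsub>Y\<^esub> f = h \<cdot>\<^bsub>Y\<^esub> f"
    then have "generated_sieve k X A P \<subseteq> {f \<in> arrows_to X A. g \<cdot>\<^bsub>Y\<^esub> FA F f = h \<cdot>\<^bsub>Y\<^esub> FA F f}"
      using assms by (intro X.generated_sieve_minimal lin_sieve_equalizer_image) auto
    then have "\<forall>f \<in> FA F ` generated_sieve k X A P. g \<cdot>\<^bsub>Y\<^esub> f = h \<cdot>\<^bsub>Y\<^esub> f" by blast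
    then show "g = h" using * gh(1,2) B unfolding jointly_epi_def by blast
  qed
next
  assume "jointly_epi Y (FO F A) (FA F ` P)"
  then show "jointly_epi Y (FO F A) (FA F ` generated_sieve k X A P)"
    using X.lin_sieve_generated(2)[OF assms] by (auto intro: Y.jointly_epi_mono)
qed

lemma image_arrows_to: "P \<subseteq> arrows_to X A \<Longrightarrow> FA F ` P \<subseteq> arrows_to Y (FO F A)"
  by (auto simp: arrows_to_def)

end

lemma linear_functorI:
  assumes "lin_category k X" "lin_category k Y" "lin_functor k X Y F"
  shows "linear_functor X Y k F"
  using assms
  by (auto simp: linear_functor_def linear_category_def linear_category_axioms_def category_def
    lin_category_def lin_functor_def functor_between_def functor_between_axioms_def linear_functor_axioms_def)

lemma lin_functor_between:
  "lin_category k X \<Longrightarrow> lin_category k Y \<Longrightarrow> lin_functor k X Y F \<Longrightarrow> functor_between X Y F"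
  using linear_functorI by (auto simp: linear_functor_def)

lemma linear_functor_comp:
  assumes "linear_functor X Y k F" "linear_functor Y Z k G"
  shows "linear_functor X Z k (comp_func X G F)"
proof -
  interpret F: linear_functor X Y k F by fact
  interpret G: linear_functor Y Z k G by fact
  have "functor_between X Z (comp_func X G F)"
    by (rule is_functor_comp[OF F.functor_between_axioms G.functor_between_axioms])
  then show ?thesis
    by (intro linear_functorI)
      (auto simp: lin_functor_def functor_between_def functor_between_axioms_def Hom_def F.X.linear G.Y.linear)
qed

lemma linear_functor_id:
  assumes "linear_category X k"
  shows "linear_functor X X k (id_func X)"
proof -
  interpret linear_category X k by fact
  have "functor_between X X (id_func X)" by (rule is_functor_id) unfold_locales
  then show ?thesis
    by (intro linear_functorI)
      (auto simp: lin_functor_def functor_between_def functor_between_axioms_def Hom_def linear)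
qed

section \<open>Presentations and the arrows between them in terms of joint epimorphisms\<close>

locale presentation = grothendieck_cat C k U
  for C :: "('o, 'm, 'k) lincat" (structure) and k and U :: "'u set" +
  fixes \<a> :: "('u, 'u, 'k) lincat" and T :: "('u, 'u) cover_system" and u :: "('u, 'u, 'o, 'm) func"
  assumes presentation: "is_presentation U k C (\<a>, T, u)"
begin

lemma LC: "LC_morphism k \<a> T C (canonical_topology k C) u"
  and site: "small_lin_site U k \<a> T"
  using presentation by (auto simp: is_presentation_def)

sublocale linear_functor \<a> C k u
  using LC site linear by (intro linear_functorI) (auto simp: LC_morphism_def small_lin_site_def)

lemma small_Ob: "small U (Ob \<a>)"
  using site by (simp add: small_lin_site_def small_category_def)

lemma topology: "grothendieck_topology k \<a> T"
  using site by (simp add: small_lin_site_def)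

text \<open>The inverse image clause of \<open>LC_morphism\<close> determines \<open>T\<close> from
  \<open>u\<close>, which turns every covering condition on the site into a condition in
  \<open>C\<close>.\<close>

lemma cover_iff:
  assumes "A \<in> Ob \<a>"
  shows "R \<in> T A \<longleftrightarrow> lin_sieve k \<a> A R \<and> jointly_epi C (FO u A) (FA u ` R)"
proof -
  have "R \<in> T A \<Longrightarrow> lin_sieve k \<a> A R"
    using topology assms unfolding grothendieck_topology_def by (auto dest!: PiE_mem)
  moreover have "R \<in> T A \<longleftrightarrow> jointly_epi C (FO u A) (FA u ` R)" if R: "lin_sieve k \<a> A R"
  proof -
    have "R \<subseteq> arrows_to \<a> A" using R by (simp add: lin_sieve_def)
    then show ?thesis
      using LC assms R covering_family_canonical[of "FO u A" "FA u ` R"] image_arrows_to[of R A]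
      unfolding LC_morphism_def by auto
  qed
  ultimately show ?thesis by blast
qed

lemma covering_family_iff:
  assumes "A \<in> Ob \<a>"
  shows "covering_family k \<a> T A P \<longleftrightarrow> P \<subseteq> arrows_to \<a> A \<and> jointly_epi C (FO u A) (FA u ` P)"
  using cover_iff[OF assms] X.lin_sieve_generated(1)[OF assms] jointly_epi_image_generated[OF assms]
  by (auto simp: covering_family_def)

lemma locally_generating:
  assumes "B \<in> Ob C"
  shows "jointly_epi C B {f \<in> arrows_to C B. Src C f \<in> FO u ` Ob \<a>}"
proof -
  obtain P where P: "covering_family k C (canonical_topology k C) B P"
    "\<forall>p \<in> P. \<exists>A \<in> Ob \<a>. Src C p = FO u A"
    using LC assms unfolding LC_morphism_def by blast
  then have "jointly_epi C B P" "P \<subseteq> arrows_to C B"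
    using covering_family_canonical[OF assms] by auto
  then show ?thesis using P(2) by (elim jointly_epi_mono) auto
qed

text \<open>Enlarging the covering family from (F) to all arrows along which \<open>c\<close> lifts
  replaces an existence statement by a property of one explicit family.\<close>

lemma locally_full:
  assumes "A \<in> Ob \<a>" "A' \<in> Ob \<a>" "c \<in> Hom C (FO u A) (FO u A')"
  shows "jointly_epi C (FO u A) (FA u ` {p \<in> arrows_to \<a> A. \<exists>h \<in> Hom \<a> (Src \<a> p) A'. c \<cdot> FA u p = FA u h})"
proof -
  obtain P where P: "covering_family k \<a> T A P" "\<forall>p \<in> P. \<exists>h \<in> Hom \<a> (Src \<a> p) A'. c \<cdot> FA u p = FA u h"
    using LC assms unfolding LC_morphism_def by blast
  then have "jointly_epi C (FO u A) (FA u ` P)" "P \<subseteq> arrows_to \<a> A"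
    using covering_family_iff[OF assms(1)] by auto
  then show ?thesis using P(2) by (elim jointly_epi_mono) auto
qed

lemma locally_faithful:
  assumes "A \<in> Ob \<a>" "A' \<in> Ob \<a>" "a \<in> Hom \<a> A A'" "FA u a = ArZero C (FO u A) (FO u A')"
  shows "\<exists>P. covering_family k \<a> T A P \<and> (\<forall>p \<in> P. a \<cdot>\<^bsub>\<a>\<^esub> p = ArZero \<a> (Src \<a> p) A')"
  using LC assms unfolding LC_morphism_def by blast

end

text \<open>
  Between presentations, the last two conditions on an LC morphism follow from the first two and from
  the compatibility with the functors to \<open>C\<close>.
\<close>

lemma (in grothendieck_cat) is_presentation_arrow_iff:
  assumes "is_presentation U k C (\<a>, Ta, ua)" "is_presentation U k C (\<b>, Tb, ub)"
  shows "is_presentation_arrow k (\<a>, Ta, ua) f (\<b>, Tb, ub) \<longleftrightarrow>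
    lin_functor k \<a> \<b> f \<and> comp_func \<a> ub f = ua \<and>
    (\<forall>B \<in> Ob \<b>. jointly_epi C (FO ub B) (FA ub ` {g \<in> arrows_to \<b> B. Src \<b> g \<in> FO f ` Ob \<a>})) \<and>
    (\<forall>A \<in> Ob \<a>. \<forall>A' \<in> Ob \<a>. \<forall>c \<in> Hom \<b> (FO f A) (FO f A').
      jointly_epi C (FO ua A) (FA ua ` {p \<in> arrows_to \<a> A. \<exists>h \<in> Hom \<a> (Src \<a> p) A'. c \<cdot>\<^bsub>\<b>\<^esub> FA f p = FA f h}))"
    (is "_ \<longleftrightarrow> ?lin \<and> ?comm \<and> ?G \<and> ?F")
proof -
  interpret ua: presentation C k U \<a> Ta ua using assms(1) by unfold_locales
  interpret ub: presentation C k U \<b> Tb ub using assms(2) by unfold_locales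
  show ?thesis
  proof
    assume *: "is_presentation_arrow k (\<a>, Ta, ua) f (\<b>, Tb, ub)"
    then have lin: ?lin and comm: ?comm and LC: "LC_morphism k \<a> Ta \<b> Tb f"
      by (auto simp: is_presentation_arrow_def LC_morphism_def)
    interpret f: linear_functor \<a> \<b> k f by (intro linear_functorI ua.X.linear ub.X.linear lin)
    have ?G
    proof
      fix B assume B: "B \<in> Ob \<b>"
      obtain P where P: "covering_family k \<b> Tb B P" "\<forall>p \<in> P. \<exists>A \<in> Ob \<a>. Src \<b> p = FO f A"
        using LC B unfolding LC_morphism_def by blast
      then have "jointly_epi C (FO ub B) (FA ub ` P)" "P \<subseteq> arrows_to \<b> B"
        using ub.covering_family_iff[OF B] by auto
      then show "jointly_epi C (FO ub B) (FA ub ` {g \<in> arrows_to \<b> B. Src \<b> g \<in> FO f ` Ob \<a>})"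
        using P(2) by (elim jointly_epi_mono, intro image_mono) auto
    qed
    moreover have ?F
    proof (intro ballI)
      fix A A' c assume A: "A \<in> Ob \<a>" "A' \<in> Ob \<a>" "c \<in> Hom \<b> (FO f A) (FO f A')"
      obtain P where P: "covering_family k \<a> Ta A P"
        "\<forall>p \<in> P. \<exists>h \<in> Hom \<a> (Src \<a> p) A'. c \<cdot>\<^bsub>\<b>\<^esub> FA f p = FA f h"
        using LC A unfolding LC_morphism_def by blast
      then have "jointly_epi C (FO ua A) (FA ua ` P)" "P \<subseteq> arrows_to \<a> A"
        using ua.covering_family_iff[OF A(1)] by auto
      then show "jointly_epi C (FO ua A)
          (FA ua ` {p \<in> arrows_to \<a> A. \<exists>h \<in> Hom \<a> (Src \<a> p) A'. c \<cdot>\<^bsub>\<b>\<^esub> FA f p = FA f h})"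
        using P(2) by (elim jointly_epi_mono) auto
    qed
    ultimately show "?lin \<and> ?comm \<and> ?G \<and> ?F" using lin comm by simp
  next
    assume *: "?lin \<and> ?comm \<and> ?G \<and> ?F"
    then have lin: ?lin and comm: ?comm and G: ?G and F: ?F by auto
    interpret f: linear_functor \<a> \<b> k f by (intro linear_functorI ua.X.linear ub.X.linear lin)
    have uO: "FO ub (FO f A) = FO ua A" if "A \<in> Ob \<a>" for A
      using that by (simp flip: comm)
    have uA: "FA ub (FA f g) = FA ua g" if "g \<in> Ar \<a>" for g
      using that by (simp flip: comm)
    have "LC_morphism k \<a> Ta \<b> Tb f"
      unfolding LC_morphism_def
    proof (intro conjI ballI allI impI lin)
      fix B assume B: "B \<in> Ob \<b>"
      let ?P = "{g \<in> arrows_to \<b> B. Src \<b> g \<in> FO f ` Ob \<a>}"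
      have "covering_family k \<b> Tb B ?P" using G B by (auto simp: ub.covering_family_iff)
      then show "\<exists>P. covering_family k \<b> Tb B P \<and> (\<forall>p \<in> P. \<exists>A \<in> Ob \<a>. Src \<b> p = FO f A)"
        by (intro exI[of _ ?P]) auto
    next
      fix A A' c assume A: "A \<in> Ob \<a>" "A' \<in> Ob \<a>" "c \<in> Hom \<b> (FO f A) (FO f A')"
      let ?P = "{p \<in> arrows_to \<a> A. \<exists>h \<in> Hom \<a> (Src \<a> p) A'. c \<cdot>\<^bsub>\<b>\<^esub> FA f p = FA f h}"
      have "covering_family k \<a> Ta A ?P" using F A by (auto simp: ua.covering_family_iff)
      then show "\<exists>P. covering_family k \<a> Ta A P \<and>
          (\<forall>p \<in> P. \<exists>h \<in> Hom \<a> (Src \<a> p) A'. c \<cdot>\<^bsub>\<b>\<^esub> FA f p = FA f h)"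
        by (intro exI[of _ ?P]) auto
    next
      fix A A' a assume A: "A \<in> Ob \<a>" "A' \<in> Ob \<a>" "a \<in> Hom \<a> A A'"
        and a: "FA f a = ArZero \<b> (FO f A) (FO f A')"
      have "FA ua a = ArZero C (FO ua A) (FO ua A')"
        using A a uA[of a] by (simp add: uO Hom_def)
      then show "\<exists>P. covering_family k \<a> Ta A P \<and> (\<forall>p \<in> P. a \<cdot>\<^bsub>\<a>\<^esub> p = ArZero \<a> (Src \<a> p) A')"
        using ua.locally_faithful A by blast
    next
      fix A R assume A: "A \<in> Ob \<a>" and R: "lin_sieve k \<a> A R"
      have R': "R \<subseteq> arrows_to \<a> A" using R by (simp add: lin_sieve_def)
      have "FA ub ` FA f ` R = FA ua ` R"
        using R' uA by (force simp: arrows_to_def image_image)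
      then show "R \<in> Ta A \<longleftrightarrow> covering_family k \<b> Tb (FO f A) (FA f ` R)"
        using A R f.image_arrows_to[OF R']
        by (simp add: ua.cover_iff ub.covering_family_iff uO)
    qed
    then show "is_presentation_arrow k (\<a>, Ta, ua) f (\<b>, Tb, ub)"
      using comm by (simp add: is_presentation_arrow_def)
  qed
qed

lemma (in category) jointly_epi_eqI:
  assumes "jointly_epi C A P" "v \<in> Ar C" "w \<in> Ar C" "Src C v = A" "Src C w = A" "Tgt C v = Tgt C w"
    "\<And>p. p \<in> P \<Longrightarrow> v \<cdot> p = w \<cdot> p"
  shows "v = w"
  using assms unfolding jointly_epi_def Hom_def by (metis (mono_tags, lifting) Tgt_Ob mem_Collect_eq)

text \<open>The two families for the composite functor are reached only by composing several
  coverings. So two arrows \<open>v\<close> and \<open>w\<close> that agree on the family are shown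
  equal by restricting them along one covering after another until the composite restriction lies in
  the family. For (G), values of \<open>g\<close> cover, and each is covered by values of
  \<open>f\<close>; for (F), four coverings are needed.\<close>

lemma (in grothendieck_cat) presentation_arrow_comp:
  assumes "is_presentation U k C p" "is_presentation U k C q" "is_presentation U k C r"
    "is_presentation_arrow k p f q" "is_presentation_arrow k q g r"
  shows "is_presentation_arrow k p (comp_func (fst p) g f) r"
proof -
  obtain \<a> Ta ua \<b> Tb ub \<c> Tc uc where pqr [simp]: "p = (\<a>, Ta, ua)" "q = (\<b>, Tb, ub)" "r = (\<c>, Tc, uc)"
    by (cases p, cases q, cases r) auto
  interpret ua: presentation C k U \<a> Ta ua using assms(1) by unfold_locales simp
  interpret ub: presentation C k U \<b> Tb ub using assms(2) by unfold_locales simp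
  interpret uc: presentation C k U \<c> Tc uc using assms(3) by unfold_locales simp
  note f = assms(4)[unfolded pqr is_presentation_arrow_iff[OF ua.presentation ub.presentation]]
  note g = assms(5)[unfolded pqr is_presentation_arrow_iff[OF ub.presentation uc.presentation]]
  interpret f: linear_functor \<a> \<b> k f using f by (intro linear_functorI ua.X.linear ub.X.linear) simp
  interpret g: linear_functor \<b> \<c> k g using g by (intro linear_functorI ub.X.linear uc.X.linear) simp
  let ?h = "comp_func \<a> g f"
  interpret h: linear_functor \<a> \<c> k ?h
    by (rule linear_functor_comp[OF f.linear_functor_axioms g.linear_functor_axioms])
  have comm_f: "comp_func \<a> ub f = ua" and comm_g: "comp_func \<b> uc g = ub" using f g by auto
  have uf [simp]: "A \<in> Ob \<a> \<Longrightarrow> FO ub (FO f A) = FO ua A" "x \<in> Ar \<a> \<Longrightarrow> FA ub (FA f x) = FA ua x" for A x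
    by (simp_all flip: comm_f)
  have ug [simp]: "A \<in> Ob \<b> \<Longrightarrow> FO uc (FO g A) = FO ub A" "x \<in> Ar \<b> \<Longrightarrow> FA uc (FA g x) = FA ub x" for A x
    by (simp_all flip: comm_g)
  have "is_presentation_arrow k (\<a>, Ta, ua) ?h (\<c>, Tc, uc)"
    unfolding is_presentation_arrow_iff[OF ua.presentation uc.presentation]
  proof (intro conjI ballI h.lin_functor)
    have "comp_func \<a> uc ?h = comp_func \<a> (comp_func \<b> uc g) f"
      by (rule comp_func_assoc[OF f.functor_between_axioms g.functor_between_axioms])
    then show "comp_func \<a> uc ?h = ua" by (simp add: comm_f comm_g)
  next
    fix Z assume Z: "Z \<in> Ob \<c>"
    show "jointly_epi C (FO uc Z) (FA uc ` {m \<in> arrows_to \<c> Z. Src \<c> m \<in> FO ?h ` Ob \<a>})"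
      unfolding jointly_epi_def
    proof (intro ballI impI)
      fix X v w assume vw: "v \<in> Hom C (FO uc Z) X" "w \<in> Hom C (FO uc Z) X"
        and eq: "\<forall>m \<in> FA uc ` {m \<in> arrows_to \<c> Z. Src \<c> m \<in> FO ?h ` Ob \<a>}. v \<cdot> m = w \<cdot> m"
      have [simp]: "v \<in> Ar C" "w \<in> Ar C" "Src C v = FO uc Z" "Src C w = FO uc Z" "Tgt C v = X" "Tgt C w = X"
        using vw by (auto simp: Hom_def)
      have "jointly_epi C (FO uc Z) (FA uc ` {m \<in> arrows_to \<c> Z. Src \<c> m \<in> FO g ` Ob \<b>})"
        using g Z by simp
      then show "v = w"
      proof (rule jointly_epi_eqI)
        fix p assume "p \<in> FA uc ` {m \<in> arrows_to \<c> Z. Src \<c> m \<in> FO g ` Ob \<b>}"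
        then obtain m B where m [simp]: "m \<in> Ar \<c>" "Tgt \<c> m = Z" "Src \<c> m = FO g B" "B \<in> Ob \<b>" and p: "p = FA uc m"
          by (auto simp: arrows_to_def)
        have "jointly_epi C (FO ub B) (FA ub ` {n \<in> arrows_to \<b> B. Src \<b> n \<in> FO f ` Ob \<a>})"
          using f by simp
        then show "v \<cdot> p = w \<cdot> p"
        proof (rule jointly_epi_eqI)
          fix n' assume "n' \<in> FA ub ` {n \<in> arrows_to \<b> B. Src \<b> n \<in> FO f ` Ob \<a>}"
          then obtain n A where n [simp]: "n \<in> Ar \<b>" "Tgt \<b> n = B" "Src \<b> n = FO f A" "A \<in> Ob \<a>"
            and n': "n' = FA ub n" by (auto simp: arrows_to_def)
          have "v \<cdot> FA uc (m \<cdot>\<^bsub>\<c>\<^esub> FA g n) = w \<cdot> FA uc (m \<cdot>\<^bsub>\<c>\<^esub> FA g n)"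
            by (rule eq[rule_format], rule imageI) (auto simp: arrows_to_def)
          then show "(v \<cdot> p) \<cdot> n' = (w \<cdot> p) \<cdot> n'" by (simp add: p n')
        qed (simp_all add: p)
      qed simp_all
    qed
  next
    fix A A' c assume A [simp]: "A \<in> Ob \<a>" "A' \<in> Ob \<a>" and "c \<in> Hom \<c> (FO ?h A) (FO ?h A')"
    then have c [simp]: "c \<in> Ar \<c>" "Src \<c> c = FO g (FO f A)" "Tgt \<c> c = FO g (FO f A')"
      by (auto simp: Hom_def)
    show "jointly_epi C (FO ua A) (FA ua ` {p \<in> arrows_to \<a> A. \<exists>y \<in> Hom \<a> (Src \<a> p) A'. c \<cdot>\<^bsub>\<c>\<^esub> FA ?h p = FA ?h y})"
      unfolding jointly_epi_def
    proof (intro ballI impI)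
      fix X v w assume vw: "v \<in> Hom C (FO ua A) X" "w \<in> Hom C (FO ua A) X"
        and eq: "\<forall>m \<in> FA ua ` {p \<in> arrows_to \<a> A. \<exists>y \<in> Hom \<a> (Src \<a> p) A'. c \<cdot>\<^bsub>\<c>\<^esub> FA ?h p = FA ?h y}. v \<cdot> m = w \<cdot> m"
      have [simp]: "v \<in> Ar C" "w \<in> Ar C" "Src C v = FO ua A" "Src C w = FO ua A" "Tgt C v = X" "Tgt C w = X"
        using vw by (auto simp: Hom_def)
      have "jointly_epi C (FO ub (FO f A)) (FA ub ` {m \<in> arrows_to \<b> (FO f A).
          \<exists>h \<in> Hom \<b> (Src \<b> m) (FO f A'). c \<cdot>\<^bsub>\<c>\<^esub> FA g m = FA g h})"
        by (rule g[THEN conjunct2, THEN conjunct2, THEN conjunct2, rule_format]) (simp_all add: Hom_def)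
      then have "jointly_epi C (FO ua A) (FA ub ` {m \<in> arrows_to \<b> (FO f A).
          \<exists>h \<in> Hom \<b> (Src \<b> m) (FO f A'). c \<cdot>\<^bsub>\<c>\<^esub> FA g m = FA g h})"
        by simp
      then show "v = w"
      proof (rule jointly_epi_eqI)
        fix p assume "p \<in> FA ub ` {m \<in> arrows_to \<b> (FO f A). \<exists>h \<in> Hom \<b> (Src \<b> m) (FO f A'). c \<cdot>\<^bsub>\<c>\<^esub> FA g m = FA g h}"
        then obtain m l where m [simp]: "m \<in> Ar \<b>" "Tgt \<b> m = FO f A" "l \<in> Ar \<b>" "Src \<b> l = Src \<b> m" "Tgt \<b> l = FO f A'"
          and l: "c \<cdot>\<^bsub>\<c>\<^esub> FA g m = FA g l" and p: "p = FA ub m"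
          by (auto simp: arrows_to_def Hom_def)
        \<comment> \<open>The source of \<open>m\<close> need not be a value of \<open>f\<close>; it
          is covered by arrows \<open>n\<close> whose sources are.\<close>
        have "jointly_epi C (FO ub (Src \<b> m)) (FA ub ` {n \<in> arrows_to \<b> (Src \<b> m). Src \<b> n \<in> FO f ` Ob \<a>})"
          using f by simp
        then show "v \<cdot> p = w \<cdot> p"
        proof (rule jointly_epi_eqI)
          fix n' assume "n' \<in> FA ub ` {n \<in> arrows_to \<b> (Src \<b> m). Src \<b> n \<in> FO f ` Ob \<a>}"
          then obtain n D where n [simp]: "n \<in> Ar \<b>" "Tgt \<b> n = Src \<b> m" "Src \<b> n = FO f D" "D \<in> Ob \<a>"
            and n': "n' = FA ub n" by (auto simp: arrows_to_def)
          \<comment> \<open>The composite of \<open>m\<close> and \<open>n\<close> runs between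
            values of \<open>f\<close>, so after a covering \<open>s\<close> it lifts to an arrow
            \<open>y\<close> of the first site.\<close>
          have "jointly_epi C (FO ua D) (FA ua ` {s \<in> arrows_to \<a> D. \<exists>y \<in> Hom \<a> (Src \<a> s) A. (m \<cdot>\<^bsub>\<b>\<^esub> n) \<cdot>\<^bsub>\<b>\<^esub> FA f s = FA f y})"
            using f by (simp add: Hom_def)
          then show "(v \<cdot> p) \<cdot> n' = (w \<cdot> p) \<cdot> n'"
          proof (rule jointly_epi_eqI)
            fix s' assume "s' \<in> FA ua ` {s \<in> arrows_to \<a> D. \<exists>y \<in> Hom \<a> (Src \<a> s) A. (m \<cdot>\<^bsub>\<b>\<^esub> n) \<cdot>\<^bsub>\<b>\<^esub> FA f s = FA f y}"
            then obtain s y where s [simp]: "s \<in> Ar \<a>" "Tgt \<a> s = D" "y \<in> Ar \<a>" "Src \<a> y = Src \<a> s" "Tgt \<a> y = A"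
              and y: "(m \<cdot>\<^bsub>\<b>\<^esub> n) \<cdot>\<^bsub>\<b>\<^esub> FA f s = FA f y" and s': "s' = FA ua s"
              by (auto simp: arrows_to_def Hom_def)
            \<comment> \<open>The arrow \<open>l\<close>, a lift of \<open>c\<close> restricted
              along \<open>m\<close>, becomes an arrow between values of \<open>f\<close> when
              restricted further along \<open>n\<close> and \<open>s\<close>. After a last covering
              \<open>t\<close> it lifts to \<open>z\<close>.\<close>
            have "jointly_epi C (FO ua (Src \<a> s)) (FA ua ` {t \<in> arrows_to \<a> (Src \<a> s).
                \<exists>z \<in> Hom \<a> (Src \<a> t) A'. (l \<cdot>\<^bsub>\<b>\<^esub> (n \<cdot>\<^bsub>\<b>\<^esub> FA f s)) \<cdot>\<^bsub>\<b>\<^esub> FA f t = FA f z})"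
              using f by (simp add: Hom_def)
            then show "((v \<cdot> p) \<cdot> n') \<cdot> s' = ((w \<cdot> p) \<cdot> n') \<cdot> s'"
            proof (rule jointly_epi_eqI)
              fix t' assume "t' \<in> FA ua ` {t \<in> arrows_to \<a> (Src \<a> s).
                \<exists>z \<in> Hom \<a> (Src \<a> t) A'. (l \<cdot>\<^bsub>\<b>\<^esub> (n \<cdot>\<^bsub>\<b>\<^esub> FA f s)) \<cdot>\<^bsub>\<b>\<^esub> FA f t = FA f z}"
              then obtain t z where t [simp]: "t \<in> Ar \<a>" "Tgt \<a> t = Src \<a> s" "z \<in> Ar \<a>" "Src \<a> z = Src \<a> t" "Tgt \<a> z = A'"
                and z: "(l \<cdot>\<^bsub>\<b>\<^esub> (n \<cdot>\<^bsub>\<b>\<^esub> FA f s)) \<cdot>\<^bsub>\<b>\<^esub> FA f t = FA f z" and t': "t' = FA ua t"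
                by (auto simp: arrows_to_def Hom_def)
              have "c \<cdot>\<^bsub>\<c>\<^esub> FA g (FA f (y \<cdot>\<^bsub>\<a>\<^esub> t)) = c \<cdot>\<^bsub>\<c>\<^esub> FA g (((m \<cdot>\<^bsub>\<b>\<^esub> n) \<cdot>\<^bsub>\<b>\<^esub> FA f s) \<cdot>\<^bsub>\<b>\<^esub> FA f t)"
                unfolding y by simp
              also have "\<dots> = (c \<cdot>\<^bsub>\<c>\<^esub> FA g m) \<cdot>\<^bsub>\<c>\<^esub> FA g (n \<cdot>\<^bsub>\<b>\<^esub> (FA f s \<cdot>\<^bsub>\<b>\<^esub> FA f t))" by simp
              also have "\<dots> = FA g ((l \<cdot>\<^bsub>\<b>\<^esub> (n \<cdot>\<^bsub>\<b>\<^esub> FA f s)) \<cdot>\<^bsub>\<b>\<^esub> FA f t)" unfolding l by simp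
              finally have "c \<cdot>\<^bsub>\<c>\<^esub> FA ?h (y \<cdot>\<^bsub>\<a>\<^esub> t) = FA ?h z" unfolding z by simp
              \<comment> \<open>The composite of \<open>y\<close> and \<open>t\<close> belongs to
                the family on which \<open>v\<close> and \<open>w\<close> agree, with
                \<open>z\<close> as witness, and its image in \<open>C\<close> is the composite of
                all four restrictions.\<close>
              then have "v \<cdot> FA ua (y \<cdot>\<^bsub>\<a>\<^esub> t) = w \<cdot> FA ua (y \<cdot>\<^bsub>\<a>\<^esub> t)"
                by (intro eq[rule_format] imageI CollectI conjI bexI[of _ z]) (simp_all add: arrows_to_def Hom_def)
              moreover have "FA ua y = FA ub m \<cdot> (FA ub n \<cdot> FA ua s)"
                using arg_cong[OF y, of "FA ub"] by simp
              ultimately show "(((v \<cdot> p) \<cdot> n') \<cdot> s') \<cdot> t' = (((w \<cdot> p) \<cdot> n') \<cdot> s') \<cdot> t'"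
                by (simp add: p n' s' t')
            qed (simp_all add: p n' s')
          qed (simp_all add: p n')
        qed (simp_all add: p)
      qed simp_all
    qed
  qed
  then show ?thesis by simp
qed


section \<open>Generating sets of objects and their full subcategories\<close>

context grothendieck_cat
begin

definition generating :: "'o set \<Rightarrow> bool" where
  "generating S \<longleftrightarrow> S \<subseteq> Ob C \<and> small U S \<and>
    (\<forall>B \<in> Ob C. jointly_epi C B {f \<in> arrows_to C B. Src C f \<in> S})"

lemma generating_superset:
  assumes "generating S" "S \<subseteq> S'" "S' \<subseteq> Ob C" "small U S'"
  shows "generating S'"
  unfolding generating_def
proof (intro conjI ballI assms)
  fix B assume "B \<in> Ob C"
  then have "jointly_epi C B {f \<in> arrows_to C B. Src C f \<in> S}" using assms by (simp add: generating_def)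
  then show "jointly_epi C B {f \<in> arrows_to C B. Src C f \<in> S'}"
    by (rule jointly_epi_mono) (use assms in auto)
qed

lemma generating_Un: "generating S \<Longrightarrow> generating S' \<Longrightarrow> generating (S \<union> S')"
  by (rule generating_superset[of S]) (auto simp: generating_def intro: small_Un[OF universe])

lemma generating_insert:
  assumes "generating S" "A \<in> Ob C"
  shows "generating (insert A S)"
proof (rule generating_superset[OF assms(1)])
  have "small U {A}" by (rule small_finite[OF universe]) simp
  then show "small U (insert A S)"
    using small_Un[OF universe, of "{A}" S] assms(1) by (simp add: generating_def)
  show "insert A S \<subseteq> Ob C" using assms by (simp add: generating_def)
qed auto

lemma ex_generating: "\<exists>S. generating S"
proof -
  obtain G where G: "is_generator C G" using grothendieck by (auto simp: grothendieck_category_def)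
  have "generating {G}"
    unfolding generating_def
  proof (intro conjI ballI)
    show "{G} \<subseteq> Ob C" using G by (simp add: is_generator_def)
    show "small U {G}" by (rule small_finite[OF universe]) simp
    fix B assume B: "B \<in> Ob C"
    have "{f \<in> arrows_to C B. Src C f \<in> {G}} = Hom C G B" by (auto simp: arrows_to_def Hom_def)
    then show "jointly_epi C B {f \<in> arrows_to C B. Src C f \<in> {G}}"
      using G B unfolding jointly_epi_def is_generator_def by simp
  qed
  then show ?thesis ..
qed

lemma presentation_generating:
  assumes "is_presentation U k C (\<a>, T, u)"
  shows "generating (FO u ` Ob \<a>)"
proof -
  interpret presentation C k U \<a> T u using assms by unfold_locales
  show ?thesis
    unfolding generating_def using locally_generating small_image[OF small_Ob] by auto
qed

definition full_arrows :: "'o set \<Rightarrow> 'm set" where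
  "full_arrows S = {f \<in> Ar C. Src C f \<in> S \<and> Tgt C f \<in> S}"

lemma small_full_arrows:
  assumes "S \<subseteq> Ob C" "small U S"
  shows "small U (full_arrows S)"
proof -
  have "locally_small U C" using grothendieck by (simp add: grothendieck_category_def)
  then have "small U (\<Union>A \<in> S. \<Union>B \<in> S. Hom C A B)"
    using assms by (intro small_UN universe) (auto simp: locally_small_def)
  then show ?thesis by (rule small_subset) (auto simp: full_arrows_def Hom_def)
qed

text \<open>A small site consists of elements of \<open>U\<close>, while \<open>S\<close> consists
  of objects of \<open>C\<close>, so the full subcategory is carried into \<open>U\<close> along
  chosen injections of its objects and of its arrows. The choice depends on \<open>S\<close> alone,
  which makes \<open>full_presentation\<close> a function of \<open>S\<close>.\<close>

definition encO :: "'o set \<Rightarrow> 'o \<Rightarrow> 'u" where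
  "encO S = (SOME e. inj_on e S \<and> e ` S \<subseteq> U)"

definition decO :: "'o set \<Rightarrow> 'u \<Rightarrow> 'o" where
  "decO S = inv_into S (encO S)"

definition encA :: "'o set \<Rightarrow> 'm \<Rightarrow> 'u" where
  "encA S = (SOME e. inj_on e (full_arrows S) \<and> e ` full_arrows S \<subseteq> U)"

definition decA :: "'o set \<Rightarrow> 'u \<Rightarrow> 'm" where
  "decA S = inv_into (full_arrows S) (encA S)"

definition full_cat :: "'o set \<Rightarrow> ('u, 'u, 'k) lincat" where
  "full_cat S = \<lparr> Ob = encO S ` S, Ar = encA S ` full_arrows S,
     Src = (\<lambda>f. encO S (Src C (decA S f))), Tgt = (\<lambda>f. encO S (Tgt C (decA S f))),
     Cmp = (\<lambda>g f. encA S (decA S g \<cdot> decA S f)), Ide = (\<lambda>A. encA S (Ide C (decO S A))),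
     ArAdd = (\<lambda>f g. encA S (decA S f \<^bold>+ decA S g)),
     ArZero = (\<lambda>A B. encA S (ArZero C (decO S A) (decO S B))),
     ArSmult = (\<lambda>r f. encA S (ArSmult C r (decA S f))) \<rparr>"

definition full_func :: "'o set \<Rightarrow> ('u, 'u, 'o, 'm) func" where
  "full_func S = \<lparr> FO = restrict (decO S) (Ob (full_cat S)), FA = restrict (decA S) (Ar (full_cat S)) \<rparr>"

text \<open>The inverse image of the canonical topology along \<open>full_func S\<close>, as
  \<open>LC_morphism\<close> prescribes, with the functor written out as decoding.\<close>

definition full_top :: "'o set \<Rightarrow> ('u, 'u) cover_system" where
  "full_top S = (\<lambda>A \<in> Ob (full_cat S).
     {R. lin_sieve k (full_cat S) A R \<and> jointly_epi C (decO S A) (decA S ` R)})"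

definition full_presentation :: "'o set \<Rightarrow> ('u, 'o, 'm, 'k) presentation" where
  "full_presentation S = (full_cat S, full_top S, full_func S)"

end

locale full_subcategory = grothendieck_cat C k U
  for C :: "('o, 'm, 'k) lincat" (structure) and k and U :: "'u set" +
  fixes S :: "'o set"
  assumes generating: "generating S"
begin

abbreviation full_subcat :: "('u, 'u, 'k) lincat" (\<open>\<b>\<close>) where
  "\<b> \<equiv> full_cat S"

lemma S_Ob [simp]: "A \<in> S \<Longrightarrow> A \<in> Ob C"
  and S_small: "small U S"
  and S_epi: "B \<in> Ob C \<Longrightarrow> jointly_epi C B {f \<in> arrows_to C B. Src C f \<in> S}"
  using generating by (auto simp: generating_def)

lemma encO: "inj_on (encO S) S" "encO S ` S \<subseteq> U"
proof -
  have "\<exists>e. inj_on e S \<and> e ` S \<subseteq> U" using small_embedding[OF S_small] by blast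
  then have "inj_on (encO S) S \<and> encO S ` S \<subseteq> U" unfolding encO_def by (rule someI_ex)
  then show "inj_on (encO S) S" "encO S ` S \<subseteq> U" by auto
qed

lemma encA: "inj_on (encA S) (full_arrows S)" "encA S ` full_arrows S \<subseteq> U"
proof -
  have "S \<subseteq> Ob C" by auto
  then have "\<exists>e. inj_on e (full_arrows S) \<and> e ` full_arrows S \<subseteq> U"
    using small_embedding[OF small_full_arrows[OF _ S_small]] by blast
  then have "inj_on (encA S) (full_arrows S) \<and> encA S ` full_arrows S \<subseteq> U" unfolding encA_def by (rule someI_ex)
  then show "inj_on (encA S) (full_arrows S)" "encA S ` full_arrows S \<subseteq> U" by auto
qed

lemma decO_encO [simp]: "A \<in> S \<Longrightarrow> decO S (encO S A) = A"
  using encO(1) by (simp add: decO_def)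

lemma decA_encA [simp]: "f \<in> Ar C \<Longrightarrow> Src C f \<in> S \<Longrightarrow> Tgt C f \<in> S \<Longrightarrow> decA S (encA S f) = f"
  using encA(1) by (simp add: decA_def full_arrows_def)

lemma Ob_full [simp]: "Ob \<b> = encO S ` S"
  and Ar_full: "Ar \<b> = encA S ` full_arrows S"
  by (simp_all add: full_cat_def)

lemma full_ArI [simp]: "f \<in> Ar C \<Longrightarrow> Src C f \<in> S \<Longrightarrow> Tgt C f \<in> S \<Longrightarrow> encA S f \<in> Ar \<b>"
  by (simp add: Ar_full full_arrows_def)

lemma full_ArE:
  assumes "x \<in> Ar \<b>"
  obtains f where "x = encA S f" "f \<in> Ar C" "Src C f \<in> S" "Tgt C f \<in> S"
  using assms by (auto simp: Ar_full full_arrows_def)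

lemma full_ops [simp]:
  "Src \<b> x = encO S (Src C (decA S x))"
  "Tgt \<b> x = encO S (Tgt C (decA S x))"
  "y \<cdot>\<^bsub>\<b>\<^esub> x = encA S (decA S y \<cdot> decA S x)"
  "Ide \<b> a = encA S (Ide C (decO S a))"
  "ArAdd \<b> x y = encA S (decA S x \<^bold>+ decA S y)"
  "ArZero \<b> a b = encA S (ArZero C (decO S a) (decO S b))"
  "ArSmult \<b> r x = encA S (ArSmult C r (decA S x))"
  by (simp_all add: full_cat_def)

lemma full_func_simps [simp]:
  "a \<in> encO S ` S \<Longrightarrow> FO (full_func S) a = decO S a"
  "x \<in> Ar \<b> \<Longrightarrow> FA (full_func S) x = decA S x"
  by (auto simp: full_func_def)

lemma encO_eq_iff [simp]: "A \<in> S \<Longrightarrow> B \<in> S \<Longrightarrow> encO S A = encO S B \<longleftrightarrow> A = B"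
  using encO(1) by (auto simp: inj_on_def)

lemma decA_simps [simp]:
  assumes "x \<in> Ar \<b>"
  shows "decA S x \<in> Ar C" "Src C (decA S x) \<in> S" "Tgt C (decA S x) \<in> S" "encA S (decA S x) = x"
  using assms by (auto elim!: full_ArE)

lemma decO_simps:
  assumes "a \<in> encO S ` S"
  shows "decO S a \<in> S" "encO S (decO S a) = a"
  using assms by auto

lemma Hom_full: "Hom \<b> (encO S A) (encO S B) = encA S ` Hom C A B" if "A \<in> S" "B \<in> S"
proof (intro equalityI subsetI)
  fix x assume "x \<in> Hom \<b> (encO S A) (encO S B)"
  then show "x \<in> encA S ` Hom C A B"
    using that by (intro image_eqI[where x = "decA S x"]) (auto simp: Hom_def)
qed (use that in \<open>auto simp: Hom_def\<close>)

lemma full_is_category: "is_category \<b>"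
  unfolding is_category_def
proof (intro conjI ballI impI)
  fix x assume x: "x \<in> Ar \<b>"
  then show "Src \<b> x \<in> Ob \<b>" "Tgt \<b> x \<in> Ob \<b>"
    "x \<cdot>\<^bsub>\<b>\<^esub> Ide \<b> (Src \<b> x) = x"
    "Ide \<b> (Tgt \<b> x) \<cdot>\<^bsub>\<b>\<^esub> x = x"
    by auto
  fix y assume y: "y \<in> Ar \<b>" "Tgt \<b> x = Src \<b> y"
  then show "y \<cdot>\<^bsub>\<b>\<^esub> x \<in> Hom \<b> (Src \<b> x) (Tgt \<b> y)"
    using x by (auto simp: Hom_def)
  fix z assume z: "z \<in> Ar \<b>" "Tgt \<b> y = Src \<b> z"
  then show "z \<cdot>\<^bsub>\<b>\<^esub> y \<cdot>\<^bsub>\<b>\<^esub> x = z \<cdot>\<^bsub>\<b>\<^esub> (y \<cdot>\<^bsub>\<b>\<^esub> x)"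
    using x y by simp
next
  fix a assume "a \<in> Ob \<b>"
  then show "Ide \<b> a \<in> Hom \<b> a a" by (auto simp: Hom_def)
qed

lemma full_hom_module:
  assumes "A \<in> S" "B \<in> S"
  shows "module k (hom_module \<b> (encO S A) (encO S B))"
proof -
  interpret M: module k "hom_module C A B" using assms by (intro hom_module) auto
  let ?N = "hom_module \<b> (encO S A) (encO S B)"
  have M [simp]: "carrier (hom_module C A B) = Hom C A B" "zero (hom_module C A B) = ArZero C A B"
    "add (hom_module C A B) = ArAdd C" "smult (hom_module C A B) = ArSmult C"
    by (simp_all add: hom_module_def)
  have N [simp]: "carrier ?N = encA S ` Hom C A B" "zero ?N = encA S (ArZero C A B)"
    "add ?N = ArAdd \<b>" "smult ?N = ArSmult \<b>"
    using assms by (simp_all add: hom_module_def Hom_full)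
  have AB: "A \<in> Ob C" "B \<in> Ob C" using assms by auto
  note H = zero_Hom[OF AB] add_Hom[OF AB] smult_Hom[OF AB] neg_Hom[OF AB]
  have dec [simp]: "decA S (encA S f) = f" if "f \<in> Hom C A B" for f
    using that assms by (auto simp: Hom_def)
  show ?thesis
  proof (rule moduleI)
    show "abelian_group ?N"
    proof (rule abelian_groupI)
      fix x assume "x \<in> carrier ?N"
      then obtain f where f: "f \<in> Hom C A B" "x = encA S f" by auto
      show "\<exists>y \<in> carrier ?N. y \<oplus>\<^bsub>?N\<^esub> x = \<zero>\<^bsub>?N\<^esub>"
        by (rule bexI[of _ "encA S (neg f)"])
          (use f H add_neg'[OF AB f(1)] add_comm'[OF AB, of f "neg f"] in auto)
    qed (use H add_comm'[OF AB] add_assoc'[OF AB] zero_add'[OF AB] in auto)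
  qed (use H M.smult_l_distr M.smult_r_distr M.smult_assoc1 M.smult_one in \<open>auto simp: M.R.is_cring\<close>)
qed

lemma full_lin_category: "lin_category k \<b>"
  unfolding lin_category_def
proof (intro conjI full_is_category ballI)
  fix a b assume "a \<in> Ob \<b>" "b \<in> Ob \<b>"
  then show "module k (hom_module \<b> a b)" using full_hom_module by auto
  fix d assume "d \<in> Ob \<b>"
  fix f g assume "f \<in> Hom \<b> a b" "g \<in> Hom \<b> b d"
  then have fg: "f \<in> Ar \<b>" "g \<in> Ar \<b>" "Tgt C (decA S f) = Src C (decA S g)"
    by (auto simp: Hom_def)
  show "g \<cdot>\<^bsub>\<b>\<^esub> ArSmult \<b> r f = ArSmult \<b> r (g \<cdot>\<^bsub>\<b>\<^esub> f)"
    "ArSmult \<b> r g \<cdot>\<^bsub>\<b>\<^esub> f = ArSmult \<b> r (g \<cdot>\<^bsub>\<b>\<^esub> f)"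
    if "r \<in> carrier k" for r
    using fg that by (simp_all add: Cmp_smult smult_Cmp)
next
  fix a b d f f' g g' assume "a \<in> Ob \<b>" "b \<in> Ob \<b>" "d \<in> Ob \<b>"
    "f \<in> Hom \<b> a b" "f' \<in> Hom \<b> a b" "g \<in> Hom \<b> b d" "g' \<in> Hom \<b> b d"
  then have "f \<in> Ar \<b>" "g \<in> Ar \<b>" "f' \<in> Ar \<b>" "g' \<in> Ar \<b>"
    "Tgt C (decA S f) = Src C (decA S g)" "Tgt C (decA S f') = Src C (decA S g)" "Src C (decA S g') = Src C (decA S g)"
    "Src C (decA S f) = Src C (decA S f')" "Tgt C (decA S g) = Tgt C (decA S g')"
    by (auto simp: Hom_def)
  then show "g \<cdot>\<^bsub>\<b>\<^esub> ArAdd \<b> f f' = ArAdd \<b> (g \<cdot>\<^bsub>\<b>\<^esub> f) (g \<cdot>\<^bsub>\<b>\<^esub> f')"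
    "ArAdd \<b> g g' \<cdot>\<^bsub>\<b>\<^esub> f = ArAdd \<b> (g \<cdot>\<^bsub>\<b>\<^esub> f) (g' \<cdot>\<^bsub>\<b>\<^esub> f)"
    by (simp_all add: Cmp_add add_Cmp)
qed

lemma full_lin_functor: "lin_functor k \<b> C (full_func S)"
  unfolding lin_functor_def
proof (intro conjI ballI)
  show "is_functor \<b> C (full_func S)"
  proof (rule is_functorI)
    show "FO (full_func S) \<in> extensional (Ob \<b>)" "FA (full_func S) \<in> extensional (Ar \<b>)"
      by (simp_all add: full_func_def)
  qed (auto simp: Hom_def)
qed (auto simp: Hom_def)

sublocale full: linear_functor \<b> C k "full_func S"
  by (intro linear_functorI full_lin_category linear full_lin_functor)

lemma arrows_to_full: "A \<in> S \<Longrightarrow> P \<subseteq> arrows_to \<b> (encO S A) \<Longrightarrow> decA S ` P \<subseteq> arrows_to C A"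
  by (auto simp: arrows_to_def)

lemma FA_image: "P \<subseteq> arrows_to \<b> a \<Longrightarrow> FA (full_func S) ` P = decA S ` P"
  by (intro image_cong) (auto simp: arrows_to_def)

lemma full_cover_iff:
  "A \<in> S \<Longrightarrow> R \<in> full_top S (encO S A) \<longleftrightarrow> lin_sieve k \<b> (encO S A) R \<and> jointly_epi C A (decA S ` R)"
  by (simp add: full_top_def)

text \<open>Stability under pullback is \<open>jointly_epi_pullback\<close>, applied to the decoded
  sieve, which consists of arrows with source in \<open>S\<close> only. Transitivity is
  \<open>jointly_epi_trans\<close>, and the maximal sieve contains an identity.\<close>

lemma full_grothendieck_topology: "grothendieck_topology k \<b> (full_top S)"
  unfolding grothendieck_topology_def
proof (intro conjI ballI allI impI)
  show "full_top S \<in> (\<Pi>\<^sub>E A \<in> Ob \<b>. {\<R>. \<R> \<subseteq> {R. lin_sieve k \<b> A R}})"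
    by (auto simp: full_top_def)
next
  fix a assume "a \<in> Ob \<b>"
  then obtain A where A [simp]: "a = encO S A" "A \<in> S" by auto
  have "encA S (Ide C A) \<in> arrows_to \<b> a" by (simp add: arrows_to_def)
  then have "Ide C A \<in> decA S ` arrows_to \<b> a" by (rule rev_image_eqI) simp
  then show "arrows_to \<b> a \<in> full_top S a"
    using full.X.lin_sieve_arrows_to[of a] by (simp add: full_cover_iff jointly_epi_Ide)
next
  fix a R g assume a: "a \<in> Ob \<b>" and R: "R \<in> full_top S a" and g: "g \<in> arrows_to \<b> a"
  obtain A where A [simp]: "a = encO S A" "A \<in> S" using a by auto
  have R': "lin_sieve k \<b> a R" "jointly_epi C A (decA S ` R)" using R by (simp_all add: full_cover_iff)
  have g' [simp]: "g \<in> Ar \<b>" "Tgt C (decA S g) = A" using g by (auto simp: arrows_to_def)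
  have RD: "r \<in> Ar \<b>" "Tgt C (decA S r) = A" if "r \<in> R" for r
    using full.X.lin_sieveD[OF R'(1) a that] by auto
  have "jointly_epi C (Src C (decA S g)) {f \<in> arrows_to C (Src C (decA S g)). Src C f \<in> S \<and> decA S g \<cdot> f \<in> decA S ` R}"
  proof (rule jointly_epi_pullback[OF _ S_small S_epi])
    show "r \<in> Ar C \<and> Tgt C r = A \<and> Src C r \<in> S" if "r \<in> decA S ` R" for r
      using that RD by auto
    show "ArZero C B A \<in> decA S ` R" if "B \<in> S" for B
      using full.X.lin_sieve_zero[OF R'(1) a, of "encO S B"] that
      by (intro rev_image_eqI[of "encA S (ArZero C B A)"]) auto
    show "r \<^bold>+ r' \<in> decA S ` R" if rr: "r \<in> decA S ` R" "r' \<in> decA S ` R" "Src C r = Src C r'" for r r'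
    proof -
      obtain x y where xy: "x \<in> R" "y \<in> R" "r = decA S x" "r' = decA S y" using rr by auto
      have "ArAdd \<b> x y \<in> R"
        using xy rr(3) by (intro full.X.lin_sieve_add[OF R'(1) a]) auto
      then show ?thesis
        by (rule rev_image_eqI) (use xy rr(3) RD in auto)
    qed
    show "r \<cdot> y \<in> decA S ` R" if ry: "r \<in> decA S ` R" "y \<in> Ar C" "Tgt C y = Src C r" "Src C y \<in> S" for r y
    proof -
      obtain x where x: "x \<in> R" "r = decA S x" using ry by auto
      have "x \<cdot>\<^bsub>\<b>\<^esub> encA S y \<in> R"
        using x ry RD[OF x(1)] by (intro full.X.lin_sieve_Cmp[OF R'(1) a]) auto
      then show ?thesis
        by (rule rev_image_eqI) (use x ry RD[OF x(1)] in auto)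
    qed
    show "jointly_epi C A (decA S ` R)" by (rule R'(2))
    show "decA S g \<in> Hom C (Src C (decA S g)) A" by (simp add: Hom_def)
  qed auto
  moreover have "{f \<in> arrows_to C (Src C (decA S g)). Src C f \<in> S \<and> decA S g \<cdot> f \<in> decA S ` R} \<subseteq>
      decA S ` pullback_sieve \<b> g R"
  proof
    fix f assume "f \<in> {f \<in> arrows_to C (Src C (decA S g)). Src C f \<in> S \<and> decA S g \<cdot> f \<in> decA S ` R}"
    then obtain x where f: "f \<in> Ar C" "Tgt C f = Src C (decA S g)" "Src C f \<in> S" and x: "x \<in> R" "decA S g \<cdot> f = decA S x"
      by (auto simp: arrows_to_def)
    have "g \<cdot>\<^bsub>\<b>\<^esub> encA S f = x" using f x RD[OF x(1)] by simp
    then have "encA S f \<in> pullback_sieve \<b> g R"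
      using f x by (simp add: pullback_sieve_def arrows_to_def)
    then show "f \<in> decA S ` pullback_sieve \<b> g R"
      by (rule rev_image_eqI) (use f in simp)
  qed
  ultimately have "jointly_epi C (Src C (decA S g)) (decA S ` pullback_sieve \<b> g R)"
    by (rule jointly_epi_mono)
  then show "pullback_sieve \<b> g R \<in> full_top S (Src \<b> g)"
    using full.X.lin_sieve_pullback[OF R'(1), of g] by (simp add: full_cover_iff)
next
  fix a R V assume a: "a \<in> Ob \<b>" and V: "V \<in> full_top S a" and R: "lin_sieve k \<b> a R"
    and pb: "\<forall>g \<in> V. pullback_sieve \<b> g R \<in> full_top S (Src \<b> g)"
  obtain A where A [simp]: "a = encO S A" "A \<in> S" using a by auto
  have V': "lin_sieve k \<b> a V" "jointly_epi C A (decA S ` V)" using V by (simp_all add: full_cover_iff)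
  have sub: "V \<subseteq> arrows_to \<b> (encO S A)" "R \<subseteq> arrows_to \<b> (encO S A)"
    using V' R by (auto simp: lin_sieve_def)
  have "jointly_epi C A (decA S ` R)"
  proof (rule jointly_epi_trans[OF V'(2)])
    show "decA S ` V \<subseteq> arrows_to C A" "decA S ` R \<subseteq> arrows_to C A"
      using sub arrows_to_full by auto
    fix p assume "p \<in> decA S ` V"
    then obtain g where g: "g \<in> V" "p = decA S g" by auto
    have g' [simp]: "g \<in> Ar \<b>" using g sub by (auto simp: arrows_to_def)
    let ?Q = "pullback_sieve \<b> g R"
    have Q: "?Q \<subseteq> arrows_to \<b> (encO S (Src C (decA S g)))"
      by (auto simp: pullback_sieve_def)
    have "jointly_epi C (Src C p) (decA S ` ?Q)"
      using bspec[OF pb g(1)] g(2) by (simp add: full_cover_iff)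
    moreover have "decA S ` ?Q \<subseteq> arrows_to C (Src C p)"
      using arrows_to_full[OF _ Q] g by simp
    moreover have "p \<cdot> r \<in> decA S ` R" if r: "r \<in> decA S ` ?Q" for r
    proof -
      obtain x where xQ: "x \<in> ?Q" "r = decA S x" using r by auto
      then have x: "x \<in> Ar \<b>" "Tgt C (decA S x) = Src C (decA S g)" "g \<cdot>\<^bsub>\<b>\<^esub> x \<in> R" "r = decA S x"
        by (auto simp: pullback_sieve_def arrows_to_def)
      show ?thesis by (rule rev_image_eqI[OF x(3)]) (use x g in simp)
    qed
    ultimately show "\<exists>Q \<subseteq> arrows_to C (Src C p). jointly_epi C (Src C p) Q \<and> (\<forall>r \<in> Q. p \<cdot> r \<in> decA S ` R)"
      by blast
  qed
  then show "R \<in> full_top S a" using R by (simp add: full_cover_iff)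
qed

lemma full_maximal_covering:
  assumes "a \<in> Ob \<b>"
  shows "covering_family k \<b> (full_top S) a (arrows_to \<b> a)"
proof -
  have "arrows_to \<b> a \<in> full_top S a"
    using full_grothendieck_topology assms by (auto simp: grothendieck_topology_def)
  moreover have "generated_sieve k \<b> a (arrows_to \<b> a) = arrows_to \<b> a"
    using full.X.lin_sieve_arrows_to[OF assms] full.X.lin_sieve_generated(2)[OF assms order_refl]
    by (auto simp: generated_sieve_def)
  ultimately show ?thesis by (simp add: covering_family_def)
qed

text \<open>The functor is full and faithful, so in (F) and (FF) the maximal family serves as the
  covering. (G) is the assumption that \<open>S\<close> is generating, and the clause on topologies
  holds by the choice of \<open>full_top\<close>.\<close>

lemma full_LC: "LC_morphism k \<b> (full_top S) C (canonical_topology k C) (full_func S)"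
  unfolding LC_morphism_def
proof (intro conjI ballI allI impI full_lin_functor)
  fix B assume B: "B \<in> Ob C"
  let ?P = "{f \<in> arrows_to C B. Src C f \<in> S}"
  have "covering_family k C (canonical_topology k C) B ?P"
    using S_epi[OF B] by (auto simp: covering_family_canonical[OF B])
  moreover have "\<exists>A \<in> Ob \<b>. Src C p = FO (full_func S) A" if "p \<in> ?P" for p
    using that by (intro bexI[of _ "encO S (Src C p)"]) auto
  ultimately show "\<exists>P. covering_family k C (canonical_topology k C) B P \<and>
      (\<forall>p \<in> P. \<exists>A \<in> Ob \<b>. Src C p = FO (full_func S) A)"
    by blast
next
  fix a R assume a: "a \<in> Ob \<b>" and R: "lin_sieve k \<b> a R"
  obtain A where A: "a = encO S A" "A \<in> S" using a by auto
  have sub: "R \<subseteq> arrows_to \<b> a" using R by (simp add: lin_sieve_def)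
  then show "R \<in> full_top S a \<longleftrightarrow>
      covering_family k C (canonical_topology k C) (FO (full_func S) a) (FA (full_func S) ` R)"
    using A R arrows_to_full[of A R] by (simp add: FA_image[OF sub] full_cover_iff covering_family_canonical)
next
  fix a b c assume ab: "a \<in> Ob \<b>" "b \<in> Ob \<b>"
    and c: "c \<in> Hom C (FO (full_func S) a) (FO (full_func S) b)"
  obtain A B where A: "a = encO S A" "A \<in> S" "b = encO S B" "B \<in> S" using ab by auto
  have c': "c \<in> Hom C A B" using c A by simp
  have "\<exists>h \<in> Hom \<b> (Src \<b> p) b. c \<cdot> FA (full_func S) p = FA (full_func S) h"
    if "p \<in> arrows_to \<b> a" for p
    using that A c' by (intro bexI[of _ "encA S (c \<cdot> decA S p)"]) (auto simp: arrows_to_def Hom_def)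
  then show "\<exists>P. covering_family k \<b> (full_top S) a P \<and>
      (\<forall>p \<in> P. \<exists>h \<in> Hom \<b> (Src \<b> p) b. c \<cdot> FA (full_func S) p = FA (full_func S) h)"
    using full_maximal_covering[OF ab(1)] by blast
next
  fix a b c assume ab: "a \<in> Ob \<b>" "b \<in> Ob \<b>" and c: "c \<in> Hom \<b> a b"
    and c0: "FA (full_func S) c = ArZero C (FO (full_func S) a) (FO (full_func S) b)"
  obtain A B where A: "a = encO S A" "A \<in> S" "b = encO S B" "B \<in> S" using ab by auto
  have c': "c \<in> Ar \<b>" using c by (simp add: Hom_def)
  then have "encA S (decA S c) = encA S (ArZero C A B)" using c0 A by simp
  then have c_eq: "c = ArZero \<b> a b" using c' A by simp
  have "c \<cdot>\<^bsub>\<b>\<^esub> p = ArZero \<b> (Src \<b> p) b"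
    if "p \<in> arrows_to \<b> a" for p
    using that ab unfolding c_eq arrows_to_def by (auto intro!: full.X.zero_Cmp simp del: full_ops)
  then show "\<exists>P. covering_family k \<b> (full_top S) a P \<and>
      (\<forall>p \<in> P. c \<cdot>\<^bsub>\<b>\<^esub> p = ArZero \<b> (Src \<b> p) b)"
    using full_maximal_covering[OF ab(1)] by blast
qed

lemma is_presentation_full: "is_presentation U k C (full_presentation S)"
proof -
  have "S \<subseteq> Ob C" by auto
  then have "small_category U \<b>"
    using full_is_category encO(2) encA(2) small_image[OF S_small]
      small_image[OF small_full_arrows[OF _ S_small]]
    by (auto simp: small_category_def Ar_full)
  then show ?thesis
    using full_lin_category full_grothendieck_topology full_LC
    by (simp add: is_presentation_def full_presentation_def small_lin_site_def)
qed

definition into_full :: "('u, 'u, 'k) lincat \<Rightarrow> ('u, 'u, 'o, 'm) func \<Rightarrow> ('u, 'u, 'u, 'u) func" where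
  "into_full \<a> u = \<lparr> FO = (\<lambda>A \<in> Ob \<a>. encO S (FO u A)), FA = (\<lambda>f \<in> Ar \<a>. encA S (FA u f)) \<rparr>"

text \<open>\<open>into_full\<close> is \<open>u\<close> with its values replaced by their codes. By
  \<open>is_presentation_arrow_iff\<close> two covering conditions remain: (G) holds because the
  values of \<open>u\<close> already cover every object of \<open>C\<close>, and (F) is the local
  fullness of \<open>u\<close>.\<close>

lemma into_full_arrow:
  assumes "is_presentation U k C (\<a>, T, u)" and sub: "FO u ` Ob \<a> \<subseteq> S"
  shows "is_presentation_arrow k (\<a>, T, u) (into_full \<a> u) (full_presentation S)"
proof -
  interpret presentation C k U \<a> T u using assms(1) by unfold_locales
  have S [simp]: "FO u A \<in> S" if "A \<in> Ob \<a>" for A using that sub by auto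
  have into [simp]: "A \<in> Ob \<a> \<Longrightarrow> FO (into_full \<a> u) A = encO S (FO u A)"
    "f \<in> Ar \<a> \<Longrightarrow> FA (into_full \<a> u) f = encA S (FA u f)" for A f
    by (simp_all add: into_full_def)
  have ext: "FO (into_full \<a> u) \<in> extensional (Ob \<a>)" "FA (into_full \<a> u) \<in> extensional (Ar \<a>)"
    by (simp_all add: into_full_def)
  have lin: "lin_functor k \<a> \<b> (into_full \<a> u)"
    unfolding lin_functor_def
  proof (intro conjI ballI)
    show "is_functor \<a> \<b> (into_full \<a> u)"
      by (rule is_functorI) (use ext in \<open>auto simp: Hom_def\<close>)
  qed (auto simp: Hom_def)
  show ?thesis
    unfolding full_presentation_def
      is_presentation_arrow_iff[OF assms(1) is_presentation_full[unfolded full_presentation_def]]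
  proof (intro conjI lin ballI)
    show "comp_func \<a> (full_func S) (into_full \<a> u) = u"
      by (rule func_eqI[where A = "Ob \<a>" and B = "Ar \<a>"]) (auto simp: FO_ext FA_ext)
  next
    fix b assume "b \<in> Ob \<b>"
    then obtain B where B: "b = encO S B" "B \<in> S" by auto
    have "{f \<in> arrows_to C B. Src C f \<in> FO u ` Ob \<a>} \<subseteq>
        FA (full_func S) ` {g \<in> arrows_to \<b> b. Src \<b> g \<in> FO (into_full \<a> u) ` Ob \<a>}"
    proof
      fix f assume "f \<in> {f \<in> arrows_to C B. Src C f \<in> FO u ` Ob \<a>}"
      then show "f \<in> FA (full_func S) ` {g \<in> arrows_to \<b> b. Src \<b> g \<in> FO (into_full \<a> u) ` Ob \<a>}"
        using B by (intro rev_image_eqI[of "encA S f"]) (auto simp: arrows_to_def)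
    qed
    then show "jointly_epi C (FO (full_func S) b)
       (FA (full_func S) ` {g \<in> arrows_to \<b> b. Src \<b> g \<in> FO (into_full \<a> u) ` Ob \<a>})"
      using locally_generating[of B] B by (auto elim: jointly_epi_mono)
  next
    fix A A' c assume A: "A \<in> Ob \<a>" "A' \<in> Ob \<a>"
      and c: "c \<in> Hom \<b> (FO (into_full \<a> u) A) (FO (into_full \<a> u) A')"
    have c': "c \<in> Ar \<b>" "Src C (decA S c) = FO u A" "Tgt C (decA S c) = FO u A'"
      using c A by (auto simp: Hom_def)
    have "jointly_epi C (FO u A) (FA u ` {p \<in> arrows_to \<a> A. \<exists>h \<in> Hom \<a> (Src \<a> p) A'. decA S c \<cdot> FA u p = FA u h})"
      using A c' by (intro locally_full) (auto simp: Hom_def)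
    then show "jointly_epi C (FO u A) (FA u ` {p \<in> arrows_to \<a> A. \<exists>h \<in> Hom \<a> (Src \<a> p) A'.
        c \<cdot>\<^bsub>\<b>\<^esub> FA (into_full \<a> u) p = FA (into_full \<a> u) h})"
    proof (rule jointly_epi_mono, intro image_mono subsetI)
      fix p assume "p \<in> {p \<in> arrows_to \<a> A. \<exists>h \<in> Hom \<a> (Src \<a> p) A'. decA S c \<cdot> FA u p = FA u h}"
      then obtain h where p: "p \<in> Ar \<a>" "Tgt \<a> p = A" "h \<in> Hom \<a> (Src \<a> p) A'" "decA S c \<cdot> FA u p = FA u h"
        by (auto simp: arrows_to_def)
      then show "p \<in> {p \<in> arrows_to \<a> A. \<exists>h \<in> Hom \<a> (Src \<a> p) A'.
          c \<cdot>\<^bsub>\<b>\<^esub> FA (into_full \<a> u) p = FA (into_full \<a> u) h}"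
        by (auto simp: arrows_to_def Hom_def intro!: exI[of _ h])
    qed
  qed
qed

text \<open>Decoding is injective on objects and on arrows, so the strict equation
  \<open>comp_func \<a> (full_func S) f = u\<close> leaves no choice for \<open>f\<close>.\<close>

lemma into_full_unique:
  assumes "is_presentation U k C p" "is_presentation_arrow k p f (full_presentation S)"
  shows "f = into_full (fst p) (snd (snd p))"
proof -
  obtain \<a> T u where p [simp]: "p = (\<a>, T, u)" by (cases p) auto
  interpret presentation C k U \<a> T u using assms(1) by unfold_locales simp
  have lin: "lin_functor k \<a> \<b> f" and comm: "comp_func \<a> (full_func S) f = u"
    using assms(2) by (auto simp: is_presentation_arrow_def full_presentation_def LC_morphism_def)
  interpret f: linear_functor \<a> \<b> k f
    by (intro linear_functorI X.linear full_lin_category lin)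
  show ?thesis
  proof (rule func_eqI[where A = "Ob \<a>" and B = "Ar \<a>"])
    show "FO f x = FO (into_full (fst p) (snd (snd p))) x" if x: "x \<in> Ob \<a>" for x
      using f.FO_Ob[OF x] decO_simps[of "FO f x"] x by (simp add: into_full_def flip: comm)
    show "FA f x = FA (into_full (fst p) (snd (snd p))) x" if x: "x \<in> Ar \<a>" for x
      using f.FA_Ar[OF x] x by (simp add: into_full_def flip: comm)
  qed (simp_all add: f.FO_ext f.FA_ext into_full_def)
qed

end

section \<open>The category of site presentations\<close>

context grothendieck_cat
begin

abbreviation SP :: "(('u, 'o, 'm, 'k) presentation, ('u, 'o, 'm, 'k) presentation_arrow) cat" where
  "SP \<equiv> site_presentations U k C"

lemma SP_simps [simp]:
  "p \<in> Ob SP \<longleftrightarrow> is_presentation U k C p"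
  "(p, f, q) \<in> Ar SP \<longleftrightarrow> is_presentation U k C p \<and> is_presentation U k C q \<and> is_presentation_arrow k p f q"
  "Src SP (p, f, q) = p" "Tgt SP (p, f, q) = q" "Ide SP p = (p, id_func (fst p), p)"
  "(p', g, q') \<cdot>\<^bsub>SP\<^esub> (p, f, q) = (p, comp_func (fst p) g f, q')"
  by (simp_all add: site_presentations_def)

text \<open>Each family to be tested contains the image of an identity arrow.\<close>

lemma presentation_arrow_id:
  assumes "is_presentation U k C p"
  shows "is_presentation_arrow k p (id_func (fst p)) p"
proof -
  obtain \<a> T u where p [simp]: "p = (\<a>, T, u)" by (cases p) auto
  interpret presentation C k U \<a> T u using assms by unfold_locales simp
  interpret id: linear_functor \<a> \<a> k "id_func \<a>" by (rule linear_functor_id) unfold_locales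
  have "is_presentation_arrow k (\<a>, T, u) (id_func \<a>) (\<a>, T, u)"
    unfolding is_presentation_arrow_iff[OF presentation presentation]
  proof (intro conjI ballI id.lin_functor)
    show "comp_func \<a> u (id_func \<a>) = u" by (rule comp_func_id(1)) unfold_locales
    fix A assume A: "A \<in> Ob \<a>"
    have "Ide C (FO u A) \<in> FA u ` {g \<in> arrows_to \<a> A. Src \<a> g \<in> FO (id_func \<a>) ` Ob \<a>}"
      using A by (intro image_eqI[of _ _ "Ide \<a> A"]) (auto simp: arrows_to_def image_iff)
    then show "jointly_epi C (FO u A) (FA u ` {g \<in> arrows_to \<a> A. Src \<a> g \<in> FO (id_func \<a>) ` Ob \<a>})"
      using A by (intro jointly_epi_Ide) auto
    fix A' c assume "A' \<in> Ob \<a>" "c \<in> Hom \<a> (FO (id_func \<a>) A) (FO (id_func \<a>) A')"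
    then have c: "c \<in> Ar \<a>" "Src \<a> c = A" "Tgt \<a> c = A'" using A by (auto simp: Hom_def)
    have "Ide C (FO u A) \<in> FA u ` {p \<in> arrows_to \<a> A. \<exists>h \<in> Hom \<a> (Src \<a> p) A'.
        c \<cdot>\<^bsub>\<a>\<^esub> FA (id_func \<a>) p = FA (id_func \<a>) h}"
      using A c by (intro image_eqI[of _ _ "Ide \<a> A"]) (auto simp: arrows_to_def Hom_def intro!: exI[of _ c])
    then show "jointly_epi C (FO u A) (FA u ` {p \<in> arrows_to \<a> A. \<exists>h \<in> Hom \<a> (Src \<a> p) A'.
        c \<cdot>\<^bsub>\<a>\<^esub> FA (id_func \<a>) p = FA (id_func \<a>) h})"
      using A by (intro jointly_epi_Ide) auto
  qed
  then show ?thesis by simp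
qed

lemma presentation_lin_category: "is_presentation U k C p \<Longrightarrow> lin_category k (fst p)"
  by (cases p) (simp add: is_presentation_def small_lin_site_def)

lemma presentation_lin_functor: "is_presentation U k C p \<Longrightarrow> lin_functor k (fst p) C (snd (snd p))"
  by (cases p) (simp add: is_presentation_def LC_morphism_def)

lemma presentation_arrow_lin_functor: "is_presentation_arrow k p f q \<Longrightarrow> lin_functor k (fst p) (fst q) f"
  by (cases p, cases q) (simp add: is_presentation_arrow_def LC_morphism_def)

lemma presentation_arrow_comm:
  "is_presentation_arrow k p f q \<Longrightarrow> comp_func (fst p) (snd (snd q)) f = snd (snd p)"
  by (cases p, cases q) (simp add: is_presentation_arrow_def)

lemma presentation_arrow_functor:
  assumes "is_presentation U k C p" "is_presentation U k C q" "is_presentation_arrow k p f q"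
  shows "functor_between (fst p) (fst q) f"
  using linear_functorI[OF presentation_lin_category[OF assms(1)] presentation_lin_category[OF assms(2)]
      presentation_arrow_lin_functor[OF assms(3)]]
  by (simp add: linear_functor_def)

lemma SP_category: "is_category SP"
  unfolding is_category_def
proof (intro conjI ballI impI)
  fix x assume x: "x \<in> Ar SP"
  obtain p f q where x_eq [simp]: "x = (p, f, q)" by (cases x) auto
  have f: "is_presentation U k C p" "is_presentation U k C q" "is_presentation_arrow k p f q" using x by auto
  note F = presentation_arrow_functor[OF f]
  show "Src SP x \<in> Ob SP" "Tgt SP x \<in> Ob SP" using f by auto
  show "x \<cdot>\<^bsub>SP\<^esub> Ide SP (Src SP x) = x" "Ide SP (Tgt SP x) \<cdot>\<^bsub>SP\<^esub> x = x"
    using comp_func_id[OF F] by simp_all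
  fix y assume y: "y \<in> Ar SP" "Tgt SP x = Src SP y"
  obtain g r where y_eq [simp]: "y = (q, g, r)" using y by (cases y) auto
  have g: "is_presentation U k C q" "is_presentation U k C r" "is_presentation_arrow k q g r" using y by auto
  note G = presentation_arrow_functor[OF g]
  show "y \<cdot>\<^bsub>SP\<^esub> x \<in> Hom SP (Src SP x) (Tgt SP y)"
    using f g presentation_arrow_comp[OF f(1,2) g(2) f(3) g(3)] by (simp add: Hom_def)
  fix z assume z: "z \<in> Ar SP" "Tgt SP y = Src SP z"
  obtain h t where [simp]: "z = (r, h, t)" using z by (cases z) auto
  show "z \<cdot>\<^bsub>SP\<^esub> y \<cdot>\<^bsub>SP\<^esub> x = z \<cdot>\<^bsub>SP\<^esub> (y \<cdot>\<^bsub>SP\<^esub> x)"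
    by (simp add: comp_func_assoc[OF F G])
next
  fix p assume "p \<in> Ob SP"
  then show "Ide SP p \<in> Hom SP p p" using presentation_arrow_id by (simp add: Hom_def)
qed

lemma full_presentation_Ob: "generating S \<Longrightarrow> full_presentation S \<in> Ob SP"
proof -
  assume "generating S"
  then interpret full_subcategory C k U S by unfold_locales
  show ?thesis using is_presentation_full by simp
qed

lemma Hom_full_presentation:
  assumes "p \<in> Ob SP" "generating S" "FO (snd (snd p)) ` Ob (fst p) \<subseteq> S"
  shows "Hom SP p (full_presentation S) \<noteq> {}"
proof -
  interpret full_subcategory C k U S using assms(2) by unfold_locales
  obtain \<a> T u where p: "p = (\<a>, T, u)" by (cases p) auto
  have "(p, into_full \<a> u, full_presentation S) \<in> Hom SP p (full_presentation S)"
    using into_full_arrow[of \<a> T u] assms is_presentation_full by (simp add: Hom_def p)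
  then show ?thesis by blast
qed

lemma Hom_full_presentation_unique:
  assumes "generating S" "x \<in> Hom SP p (full_presentation S)" "y \<in> Hom SP p (full_presentation S)"
  shows "x = y"
proof -
  interpret full_subcategory C k U S using assms(1) by unfold_locales
  obtain f g where "x = (p, f, full_presentation S)" "y = (p, g, full_presentation S)"
    using assms(2,3) by (cases x; cases y) (auto simp: Hom_def)
  then show ?thesis
    using assms(2,3) into_full_unique[of p f] into_full_unique[of p g] by (simp add: Hom_def)
qed

lemma presentation_image_generating: "p \<in> Ob SP \<Longrightarrow> generating (FO (snd (snd p)) ` Ob (fst p))"
  using presentation_generating by (cases p) auto

text \<open>The union of the two sets of values is again a small generating set, and both
  presentations take values in it.\<close>

lemma SP_upper:
  assumes "p \<in> Ob SP" "q \<in> Ob SP"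
  shows "\<exists>S. generating S \<and> Hom SP p (full_presentation S) \<noteq> {} \<and> Hom SP q (full_presentation S) \<noteq> {}"
proof -
  let ?S = "FO (snd (snd p)) ` Ob (fst p) \<union> FO (snd (snd q)) ` Ob (fst q)"
  have "generating ?S" using assms by (intro generating_Un presentation_image_generating)
  then show ?thesis
    using Hom_full_presentation[OF assms(1)] Hom_full_presentation[OF assms(2)] by blast
qed

text \<open>Parallel arrows into \<open>q\<close> are equalized by any arrow from \<open>q\<close>
  to a full presentation, since both composites are the unique arrow into that one.\<close>

lemma SP_filtered: "filtered_category SP"
  unfolding filtered_category_def
proof (intro conjI ballI SP_category)
  show "Ob SP \<noteq> {}" using ex_generating full_presentation_Ob by blast
  show "\<exists>l \<in> Ob SP. Hom SP p l \<noteq> {} \<and> Hom SP q l \<noteq> {}" if "p \<in> Ob SP" "q \<in> Ob SP" for p q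
    using SP_upper[OF that] full_presentation_Ob by blast
  fix p q f g assume p: "p \<in> Ob SP" and q: "q \<in> Ob SP" and fg: "f \<in> Hom SP p q" "g \<in> Hom SP p q"
  interpret SP: category SP by unfold_locales (rule SP_category)
  \<comment> \<open>Taking \<open>q\<close> twice in \<open>SP_upper\<close> yields an arrow from
    \<open>q\<close> to a full presentation.\<close>
  obtain S h where S: "generating S" "h \<in> Hom SP q (full_presentation S)"
    using SP_upper[OF q q] by blast
  have "h \<cdot>\<^bsub>SP\<^esub> f = h \<cdot>\<^bsub>SP\<^esub> g"
    using SP.Cmp_Hom fg S by (intro Hom_full_presentation_unique[OF S(1), of _ p]) blast+
  then show "\<exists>l \<in> Ob SP. \<exists>h \<in> Hom SP q l. h \<cdot>\<^bsub>SP\<^esub> f = h \<cdot>\<^bsub>SP\<^esub> g"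
    using S full_presentation_Ob by blast
qed

end

section \<open>A criterion for strict filtered bicolimits\<close>

text \<open>
  For \<open>n \<in> N\<close>, the category \<open>X n\<close> is a full subcategory of \<open>C\<close>. As such indices are cofinal and receive
  at most one arrow from any index, all comparisons between the \<open>X i\<close> can be made inside \<open>C\<close>.
\<close>

locale full_cocone =
  I: category I + C: linear_category C k
  for I :: "('i, 'a) cat" and C :: "('o, 'm, 'k) lincat" and k :: "'k ring" +
  fixes X :: "'i \<Rightarrow> ('x, 'y, 'k) lincat" and \<phi> :: "'a \<Rightarrow> ('x, 'y, 'x, 'y) func"
    and u :: "'i \<Rightarrow> ('x, 'y, 'o, 'm) func" and N :: "'i set"
  assumes filtered: "filtered_category I"
    and X: "\<And>i. i \<in> Ob I \<Longrightarrow> lin_category k (X i)"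
    and \<phi>: "\<And>a. a \<in> Ar I \<Longrightarrow> lin_functor k (X (Src I a)) (X (Tgt I a)) (\<phi> a)"
    and \<phi>_Ide: "\<And>i. i \<in> Ob I \<Longrightarrow> \<phi> (Ide I i) = id_func (X i)"
    and \<phi>_Cmp: "\<And>a b. a \<in> Ar I \<Longrightarrow> b \<in> Ar I \<Longrightarrow> Tgt I a = Src I b \<Longrightarrow>
      \<phi> (b \<cdot>\<^bsub>I\<^esub> a) = comp_func (X (Src I a)) (\<phi> b) (\<phi> a)"
    and u: "\<And>i. i \<in> Ob I \<Longrightarrow> lin_functor k (X i) C (u i)"
    and u_\<phi>: "\<And>a. a \<in> Ar I \<Longrightarrow> comp_func (X (Src I a)) (u (Tgt I a)) (\<phi> a) = u (Src I a)"
    and N_Ob: "N \<subseteq> Ob I"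
    and N_inj: "\<And>n. n \<in> N \<Longrightarrow> inj_on (FO (u n)) (Ob (X n))"
    and N_faithful: "\<And>n. n \<in> N \<Longrightarrow> inj_on (FA (u n)) (Ar (X n))"
    and N_full: "\<And>n x y f. n \<in> N \<Longrightarrow> x \<in> Ob (X n) \<Longrightarrow> y \<in> Ob (X n) \<Longrightarrow> f \<in> Hom C (FO (u n) x) (FO (u n) y) \<Longrightarrow>
      \<exists>g \<in> Hom (X n) x y. FA (u n) g = f"
    and N_upper: "\<And>i j. i \<in> Ob I \<Longrightarrow> j \<in> Ob I \<Longrightarrow> \<exists>n \<in> N. Hom I i n \<noteq> {} \<and> Hom I j n \<noteq> {}"
    and N_unique: "\<And>i n a b. n \<in> N \<Longrightarrow> a \<in> Hom I i n \<Longrightarrow> b \<in> Hom I i n \<Longrightarrow> a = b"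
    and u_surj: "\<And>A. A \<in> Ob C \<Longrightarrow> \<exists>i \<in> Ob I. \<exists>x \<in> Ob (X i). FO (u i) x = A"
begin

abbreviation F :: "('i, 'a, 'x, 'y, 'k) psfunctor" where
  "F \<equiv> strict_psfunctor I X \<phi>"

definition cocone :: "('i, 'a, 'x, 'y, 'o, 'm) psnat" where
  "cocone = \<lparr> NObj = restrict u (Ob I), NArr = (\<lambda>a \<in> Ar I. \<lambda>x \<in> Ob (X (Src I a)). Ide C (FO (u (Src I a)) x)) \<rparr>"

lemma F_simps [simp]:
  "PObj F = X" "PArr F = \<phi>"
  "x \<in> Ob (X (Src I a)) \<Longrightarrow> PComp F b a x = Ide (X (Tgt I b)) (FO (\<phi> b) (FO (\<phi> a) x))"
  "x \<in> Ob (X i) \<Longrightarrow> PUnit F i x = Ide (X i) x"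
  "PComp F b a \<in> extensional (Ob (X (Src I a)))" "PUnit F i \<in> extensional (Ob (X i))"
  by (simp_all add: strict_psfunctor_def)

lemma X_linear_category: "i \<in> Ob I \<Longrightarrow> linear_category (X i) k"
  using X by (auto simp: linear_category_def linear_category_axioms_def category_def lin_category_def)

lemma X_category: "i \<in> Ob I \<Longrightarrow> category (X i)"
  using X_linear_category by (simp add: linear_category_def)

lemma \<phi>_functor: "a \<in> Ar I \<Longrightarrow> functor_between (X (Src I a)) (X (Tgt I a)) (\<phi> a)"
  by (rule lin_functor_between[OF X X \<phi>]) auto

lemma u_linear_functor: "i \<in> Ob I \<Longrightarrow> linear_functor (X i) C k (u i)"
  by (intro linear_functorI X u C.linear) auto

lemma u_functor: "i \<in> Ob I \<Longrightarrow> functor_between (X i) C (u i)"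
  using u_linear_functor by (simp add: linear_functor_def)

lemmas X_simps [simp] =
  category.Ide_simps[OF X_category] category.Src_Ob[OF X_category] category.Tgt_Ob[OF X_category]
  category.Cmp_Ide[OF X_category] category.Ide_Cmp[OF X_category] category.is_iso_Ide[OF X_category]
  category.Cmp_simps[OF X_category]

lemmas \<phi>_simps [simp] =
  functor_between.FO_Ob[OF \<phi>_functor] functor_between.FA_Ar[OF \<phi>_functor]
  functor_between.Src_FA[OF \<phi>_functor] functor_between.Tgt_FA[OF \<phi>_functor]
  functor_between.FA_Ide[OF \<phi>_functor]

lemmas u_simps [simp] =
  functor_between.FO_Ob[OF u_functor] functor_between.FA_Ar[OF u_functor]
  functor_between.Src_FA[OF u_functor] functor_between.Tgt_FA[OF u_functor]
  functor_between.FA_Ide[OF u_functor] functor_between.FA_Cmp[OF u_functor]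

lemma u_\<phi>_simps [simp]:
  assumes "a \<in> Ar I"
  shows "x \<in> Ob (X (Src I a)) \<Longrightarrow> FO (u (Tgt I a)) (FO (\<phi> a) x) = FO (u (Src I a)) x"
    and "f \<in> Ar (X (Src I a)) \<Longrightarrow> FA (u (Tgt I a)) (FA (\<phi> a) f) = FA (u (Src I a)) f"
  using comp_func_simps(1)[of x "X (Src I a)" "u (Tgt I a)" "\<phi> a"]
    comp_func_simps(2)[of f "X (Src I a)" "u (Tgt I a)" "\<phi> a"] u_\<phi>[OF assms] by simp_all

lemma \<phi>_Cmp_simps [simp]:
  "a \<in> Ar I \<Longrightarrow> b \<in> Ar I \<Longrightarrow> Tgt I a = Src I b \<Longrightarrow> x \<in> Ob (X (Src I a)) \<Longrightarrow>
    FO (\<phi> (b \<cdot>\<^bsub>I\<^esub> a)) x = FO (\<phi> b) (FO (\<phi> a) x)"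
  "a \<in> Ar I \<Longrightarrow> b \<in> Ar I \<Longrightarrow> Tgt I a = Src I b \<Longrightarrow> f \<in> Ar (X (Src I a)) \<Longrightarrow>
    FA (\<phi> (b \<cdot>\<^bsub>I\<^esub> a)) f = FA (\<phi> b) (FA (\<phi> a) f)"
  by (simp_all add: \<phi>_Cmp)

lemma \<phi>_Ide_simps [simp]:
  "i \<in> Ob I \<Longrightarrow> x \<in> Ob (X i) \<Longrightarrow> FO (\<phi> (Ide I i)) x = x"
  "i \<in> Ob I \<Longrightarrow> f \<in> Ar (X i) \<Longrightarrow> FA (\<phi> (Ide I i)) f = f"
  by (simp_all add: \<phi>_Ide)

lemma strict_pseudofunctor: "lin_pseudofunctor k I F"
  unfolding lin_pseudofunctor_def
proof (intro conjI ballI impI)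
  show "is_category I" by (rule I.category)
  show "lin_category k (PObj F i)" if "i \<in> Ob I" for i using that X by simp
  fix a assume a: "a \<in> Ar I"
  show "lin_functor k (PObj F (Src I a)) (PObj F (Tgt I a)) (PArr F a)" using a \<phi> by simp
  show "PComp F a (Ide I (Src I a)) x \<cdot>\<^bsub>PObj F (Tgt I a)\<^esub> FA (PArr F a) (PUnit F (Src I a) x)
          = Ide (PObj F (Tgt I a)) (FO (PArr F a) x)"
    and "PComp F (Ide I (Tgt I a)) a x \<cdot>\<^bsub>PObj F (Tgt I a)\<^esub> PUnit F (Tgt I a) (FO (PArr F a) x)
          = Ide (PObj F (Tgt I a)) (FO (PArr F a) x)"
    if "x \<in> Ob (PObj F (Src I a))" for x
    using that a by simp_all
  fix b assume b: "b \<in> Ar I" and ab: "Tgt I a = Src I b"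
  have "FO (\<phi> a) x \<in> Ob (X (Src I b))" if "x \<in> Ob (X (Src I a))" for x
    using \<phi>_simps(1)[OF a that] ab by simp
  moreover have "FA (\<phi> a) f \<in> Ar (X (Src I b))" "Src (X (Src I b)) (FA (\<phi> a) f) = FO (\<phi> a) (Src (X (Src I a)) f)"
    "Tgt (X (Src I b)) (FA (\<phi> a) f) = FO (\<phi> a) (Tgt (X (Src I a)) f)" if "f \<in> Ar (X (Src I a))" for f
    using \<phi>_simps(2-4)[OF a that] ab by simp_all
  ultimately show "nat_iso (PObj F (Src I a)) (PObj F (Tgt I b))
      (comp_func (PObj F (Src I a)) (PArr F b) (PArr F a)) (PArr F (b \<cdot>\<^bsub>I\<^esub> a)) (PComp F b a)"
    using a b ab by (auto simp: nat_iso_def nat_trans_def Hom_def)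
  fix c x assume c: "c \<in> Ar I" and bc: "Tgt I b = Src I c" and x: "x \<in> Ob (PObj F (Src I a))"
  have xb: "FO (\<phi> a) x \<in> Ob (X (Src I b))" using \<phi>_simps(1)[OF a, of x] x ab by simp
  have xc: "FO (\<phi> b) (FO (\<phi> a) x) \<in> Ob (X (Src I c))" using \<phi>_simps(1)[OF b xb] bc by simp
  show "PComp F (c \<cdot>\<^bsub>I\<^esub> b) a x \<cdot>\<^bsub>PObj F (Tgt I c)\<^esub> PComp F c b (FO (PArr F a) x) =
      PComp F c (b \<cdot>\<^bsub>I\<^esub> a) x \<cdot>\<^bsub>PObj F (Tgt I c)\<^esub> FA (PArr F c) (PComp F b a x)"
    using a b c ab bc x xb xc by (simp add: \<phi>_simps(5)[OF c, unfolded bc[symmetric]])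
next
  fix i assume "i \<in> Ob I"
  then show "nat_iso (PObj F i) (PObj F i) (id_func (PObj F i)) (PArr F (Ide I i)) (PUnit F i)"
    by (auto simp: nat_iso_def nat_trans_def Hom_def)
qed

lemma cocone_simps [simp]:
  "i \<in> Ob I \<Longrightarrow> NObj cocone i = u i"
  "a \<in> Ar I \<Longrightarrow> x \<in> Ob (X (Src I a)) \<Longrightarrow> NArr cocone a x = Ide C (FO (u (Src I a)) x)"
  by (simp_all add: cocone_def)

lemma cocone_psnat: "lin_psnat k I F C cocone"
  unfolding lin_psnat_def
proof (intro conjI ballI impI)
  show "NObj cocone \<in> extensional (Ob I)" "NArr cocone \<in> extensional (Ar I)" by (simp_all add: cocone_def)
  show "lin_functor k (PObj F i) C (NObj cocone i)" if "i \<in> Ob I" for i using that u by simp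
  show "NArr cocone (Ide I i) x = FA (NObj cocone i) (PUnit F i x)" if "i \<in> Ob I" "x \<in> Ob (PObj F i)" for i x
    using that by simp
  fix a assume a: "a \<in> Ar I"
  then show "nat_iso (PObj F (Src I a)) C (NObj cocone (Src I a))
        (comp_func (PObj F (Src I a)) (NObj cocone (Tgt I a)) (PArr F a)) (NArr cocone a)"
    by (auto simp: nat_iso_def nat_trans_def Hom_def cocone_def)
  fix b x assume b: "b \<in> Ar I" and ab: "Tgt I a = Src I b" and x: "x \<in> Ob (PObj F (Src I a))"
  have xb: "FO (\<phi> a) x \<in> Ob (X (Src I b))" using \<phi>_simps(1)[OF a, of x] x ab by simp
  have ux: "FO (u (Src I b)) (FO (\<phi> a) x) = FO (u (Src I a)) x" using u_\<phi>_simps(1)[OF a, of x] x ab by simp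
  show "NArr cocone (b \<cdot>\<^bsub>I\<^esub> a) x = FA (NObj cocone (Tgt I b)) (PComp F b a x) \<cdot>\<^bsub>C\<^esub>
             (NArr cocone b (FO (PArr F a) x) \<cdot>\<^bsub>C\<^esub> NArr cocone a x)"
    using a b ab x xb by (simp add: ux)
qed

end

section \<open>Categories of linear functors and of natural transformations\<close>

lemma lin_functor_cat_simps [simp]:
  "H \<in> Ob (lin_functor_cat k L D) \<longleftrightarrow> lin_functor k L D H"
  "(H, \<tau>, K) \<in> Ar (lin_functor_cat k L D) \<longleftrightarrow> lin_functor k L D H \<and> lin_functor k L D K \<and> nat_trans L D H K \<tau>"
  "Src (lin_functor_cat k L D) (H, \<tau>, K) = H" "Tgt (lin_functor_cat k L D) (H, \<tau>, K) = K"
  "(H', \<sigma>, K') \<cdot>\<^bsub>lin_functor_cat k L D\<^esub> (H, \<tau>, K) = (H, (\<lambda>x \<in> Ob L. \<sigma> x \<cdot>\<^bsub>D\<^esub> \<tau> x), K')"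
  "Ide (lin_functor_cat k L D) H = (H, (\<lambda>x \<in> Ob L. Ide D (FO H x)), H)"
  by (simp_all add: lin_functor_cat_def)

lemma nat_transD:
  assumes "nat_trans X Y F G \<tau>"
  shows "\<tau> \<in> extensional (Ob X)" "x \<in> Ob X \<Longrightarrow> \<tau> x \<in> Ar Y" "x \<in> Ob X \<Longrightarrow> Src Y (\<tau> x) = FO F x"
    "x \<in> Ob X \<Longrightarrow> Tgt Y (\<tau> x) = FO G x"
    "f \<in> Ar X \<Longrightarrow> FA G f \<cdot>\<^bsub>Y\<^esub> \<tau> (Src X f) = \<tau> (Tgt X f) \<cdot>\<^bsub>Y\<^esub> FA F f"
  using assms by (auto simp: nat_trans_def Hom_def)

lemma nat_trans_Cmp:
  assumes "functor_between X Y F" "functor_between X Y G" "functor_between X Y H"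
    and \<tau>: "nat_trans X Y F G \<tau>" and \<sigma>: "nat_trans X Y G H \<sigma>"
  shows "nat_trans X Y F H (\<lambda>x \<in> Ob X. \<sigma> x \<cdot>\<^bsub>Y\<^esub> \<tau> x)"
proof -
  interpret F: functor_between X Y F by fact
  interpret G: functor_between X Y G by fact
  interpret H: functor_between X Y H by fact
  note [simp] = nat_transD(2-4)[OF \<tau>] nat_transD(2-4)[OF \<sigma>]
  show ?thesis
    unfolding nat_trans_def
  proof (intro conjI ballI)
    fix f assume f: "f \<in> Ar X"
    have "FA H f \<cdot>\<^bsub>Y\<^esub> (\<sigma> (Src X f) \<cdot>\<^bsub>Y\<^esub> \<tau> (Src X f)) = (FA H f \<cdot>\<^bsub>Y\<^esub> \<sigma> (Src X f)) \<cdot>\<^bsub>Y\<^esub> \<tau> (Src X f)"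
      using f by simp
    also have "\<dots> = \<sigma> (Tgt X f) \<cdot>\<^bsub>Y\<^esub> (FA G f \<cdot>\<^bsub>Y\<^esub> \<tau> (Src X f))"
      using f by (simp add: nat_transD(5)[OF \<sigma>])
    also have "\<dots> = (\<sigma> (Tgt X f) \<cdot>\<^bsub>Y\<^esub> \<tau> (Tgt X f)) \<cdot>\<^bsub>Y\<^esub> FA F f"
      using f by (simp add: nat_transD(5)[OF \<tau>])
    finally show "FA H f \<cdot>\<^bsub>Y\<^esub> (\<lambda>x \<in> Ob X. \<sigma> x \<cdot>\<^bsub>Y\<^esub> \<tau> x) (Src X f) = (\<lambda>x \<in> Ob X. \<sigma> x \<cdot>\<^bsub>Y\<^esub> \<tau> x) (Tgt X f) \<cdot>\<^bsub>Y\<^esub> FA F f"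
      using f by simp
  qed (simp_all add: Hom_def)
qed

lemma nat_trans_Ide:
  assumes "functor_between X Y F"
  shows "nat_trans X Y F F (\<lambda>x \<in> Ob X. Ide Y (FO F x))"
proof -
  interpret F: functor_between X Y F by fact
  show ?thesis by (auto simp: nat_trans_def Hom_def)
qed

lemma lin_functor_cat_category:
  assumes L: "lin_category k L" and D: "lin_category k D"
  shows "is_category (lin_functor_cat k L D)"
  unfolding is_category_def
proof (intro conjI ballI impI)
  let ?C = "lin_functor_cat k L D"
  interpret D: category D using D by unfold_locales (simp add: lin_category_def)
  fix x assume x: "x \<in> Ar ?C"
  obtain H1 \<rho> H2 where x_eq [simp]: "x = (H1, \<rho>, H2)" by (cases x) auto
  have H1: "lin_functor k L D H1" and H2: "lin_functor k L D H2" and \<rho>: "nat_trans L D H1 H2 \<rho>" using x by auto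
  interpret H1: functor_between L D H1 by (rule lin_functor_between[OF L D H1])
  interpret H2: functor_between L D H2 by (rule lin_functor_between[OF L D H2])
  note [simp] = nat_transD(2-4)[OF \<rho>]
  show "Src ?C x \<in> Ob ?C" "Tgt ?C x \<in> Ob ?C" using H1 H2 by auto
  show "x \<cdot>\<^bsub>?C\<^esub> Ide ?C (Src ?C x) = x" "Ide ?C (Tgt ?C x) \<cdot>\<^bsub>?C\<^esub> x = x"
    using nat_transD(1)[OF \<rho>] by (auto intro!: extensionalityI[of _ "Ob L"])
  fix y assume y: "y \<in> Ar ?C" "Tgt ?C x = Src ?C y"
  obtain \<sigma> H3 where y_eq [simp]: "y = (H2, \<sigma>, H3)" using y by (cases y) auto
  have H3: "lin_functor k L D H3" and \<sigma>: "nat_trans L D H2 H3 \<sigma>" using y by auto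
  interpret H3: functor_between L D H3 by (rule lin_functor_between[OF L D H3])
  note [simp] = nat_transD(2-4)[OF \<sigma>]
  show "y \<cdot>\<^bsub>?C\<^esub> x \<in> Hom ?C (Src ?C x) (Tgt ?C y)"
    using nat_trans_Cmp[OF H1.functor_between_axioms H2.functor_between_axioms H3.functor_between_axioms \<rho> \<sigma>] H1 H3
    by (simp add: Hom_def)
  fix z assume z: "z \<in> Ar ?C" "Tgt ?C y = Src ?C z"
  obtain \<tau> H4 where z_eq [simp]: "z = (H3, \<tau>, H4)" using z by (cases z) auto
  have \<tau>: "nat_trans L D H3 H4 \<tau>" using z by auto
  note [simp] = nat_transD(2-4)[OF \<tau>]
  show "z \<cdot>\<^bsub>?C\<^esub> y \<cdot>\<^bsub>?C\<^esub> x = z \<cdot>\<^bsub>?C\<^esub> (y \<cdot>\<^bsub>?C\<^esub> x)"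
    by (auto intro!: restrict_ext)
next
  fix H assume "H \<in> Ob (lin_functor_cat k L D)"
  then show "Ide (lin_functor_cat k L D) H \<in> Hom (lin_functor_cat k L D) H H"
    using nat_trans_Ide[OF lin_functor_between[OF L D]] by (simp add: Hom_def)
qed

section \<open>Pseudonatural transformations into a fixed linear category and the transport of
  arrows\<close>

locale full_cocone_target = full_cocone I C k X \<phi> u N + D: linear_category D k
  for I :: "('i, 'a) cat" and C :: "('o, 'm, 'k) lincat" and k :: "'k ring"
    and X :: "'i \<Rightarrow> ('x, 'y, 'k) lincat" and \<phi> :: "'a \<Rightarrow> ('x, 'y, 'x, 'y) func"
    and u :: "'i \<Rightarrow> ('x, 'y, 'o, 'm) func" and N :: "'i set"
    and D :: "('d, 'e, 'k) lincat"
begin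

abbreviation psnats :: "(('i, 'a, 'x, 'y, 'd, 'e) psnat,
    ('i, 'a, 'x, 'y, 'd, 'e) psnat \<times> ('i \<Rightarrow> 'x \<Rightarrow> 'e) \<times> ('i, 'a, 'x, 'y, 'd, 'e) psnat) cat" where
  "psnats \<equiv> psnat_cat k I F D"

lemma psnats_simps [simp]:
  "s \<in> Ob psnats \<longleftrightarrow> lin_psnat k I F D s"
  "(s, \<mu>, t) \<in> Ar psnats \<longleftrightarrow> lin_psnat k I F D s \<and> lin_psnat k I F D t \<and> modification I F D s t \<mu>"
  "Src psnats (s, \<mu>, t) = s" "Tgt psnats (s, \<mu>, t) = t"
  "(s', \<nu>, t') \<cdot>\<^bsub>psnats\<^esub> (s, \<mu>, t) = (s, (\<lambda>i \<in> Ob I. \<lambda>x \<in> Ob (X i). \<nu> i x \<cdot>\<^bsub>D\<^esub> \<mu> i x), t')"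
  "Ide psnats s = (s, (\<lambda>i \<in> Ob I. \<lambda>x \<in> Ob (X i). Ide D (FO (NObj s i) x)), s)"
  by (simp_all add: psnat_cat_def)

lemma psnat_functor: "lin_psnat k I F D s \<Longrightarrow> i \<in> Ob I \<Longrightarrow> linear_functor (X i) D k (NObj s i)"
  by (intro linear_functorI X D.linear) (auto simp: lin_psnat_def)

lemma psnat_functor_between: "lin_psnat k I F D s \<Longrightarrow> i \<in> Ob I \<Longrightarrow> functor_between (X i) D (NObj s i)"
  using psnat_functor by (simp add: linear_functor_def)

lemmas psnat_functor_simps =
  functor_between.FO_Ob[OF psnat_functor_between] functor_between.FA_Ar[OF psnat_functor_between]
  functor_between.Src_FA[OF psnat_functor_between] functor_between.Tgt_FA[OF psnat_functor_between]
  functor_between.FA_Ide[OF psnat_functor_between] functor_between.FA_Cmp[OF psnat_functor_between]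

lemma psnat_NArr:
  assumes "lin_psnat k I F D s" "a \<in> Hom I i j" "x \<in> Ob (X i)"
  shows "NArr s a x \<in> Ar D" "Src D (NArr s a x) = FO (NObj s i) x"
    "Tgt D (NArr s a x) = FO (NObj s j) (FO (\<phi> a) x)" "is_iso D (NArr s a x)"
  using assms by (auto simp: lin_psnat_def nat_iso_def nat_trans_def Hom_def)

lemma psnat_NArr_natural:
  assumes "lin_psnat k I F D s" "a \<in> Hom I i j" "f \<in> Ar (X i)"
  shows "FA (NObj s j) (FA (\<phi> a) f) \<cdot>\<^bsub>D\<^esub> NArr s a (Src (X i) f) = NArr s a (Tgt (X i) f) \<cdot>\<^bsub>D\<^esub> FA (NObj s i) f"
proof -
  have a: "a \<in> Ar I" "Src I a = i" "Tgt I a = j" using assms(2) by (auto simp: Hom_def)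
  have "nat_trans (X i) D (NObj s i) (comp_func (X i) (NObj s j) (\<phi> a)) (NArr s a)"
    using assms(1) a by (auto simp: lin_psnat_def nat_iso_def)
  from nat_transD(5)[OF this assms(3)] show ?thesis using assms(3) by simp
qed

lemma Hom_\<phi>:
  assumes "a \<in> Hom I i j"
  shows "x \<in> Ob (X i) \<Longrightarrow> FO (\<phi> a) x \<in> Ob (X j)" "x \<in> Ob (X i) \<Longrightarrow> FO (u j) (FO (\<phi> a) x) = FO (u i) x"
    "g \<in> Hom (X i) x y \<Longrightarrow> FA (\<phi> a) g \<in> Hom (X j) (FO (\<phi> a) x) (FO (\<phi> a) y)"
    "g \<in> Hom (X i) x y \<Longrightarrow> FA (u j) (FA (\<phi> a) g) = FA (u i) g" "i \<in> Ob I" "j \<in> Ob I"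
  using assms by (auto simp: Hom_def)

lemma Hom_\<phi>_Cmp:
  assumes "a \<in> Hom I i j" "b \<in> Hom I j l"
  shows "b \<cdot>\<^bsub>I\<^esub> a \<in> Hom I i l" "x \<in> Ob (X i) \<Longrightarrow> FO (\<phi> (b \<cdot>\<^bsub>I\<^esub> a)) x = FO (\<phi> b) (FO (\<phi> a) x)"
  using assms by (auto simp: Hom_def)

text \<open>\<open>F\<close> is strict, so the coherence cell in the compatibility law is an
  identity and drops out.\<close>

lemma psnat_NArr_Cmp:
  assumes s: "lin_psnat k I F D s" and "a \<in> Hom I i j" "b \<in> Hom I j l" and x: "x \<in> Ob (X i)"
  shows "NArr s (b \<cdot>\<^bsub>I\<^esub> a) x = NArr s b (FO (\<phi> a) x) \<cdot>\<^bsub>D\<^esub> NArr s a x"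
proof -
  have ab: "a \<in> Ar I" "Src I a = i" "Tgt I a = j" "b \<in> Ar I" "Src I b = j" "Tgt I b = l"
    using assms by (auto simp: Hom_def)
  note y = Hom_\<phi>(1)[OF assms(2) x]
  note z = Hom_\<phi>(1)[OF assms(3) y]
  have l: "l \<in> Ob I" using ab by auto
  have "NArr s (b \<cdot>\<^bsub>I\<^esub> a) x = FA (NObj s l) (PComp F b a x) \<cdot>\<^bsub>D\<^esub>
             (NArr s b (FO (\<phi> a) x) \<cdot>\<^bsub>D\<^esub> NArr s a x)"
    using s ab x unfolding lin_psnat_def by auto
  moreover have "PComp F b a x = Ide (X l) (FO (\<phi> b) (FO (\<phi> a) x))" using ab x by simp
  ultimately show ?thesis
    using psnat_functor_simps(1,5)[OF s l z] psnat_NArr[OF s assms(2) x] psnat_NArr[OF s assms(3) y] by simp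
qed

lemma modificationD:
  assumes "modification I F D s t \<mu>"
  shows "\<mu> \<in> extensional (Ob I)" "i \<in> Ob I \<Longrightarrow> nat_trans (X i) D (NObj s i) (NObj t i) (\<mu> i)"
    "a \<in> Hom I i j \<Longrightarrow> x \<in> Ob (X i) \<Longrightarrow> NArr t a x \<cdot>\<^bsub>D\<^esub> \<mu> i x = \<mu> j (FO (\<phi> a) x) \<cdot>\<^bsub>D\<^esub> NArr s a x"
  using assms by (auto simp: modification_def Hom_def)

lemma psnats_category: "is_category psnats"
  unfolding is_category_def
proof (intro conjI ballI impI)
  fix x assume x: "x \<in> Ar psnats"
  obtain s \<mu> t where x_eq [simp]: "x = (s, \<mu>, t)" by (cases x) auto
  have s: "lin_psnat k I F D s" and t: "lin_psnat k I F D t" and \<mu>: "modification I F D s t \<mu>" using x by auto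
  note [simp] = nat_transD(2-4)[OF modificationD(2)[OF \<mu>]]
  show "Src psnats x \<in> Ob psnats" "Tgt psnats x \<in> Ob psnats" using s t by auto
  have "(\<lambda>i \<in> Ob I. \<lambda>x \<in> Ob (X i). \<mu> i x) = \<mu>"
    using modificationD(1)[OF \<mu>] nat_transD(1)[OF modificationD(2)[OF \<mu>]]
    by (auto intro!: extensionalityI[of _ "Ob I"] extensional_restrict)
  then show "x \<cdot>\<^bsub>psnats\<^esub> Ide psnats (Src psnats x) = x" "Ide psnats (Tgt psnats x) \<cdot>\<^bsub>psnats\<^esub> x = x"
    by (simp_all cong: restrict_cong)
  fix y assume y: "y \<in> Ar psnats" "Tgt psnats x = Src psnats y"
  obtain \<nu> r where y_eq [simp]: "y = (t, \<nu>, r)" using y by (cases y) auto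
  have r: "lin_psnat k I F D r" and \<nu>: "modification I F D t r \<nu>" using y by auto
  note [simp] = nat_transD(2-4)[OF modificationD(2)[OF \<nu>]]
  have "modification I F D s r (\<lambda>i \<in> Ob I. \<lambda>x \<in> Ob (X i). \<nu> i x \<cdot>\<^bsub>D\<^esub> \<mu> i x)"
    unfolding modification_def
  proof (intro conjI ballI)
    fix i assume i: "i \<in> Ob I"
    have fb: "functor_between (X i) D (NObj q i)" if "lin_psnat k I F D q" for q
      using psnat_functor[OF that i] by (simp add: linear_functor_def)
    show "nat_trans (PObj F i) D (NObj s i) (NObj r i) ((\<lambda>i \<in> Ob I. \<lambda>x \<in> Ob (X i). \<nu> i x \<cdot>\<^bsub>D\<^esub> \<mu> i x) i)"
      using nat_trans_Cmp[OF fb[OF s] fb[OF t] fb[OF r] modificationD(2)[OF \<mu> i] modificationD(2)[OF \<nu> i]] i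
      by simp
  next
    fix a x assume a: "a \<in> Ar I" and x: "x \<in> Ob (PObj F (Src I a))"
    define i j where "i = Src I a" and "j = Tgt I a"
    have aH: "a \<in> Hom I i j" and xi: "x \<in> Ob (X i)" using a x by (auto simp: Hom_def i_def j_def)
    note ij = Hom_\<phi>(5,6)[OF aH] and y = Hom_\<phi>(1)[OF aH xi]
    note [simp] = psnat_NArr(1-3)[OF s aH xi] psnat_NArr(1-3)[OF t aH xi] psnat_NArr(1-3)[OF r aH xi]
    have "NArr r a x \<cdot>\<^bsub>D\<^esub> (\<nu> i x \<cdot>\<^bsub>D\<^esub> \<mu> i x) = (NArr r a x \<cdot>\<^bsub>D\<^esub> \<nu> i x) \<cdot>\<^bsub>D\<^esub> \<mu> i x"
      using ij xi y by simp
    also have "\<dots> = \<nu> j (FO (\<phi> a) x) \<cdot>\<^bsub>D\<^esub> (NArr t a x \<cdot>\<^bsub>D\<^esub> \<mu> i x)"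
      using ij xi y by (simp add: modificationD(3)[OF \<nu> aH xi])
    also have "\<dots> = (\<nu> j (FO (\<phi> a) x) \<cdot>\<^bsub>D\<^esub> \<mu> j (FO (\<phi> a) x)) \<cdot>\<^bsub>D\<^esub> NArr s a x"
      using ij xi y by (simp add: modificationD(3)[OF \<mu> aH xi])
    finally show "NArr r a x \<cdot>\<^bsub>D\<^esub> (\<lambda>i \<in> Ob I. \<lambda>x \<in> Ob (X i). \<nu> i x \<cdot>\<^bsub>D\<^esub> \<mu> i x) (Src I a) x =
        (\<lambda>i \<in> Ob I. \<lambda>x \<in> Ob (X i). \<nu> i x \<cdot>\<^bsub>D\<^esub> \<mu> i x) (Tgt I a) (FO (PArr F a) x) \<cdot>\<^bsub>D\<^esub> NArr s a x"
      using ij xi y by (simp add: i_def j_def)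
  qed simp
  then show "y \<cdot>\<^bsub>psnats\<^esub> x \<in> Hom psnats (Src psnats x) (Tgt psnats y)"
    using s r by (simp add: Hom_def)
  fix z assume z: "z \<in> Ar psnats" "Tgt psnats y = Src psnats z"
  obtain \<xi> q where z_eq [simp]: "z = (r, \<xi>, q)" using z by (cases z) auto
  have \<xi>: "modification I F D r q \<xi>" using z by auto
  note [simp] = nat_transD(2-4)[OF modificationD(2)[OF \<xi>]]
  show "z \<cdot>\<^bsub>psnats\<^esub> y \<cdot>\<^bsub>psnats\<^esub> x = z \<cdot>\<^bsub>psnats\<^esub> (y \<cdot>\<^bsub>psnats\<^esub> x)"
    by (auto intro!: restrict_ext)
next
  fix s assume "s \<in> Ob psnats"
  then have s: "lin_psnat k I F D s" by simp
  have "modification I F D s s (\<lambda>i \<in> Ob I. \<lambda>x \<in> Ob (X i). Ide D (FO (NObj s i) x))"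
    unfolding modification_def
  proof (intro conjI ballI)
    fix i assume i: "i \<in> Ob I"
    have "functor_between (X i) D (NObj s i)" using psnat_functor[OF s i] by (simp add: linear_functor_def)
    then show "nat_trans (PObj F i) D (NObj s i) (NObj s i) ((\<lambda>i \<in> Ob I. \<lambda>x \<in> Ob (X i). Ide D (FO (NObj s i) x)) i)"
      using nat_trans_Ide i by simp
  next
    fix a x assume a: "a \<in> Ar I" and x: "x \<in> Ob (PObj F (Src I a))"
    have aH: "a \<in> Hom I (Src I a) (Tgt I a)" and xi: "x \<in> Ob (X (Src I a))" using a x by (auto simp: Hom_def)
    show "NArr s a x \<cdot>\<^bsub>D\<^esub> (\<lambda>i \<in> Ob I. \<lambda>x \<in> Ob (X i). Ide D (FO (NObj s i) x)) (Src I a) x =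
        (\<lambda>i \<in> Ob I. \<lambda>x \<in> Ob (X i). Ide D (FO (NObj s i) x)) (Tgt I a) (FO (PArr F a) x) \<cdot>\<^bsub>D\<^esub> NArr s a x"
      using psnat_NArr(1-3)[OF s aH xi] a xi by simp
  qed simp
  then show "Ide psnats s \<in> Hom psnats s s" using s by (simp add: Hom_def)
qed

text \<open>
  \<open>transport s i x j y f t\<close>: the arrow \<open>t : s i x \<rightarrow> s j y\<close> corresponds to \<open>f : u i x \<rightarrow> u j y\<close>, as seen
  in any \<open>X n\<close> with \<open>n \<in> N\<close> above \<open>i\<close> and \<open>j\<close>.
\<close>

definition transport :: "('i, 'a, 'x, 'y, 'd, 'e) psnat \<Rightarrow> 'i \<Rightarrow> 'x \<Rightarrow> 'i \<Rightarrow> 'x \<Rightarrow> 'm \<Rightarrow> 'e \<Rightarrow> bool" where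
  "transport s i x j y f t \<longleftrightarrow> t \<in> Hom D (FO (NObj s i) x) (FO (NObj s j) y) \<and>
    (\<forall>n \<in> N. \<forall>a \<in> Hom I i n. \<forall>b \<in> Hom I j n. \<forall>g \<in> Hom (X n) (FO (\<phi> a) x) (FO (\<phi> b) y).
      FA (u n) g = f \<longrightarrow> NArr s b y \<cdot>\<^bsub>D\<^esub> t = FA (NObj s n) g \<cdot>\<^bsub>D\<^esub> NArr s a x)"

text \<open>By naturality of \<open>NArr s c\<close> at \<open>g\<close>, the equation over
  \<open>m\<close> is the equation over \<open>n\<close> composed with
  \<open>NArr s c (FO (\<phi> b) y)\<close>. This is an isomorphism and can be cancelled, whence an
  equivalence; the next proof climbs in one direction and descends in the other.\<close>

lemma transport_up:
  assumes s: "lin_psnat k I F D s" and x: "x \<in> Ob (X i)" and y: "y \<in> Ob (X j)"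
    and a: "a \<in> Hom I i n" and b: "b \<in> Hom I j n" and g: "g \<in> Hom (X n) (FO (\<phi> a) x) (FO (\<phi> b) y)"
    and c: "c \<in> Hom I n m" and t: "t \<in> Hom D (FO (NObj s i) x) (FO (NObj s j) y)"
  shows "NArr s (c \<cdot>\<^bsub>I\<^esub> b) y \<cdot>\<^bsub>D\<^esub> t = FA (NObj s m) (FA (\<phi> c) g) \<cdot>\<^bsub>D\<^esub> NArr s (c \<cdot>\<^bsub>I\<^esub> a) x \<longleftrightarrow>
    NArr s b y \<cdot>\<^bsub>D\<^esub> t = FA (NObj s n) g \<cdot>\<^bsub>D\<^esub> NArr s a x"
proof -
  have t' [simp]: "t \<in> Ar D" "Src D t = FO (NObj s i) x" "Tgt D t = FO (NObj s j) y" using t by (auto simp: Hom_def)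
  have g' [simp]: "g \<in> Ar (X n)" "Src (X n) g = FO (\<phi> a) x" "Tgt (X n) g = FO (\<phi> b) y" using g by (auto simp: Hom_def)
  have n: "n \<in> Ob I" "m \<in> Ob I" using Hom_\<phi>(5,6)[OF c] by auto
  note xa = Hom_\<phi>(1)[OF a x] and yb = Hom_\<phi>(1)[OF b y]
  note [simp] = psnat_functor_simps(1-4)[OF s n(1)] psnat_functor_simps(1-4)[OF s n(2)]
    psnat_NArr(1-3)[OF s a x] psnat_NArr(1-3)[OF s b y] psnat_NArr(1-3)[OF s c xa] psnat_NArr(1-3)[OF s c yb]
  have cg: "FA (\<phi> c) g \<in> Ar (X m)" "Src (X m) (FA (\<phi> c) g) = FO (\<phi> c) (FO (\<phi> a) x)"
    using Hom_\<phi>(3)[OF c g] by (auto simp: Hom_def)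
  have nat: "FA (NObj s m) (FA (\<phi> c) g) \<cdot>\<^bsub>D\<^esub> NArr s c (FO (\<phi> a) x) = NArr s c (FO (\<phi> b) y) \<cdot>\<^bsub>D\<^esub> FA (NObj s n) g"
    using psnat_NArr_natural[OF s c g'(1)] by simp
  have "FA (NObj s m) (FA (\<phi> c) g) \<cdot>\<^bsub>D\<^esub> NArr s (c \<cdot>\<^bsub>I\<^esub> a) x =
      (FA (NObj s m) (FA (\<phi> c) g) \<cdot>\<^bsub>D\<^esub> NArr s c (FO (\<phi> a) x)) \<cdot>\<^bsub>D\<^esub> NArr s a x"
    using xa cg by (simp add: psnat_NArr_Cmp[OF s a c x])
  also have "\<dots> = NArr s c (FO (\<phi> b) y) \<cdot>\<^bsub>D\<^esub> (FA (NObj s n) g \<cdot>\<^bsub>D\<^esub> NArr s a x)"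
    unfolding nat using xa yb by simp
  finally have rhs: "FA (NObj s m) (FA (\<phi> c) g) \<cdot>\<^bsub>D\<^esub> NArr s (c \<cdot>\<^bsub>I\<^esub> a) x =
    NArr s c (FO (\<phi> b) y) \<cdot>\<^bsub>D\<^esub> (FA (NObj s n) g \<cdot>\<^bsub>D\<^esub> NArr s a x)" .
  have lhs: "NArr s (c \<cdot>\<^bsub>I\<^esub> b) y \<cdot>\<^bsub>D\<^esub> t = NArr s c (FO (\<phi> b) y) \<cdot>\<^bsub>D\<^esub> (NArr s b y \<cdot>\<^bsub>D\<^esub> t)"
    using yb by (simp add: psnat_NArr_Cmp[OF s b c y])
  show ?thesis
    unfolding lhs rhs
    using D.iso_cancel_left[OF psnat_NArr(4)[OF s c yb], of "NArr s b y \<cdot>\<^bsub>D\<^esub> t" "FA (NObj s n) g \<cdot>\<^bsub>D\<^esub> NArr s a x"]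
      xa yb by auto
qed

text \<open>One index and one lift decide for all. Another index \<open>n'\<close> has a common
  bound \<open>m\<close> in \<open>N\<close> with \<open>n\<close>; the arrows from \<open>i\<close>
  and \<open>j\<close> to \<open>m\<close> through \<open>n\<close> and through \<open>n'\<close>
  coincide by \<open>N_unique\<close>, and the images of the two lifts in \<open>X m\<close>
  coincide because both lie over \<open>f\<close> and \<open>u m\<close> is faithful.\<close>

lemma transportI:
  assumes s: "lin_psnat k I F D s" and x: "x \<in> Ob (X i)" and y: "y \<in> Ob (X j)"
    and n: "n \<in> N" and a: "a \<in> Hom I i n" and b: "b \<in> Hom I j n"
    and g: "g \<in> Hom (X n) (FO (\<phi> a) x) (FO (\<phi> b) y)" "FA (u n) g = f"
    and t: "t \<in> Hom D (FO (NObj s i) x) (FO (NObj s j) y)"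
    and eq: "NArr s b y \<cdot>\<^bsub>D\<^esub> t = FA (NObj s n) g \<cdot>\<^bsub>D\<^esub> NArr s a x"
  shows "transport s i x j y f t"
  unfolding transport_def
proof (intro conjI ballI impI t)
  fix n' a' b' g'
  assume n': "n' \<in> N" and a': "a' \<in> Hom I i n'" and b': "b' \<in> Hom I j n'"
    and g': "g' \<in> Hom (X n') (FO (\<phi> a') x) (FO (\<phi> b') y)" "FA (u n') g' = f"
  obtain m c c' where m: "m \<in> N" and c: "c \<in> Hom I n m" and c': "c' \<in> Hom I n' m"
    using N_upper[of n n'] N_Ob n n' by blast
  have ca: "c \<cdot>\<^bsub>I\<^esub> a = c' \<cdot>\<^bsub>I\<^esub> a'" and cb: "c \<cdot>\<^bsub>I\<^esub> b = c' \<cdot>\<^bsub>I\<^esub> b'"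
    using N_unique[OF m] Hom_\<phi>_Cmp(1) a a' b b' c c' by blast+
  have "FA (u m) (FA (\<phi> c) g) = FA (u m) (FA (\<phi> c') g')"
    using Hom_\<phi>(4)[OF c g(1)] Hom_\<phi>(4)[OF c' g'(1)] g(2) g'(2) by simp
  moreover have "FA (\<phi> c) g \<in> Ar (X m)" "FA (\<phi> c') g' \<in> Ar (X m)"
    using Hom_\<phi>(3)[OF c g(1)] Hom_\<phi>(3)[OF c' g'(1)] by (auto simp: Hom_def)
  ultimately have cg: "FA (\<phi> c) g = FA (\<phi> c') g'"
    using N_faithful[OF m] by (auto dest: inj_onD)
  show "NArr s b' y \<cdot>\<^bsub>D\<^esub> t = FA (NObj s n') g' \<cdot>\<^bsub>D\<^esub> NArr s a' x"
    using transport_up[OF s x y a b g(1) c t] transport_up[OF s x y a' b' g'(1) c' t] eq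
    unfolding ca cb cg by simp
qed

lemma transportD:
  assumes "transport s i x j y f t"
  shows "t \<in> Ar D" "Src D t = FO (NObj s i) x" "Tgt D t = FO (NObj s j) y"
    and "n \<in> N \<Longrightarrow> a \<in> Hom I i n \<Longrightarrow> b \<in> Hom I j n \<Longrightarrow> g \<in> Hom (X n) (FO (\<phi> a) x) (FO (\<phi> b) y) \<Longrightarrow>
      FA (u n) g = f \<Longrightarrow> NArr s b y \<cdot>\<^bsub>D\<^esub> t = FA (NObj s n) g \<cdot>\<^bsub>D\<^esub> NArr s a x"
  using assms by (auto simp: transport_def Hom_def)

lemma lift_Ar:
  assumes n: "n \<in> N" and a: "a \<in> Hom I i n" and b: "b \<in> Hom I j n" and x: "x \<in> Ob (X i)" and y: "y \<in> Ob (X j)"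
    and f: "f \<in> Hom C (FO (u i) x) (FO (u j) y)"
  obtains g where "g \<in> Hom (X n) (FO (\<phi> a) x) (FO (\<phi> b) y)" "FA (u n) g = f"
  using N_full[OF n Hom_\<phi>(1)[OF a x] Hom_\<phi>(1)[OF b y]] f Hom_\<phi>(2)[OF a x] Hom_\<phi>(2)[OF b y] by auto

lemma transport_exists:
  assumes s: "lin_psnat k I F D s" and i: "i \<in> Ob I" "x \<in> Ob (X i)" and j: "j \<in> Ob I" "y \<in> Ob (X j)"
    and f: "f \<in> Hom C (FO (u i) x) (FO (u j) y)"
  shows "\<exists>t. transport s i x j y f t"
proof -
  obtain n a b where n: "n \<in> N" and a: "a \<in> Hom I i n" and b: "b \<in> Hom I j n"
    using N_upper[OF i(1) j(1)] by blast
  obtain g where g: "g \<in> Hom (X n) (FO (\<phi> a) x) (FO (\<phi> b) y)" "FA (u n) g = f"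
    using lift_Ar[OF n a b i(2) j(2) f] .
  have nO: "n \<in> Ob I" using n N_Ob by auto
  have g' [simp]: "g \<in> Ar (X n)" "Src (X n) g = FO (\<phi> a) x" "Tgt (X n) g = FO (\<phi> b) y" using g by (auto simp: Hom_def)
  note [simp] = psnat_NArr(1-3)[OF s a i(2)] psnat_NArr(1-3)[OF s b j(2)] psnat_functor_simps(1-4)[OF s nO]
  have "NArr s b y \<in> Hom D (FO (NObj s j) y) (FO (NObj s n) (FO (\<phi> b) y))" by (simp add: Hom_def)
  then obtain d where d: "d \<in> Ar D" "Src D d = FO (NObj s n) (FO (\<phi> b) y)" "Tgt D d = FO (NObj s j) y"
      "NArr s b y \<cdot>\<^bsub>D\<^esub> d = Ide D (FO (NObj s n) (FO (\<phi> b) y))"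
    using D.is_isoE[OF psnat_NArr(4)[OF s b j(2)]] by (auto simp: Hom_def)
  let ?t = "d \<cdot>\<^bsub>D\<^esub> (FA (NObj s n) g \<cdot>\<^bsub>D\<^esub> NArr s a x)"
  have "NArr s b y \<cdot>\<^bsub>D\<^esub> ?t = (NArr s b y \<cdot>\<^bsub>D\<^esub> d) \<cdot>\<^bsub>D\<^esub> (FA (NObj s n) g \<cdot>\<^bsub>D\<^esub> NArr s a x)"
    using d(1-3) by simp
  also have "\<dots> = FA (NObj s n) g \<cdot>\<^bsub>D\<^esub> NArr s a x" unfolding d(4) by simp
  finally have "transport s i x j y f ?t"
    using d(1-3) by (intro transportI[OF s i(2) j(2) n a b g]) (auto simp: Hom_def)
  then show ?thesis by blast
qed

text \<open>A lift \<open>g\<close> exists because \<open>X n\<close> is full in \<open>C\<close>,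
  and the defining equation then determines \<open>t\<close> because \<open>NArr s b y\<close> can
  be cancelled.\<close>

lemma transport_unique:
  assumes s: "lin_psnat k I F D s" and i: "i \<in> Ob I" "x \<in> Ob (X i)" and j: "j \<in> Ob I" "y \<in> Ob (X j)"
    and f: "f \<in> Hom C (FO (u i) x) (FO (u j) y)" and t: "transport s i x j y f t" "transport s i x j y f t'"
  shows "t = t'"
proof -
  obtain n a b where n: "n \<in> N" and a: "a \<in> Hom I i n" and b: "b \<in> Hom I j n"
    using N_upper[OF i(1) j(1)] by blast
  obtain g where g: "g \<in> Hom (X n) (FO (\<phi> a) x) (FO (\<phi> b) y)" "FA (u n) g = f"
    using lift_Ar[OF n a b i(2) j(2) f] .
  show ?thesis
    by (rule D.iso_cancel_left[OF psnat_NArr(4)[OF s b j(2)]])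
      (use transportD[OF t(1)] transportD[OF t(2)] psnat_NArr(1-3)[OF s b j(2)] n a b g in auto)
qed

lemma transport_Cmp:
  assumes s: "lin_psnat k I F D s" and i: "i \<in> Ob I" "x \<in> Ob (X i)" and j: "j \<in> Ob I" "y \<in> Ob (X j)"
    and l: "l \<in> Ob I" "z \<in> Ob (X l)"
    and f: "f \<in> Hom C (FO (u i) x) (FO (u j) y)" "transport s i x j y f t"
    and f': "f' \<in> Hom C (FO (u j) y) (FO (u l) z)" "transport s j y l z f' t'"
  shows "transport s i x l z (f' \<cdot>\<^bsub>C\<^esub> f) (t' \<cdot>\<^bsub>D\<^esub> t)"
proof -
  \<comment> \<open>\<open>N_upper\<close> bounds two indices at a time, so an index above all three
    is found in two steps.\<close>
  obtain n0 a0 b0 where n0: "n0 \<in> N" "a0 \<in> Hom I i n0" "b0 \<in> Hom I j n0"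
    using N_upper[OF i(1) j(1)] by blast
  obtain n c d where n: "n \<in> N" "d \<in> Hom I n0 n" "c \<in> Hom I l n"
    using N_upper[of n0 l] n0 N_Ob l(1) by blast
  obtain a b where a: "a \<in> Hom I i n" and b: "b \<in> Hom I j n"
    using Hom_\<phi>_Cmp(1)[OF _ n(2)] n0 by blast
  note c = n(3)
  have nO: "n \<in> Ob I" using n N_Ob by auto
  obtain g where g: "g \<in> Hom (X n) (FO (\<phi> a) x) (FO (\<phi> b) y)" "FA (u n) g = f"
    using lift_Ar[OF n(1) a b i(2) j(2) f(1)] .
  obtain g' where g': "g' \<in> Hom (X n) (FO (\<phi> b) y) (FO (\<phi> c) z)" "FA (u n) g' = f'"
    using lift_Ar[OF n(1) b c j(2) l(2) f'(1)] .
  have gs [simp]: "g \<in> Ar (X n)" "Src (X n) g = FO (\<phi> a) x" "Tgt (X n) g = FO (\<phi> b) y"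
    "g' \<in> Ar (X n)" "Src (X n) g' = FO (\<phi> b) y" "Tgt (X n) g' = FO (\<phi> c) z" using g g' by (auto simp: Hom_def)
  note [simp] = psnat_NArr(1-3)[OF s a i(2)] psnat_NArr(1-3)[OF s b j(2)] psnat_NArr(1-3)[OF s c l(2)]
    psnat_functor_simps[OF s nO] transportD(1-3)[OF f(2)] transportD(1-3)[OF f'(2)]
  have "NArr s c z \<cdot>\<^bsub>D\<^esub> (t' \<cdot>\<^bsub>D\<^esub> t) = (NArr s c z \<cdot>\<^bsub>D\<^esub> t') \<cdot>\<^bsub>D\<^esub> t" by simp
  also have "\<dots> = FA (NObj s n) g' \<cdot>\<^bsub>D\<^esub> (NArr s b y \<cdot>\<^bsub>D\<^esub> t)"
    by (simp add: transportD(4)[OF f'(2) n(1) b c g'])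
  also have "\<dots> = FA (NObj s n) (g' \<cdot>\<^bsub>X n\<^esub> g) \<cdot>\<^bsub>D\<^esub> NArr s a x"
    by (simp add: transportD(4)[OF f(2) n(1) a b g])
  finally show ?thesis
    using g(2) g'(2) nO by (intro transportI[OF s i(2) l(2) n(1) a c, of "g' \<cdot>\<^bsub>X n\<^esub> g"]) (auto simp: Hom_def)
qed

text \<open>With the same arrow \<open>a\<close> on both sides, the lift of
  \<open>FA (u i) g\<close> is \<open>FA (\<phi> a) g\<close>, and the equation required is
  naturality of \<open>NArr s a\<close>. It identifies the action of \<open>s\<close> on arrows
  within one index.\<close>

lemma transport_FA:
  assumes s: "lin_psnat k I F D s" and i: "i \<in> Ob I" and g: "g \<in> Hom (X i) x y"
  shows "transport s i x i y (FA (u i) g) (FA (NObj s i) g)"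
proof -
  have g' [simp]: "g \<in> Ar (X i)" "Src (X i) g = x" "Tgt (X i) g = y" using g by (auto simp: Hom_def)
  have xy: "x \<in> Ob (X i)" "y \<in> Ob (X i)" using X_simps(4,5)[OF i g'(1)] by simp_all
  obtain n a where n: "n \<in> N" and a: "a \<in> Hom I i n" using N_upper[OF i i] by blast
  show ?thesis
    using psnat_NArr_natural[OF s a g'(1)] psnat_functor_simps(2-4)[OF s i g'(1)]
    by (intro transportI[OF s xy n a a Hom_\<phi>(3)[OF a g] Hom_\<phi>(4)[OF a g]]) (auto simp: Hom_def)
qed

text \<open>Over an index above \<open>j\<close> the lift is an identity, and the equation required
  is the compatibility of \<open>s\<close> with composition in \<open>I\<close>. Together with
  \<open>transport_FA\<close>, \<open>transport_Cmp\<close> and \<open>transport_unique\<close>,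
  this reduces coherence laws for \<open>s\<close> to equations between arrows of
  \<open>C\<close>.\<close>

lemma transport_NArr:
  assumes s: "lin_psnat k I F D s" and a: "a \<in> Hom I i j" and x: "x \<in> Ob (X i)"
  shows "transport s i x j (FO (\<phi> a) x) (Ide C (FO (u i) x)) (NArr s a x)"
proof -
  have ij: "i \<in> Ob I" "j \<in> Ob I" using Hom_\<phi>(5,6)[OF a] .
  obtain n b where n: "n \<in> N" and b: "b \<in> Hom I j n" using N_upper[OF ij(2) ij(2)] by blast
  have nO: "n \<in> Ob I" using n N_Ob by auto
  note y = Hom_\<phi>(1)[OF a x]
  note z = Hom_\<phi>(1)[OF b y]
  note [simp] = psnat_NArr(1-3)[OF s a x] psnat_NArr(1-3)[OF s b y] psnat_functor_simps[OF s nO]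
  show ?thesis
  proof (rule transportI[OF s x y n Hom_\<phi>_Cmp(1)[OF a b] b, of "Ide (X n) (FO (\<phi> b) (FO (\<phi> a) x))"])
    show "FA (u n) (Ide (X n) (FO (\<phi> b) (FO (\<phi> a) x))) = Ide C (FO (u i) x)"
      using nO z by (simp add: Hom_\<phi>(2)[OF b y] Hom_\<phi>(2)[OF a x])
    show "Ide (X n) (FO (\<phi> b) (FO (\<phi> a) x)) \<in> Hom (X n) (FO (\<phi> (b \<cdot>\<^bsub>I\<^esub> a)) x) (FO (\<phi> b) (FO (\<phi> a) x))"
      using nO z by (simp add: Hom_\<phi>_Cmp(2)[OF a b x] Hom_def)
    show "NArr s b (FO (\<phi> a) x) \<cdot>\<^bsub>D\<^esub> NArr s a x =
        FA (NObj s n) (Ide (X n) (FO (\<phi> b) (FO (\<phi> a) x))) \<cdot>\<^bsub>D\<^esub> NArr s (b \<cdot>\<^bsub>I\<^esub> a) x"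
      using z by (simp add: psnat_NArr_Cmp[OF s a b x])
  qed (simp add: Hom_def)
qed

lemma transport_add:
  assumes s: "lin_psnat k I F D s" and i: "i \<in> Ob I" "x \<in> Ob (X i)" and j: "j \<in> Ob I" "y \<in> Ob (X j)"
    and f: "f \<in> Hom C (FO (u i) x) (FO (u j) y)" "transport s i x j y f t"
    and f': "f' \<in> Hom C (FO (u i) x) (FO (u j) y)" "transport s i x j y f' t'"
  shows "transport s i x j y (ArAdd C f f') (ArAdd D t t')"
proof -
  obtain n a b where n: "n \<in> N" and a: "a \<in> Hom I i n" and b: "b \<in> Hom I j n"
    using N_upper[OF i(1) j(1)] by blast
  have nO: "n \<in> Ob I" using n N_Ob by auto
  interpret un: linear_functor "X n" C k "u n" by (rule u_linear_functor[OF nO])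
  interpret sn: linear_functor "X n" D k "NObj s n" by (rule psnat_functor[OF s nO])
  obtain g where g: "g \<in> Hom (X n) (FO (\<phi> a) x) (FO (\<phi> b) y)" "FA (u n) g = f"
    using lift_Ar[OF n a b i(2) j(2) f(1)] .
  obtain g' where g': "g' \<in> Hom (X n) (FO (\<phi> a) x) (FO (\<phi> b) y)" "FA (u n) g' = f'"
    using lift_Ar[OF n a b i(2) j(2) f'(1)] .
  have gs [simp]: "g \<in> Ar (X n)" "Src (X n) g = FO (\<phi> a) x" "Tgt (X n) g = FO (\<phi> b) y"
    "g' \<in> Ar (X n)" "Src (X n) g' = FO (\<phi> a) x" "Tgt (X n) g' = FO (\<phi> b) y" using g g' by (auto simp: Hom_def)
  note [simp] = psnat_NArr(1-3)[OF s a i(2)] psnat_NArr(1-3)[OF s b j(2)]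
    transportD(1-3)[OF f(2)] transportD(1-3)[OF f'(2)]
  show ?thesis
  proof (rule transportI[OF s i(2) j(2) n a b, of "ArAdd (X n) g g'"])
    show "NArr s b y \<cdot>\<^bsub>D\<^esub> ArAdd D t t' = FA (NObj s n) (ArAdd (X n) g g') \<cdot>\<^bsub>D\<^esub> NArr s a x"
      by (simp add: D.Cmp_add D.add_Cmp transportD(4)[OF f(2) n a b g] transportD(4)[OF f'(2) n a b g'])
  qed (use g g' in \<open>auto simp: Hom_def\<close>)
qed

lemma transport_smult:
  assumes s: "lin_psnat k I F D s" and i: "i \<in> Ob I" "x \<in> Ob (X i)" and j: "j \<in> Ob I" "y \<in> Ob (X j)"
    and f: "f \<in> Hom C (FO (u i) x) (FO (u j) y)" "transport s i x j y f t" and r: "r \<in> carrier k"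
  shows "transport s i x j y (ArSmult C r f) (ArSmult D r t)"
proof -
  obtain n a b where n: "n \<in> N" and a: "a \<in> Hom I i n" and b: "b \<in> Hom I j n"
    using N_upper[OF i(1) j(1)] by blast
  have nO: "n \<in> Ob I" using n N_Ob by auto
  interpret un: linear_functor "X n" C k "u n" by (rule u_linear_functor[OF nO])
  interpret sn: linear_functor "X n" D k "NObj s n" by (rule psnat_functor[OF s nO])
  obtain g where g: "g \<in> Hom (X n) (FO (\<phi> a) x) (FO (\<phi> b) y)" "FA (u n) g = f"
    using lift_Ar[OF n a b i(2) j(2) f(1)] .
  have gs [simp]: "g \<in> Ar (X n)" "Src (X n) g = FO (\<phi> a) x" "Tgt (X n) g = FO (\<phi> b) y"
    using g by (auto simp: Hom_def)
  note [simp] = psnat_NArr(1-3)[OF s a i(2)] psnat_NArr(1-3)[OF s b j(2)] transportD(1-3)[OF f(2)]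
  show ?thesis
  proof (rule transportI[OF s i(2) j(2) n a b, of "ArSmult (X n) r g"])
    show "NArr s b y \<cdot>\<^bsub>D\<^esub> ArSmult D r t = FA (NObj s n) (ArSmult (X n) r g) \<cdot>\<^bsub>D\<^esub> NArr s a x"
      using r by (simp add: D.Cmp_smult D.smult_Cmp transportD(4)[OF f(2) n a b g])
  qed (use g r in \<open>auto simp: Hom_def\<close>)
qed

end

section \<open>Gluing a pseudonatural transformation to a functor on \<open>C\<close>\<close>

context full_cocone_target
begin

text \<open>The values of \<open>s\<close> at different points over \<open>A\<close> are isomorphic
  but need not be equal, so one point over each object of \<open>C\<close> is fixed.\<close>

definition index :: "'o \<Rightarrow> 'i" where
  "index A = (SOME i. i \<in> Ob I \<and> (\<exists>x \<in> Ob (X i). FO (u i) x = A))"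

definition point :: "'o \<Rightarrow> 'x" where
  "point A = (SOME x. x \<in> Ob (X (index A)) \<and> FO (u (index A)) x = A)"

lemma index_point [simp]:
  assumes "A \<in> Ob C"
  shows "index A \<in> Ob I" "point A \<in> Ob (X (index A))" "FO (u (index A)) (point A) = A"
proof -
  have "index A \<in> Ob I \<and> (\<exists>x \<in> Ob (X (index A)). FO (u (index A)) x = A)"
    unfolding index_def by (rule someI_ex) (use u_surj[OF assms] in blast)
  then have ex: "\<exists>x. x \<in> Ob (X (index A)) \<and> FO (u (index A)) x = A" and i: "index A \<in> Ob I" by auto
  have "point A \<in> Ob (X (index A)) \<and> FO (u (index A)) (point A) = A"
    unfolding point_def by (rule someI_ex[OF ex])
  then show "index A \<in> Ob I" "point A \<in> Ob (X (index A))" "FO (u (index A)) (point A) = A"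
    using i by auto
qed

definition transported :: "('i, 'a, 'x, 'y, 'd, 'e) psnat \<Rightarrow> 'i \<Rightarrow> 'x \<Rightarrow> 'i \<Rightarrow> 'x \<Rightarrow> 'm \<Rightarrow> 'e" where
  "transported s i x j y f = (SOME t. transport s i x j y f t)"

lemma transported:
  assumes "lin_psnat k I F D s" "i \<in> Ob I" "x \<in> Ob (X i)" "j \<in> Ob I" "y \<in> Ob (X j)"
    "f \<in> Hom C (FO (u i) x) (FO (u j) y)"
  shows "transport s i x j y f (transported s i x j y f)"
  unfolding transported_def using transport_exists[OF assms] by (rule someI_ex)

definition glued :: "('i, 'a, 'x, 'y, 'd, 'e) psnat \<Rightarrow> ('o, 'm, 'd, 'e) func" where
  "glued s = \<lparr> FO = (\<lambda>A \<in> Ob C. FO (NObj s (index A)) (point A)),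
     FA = (\<lambda>f \<in> Ar C. transported s (index (Src C f)) (point (Src C f)) (index (Tgt C f)) (point (Tgt C f)) f) \<rparr>"

lemma glued_FO [simp]: "A \<in> Ob C \<Longrightarrow> FO (glued s) A = FO (NObj s (index A)) (point A)"
  by (simp add: glued_def)

lemma glued_transport:
  assumes s: "lin_psnat k I F D s" and f: "f \<in> Hom C A B"
  shows "transport s (index A) (point A) (index B) (point B) f (FA (glued s) f)"
proof -
  have "f \<in> Ar C" "Src C f = A" "Tgt C f = B" and AB: "A \<in> Ob C" "B \<in> Ob C" using f by (auto simp: Hom_def)
  then show ?thesis
    using transported[OF s, of "index A" "point A" "index B" "point B" f] f by (simp add: glued_def)
qed

lemma glued_eqI:
  assumes s: "lin_psnat k I F D s" and f: "f \<in> Hom C A B"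
    and t: "transport s (index A) (point A) (index B) (point B) f t"
  shows "FA (glued s) f = t"
proof -
  have AB: "A \<in> Ob C" "B \<in> Ob C" using f by (auto simp: Hom_def)
  show ?thesis
    by (rule transport_unique[OF s _ _ _ _ _ glued_transport[OF s f] t]) (use AB f in simp_all)
qed

text \<open>Transports are compatible with identities, composition, sums and scalars. By
  \<open>glued_eqI\<close>, which expresses their uniqueness, each law for the glued functor follows
  from the corresponding compatibility.\<close>

lemma glued_lin_functor:
  assumes s: "lin_psnat k I F D s"
  shows "lin_functor k C D (glued s)"
  unfolding lin_functor_def
proof (intro conjI ballI)
  show "is_functor C D (glued s)"
  proof (rule is_functorI)
    show "FO (glued s) \<in> extensional (Ob C)" "FA (glued s) \<in> extensional (Ar C)" by (simp_all add: glued_def)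
    show "FO (glued s) A \<in> Ob D" if "A \<in> Ob C" for A
      using that psnat_functor_simps(1)[OF s] by simp
    show "FA (glued s) f \<in> Hom D (FO (glued s) (Src C f)) (FO (glued s) (Tgt C f))" if "f \<in> Ar C" for f
      using glued_transport[OF s, of f "Src C f" "Tgt C f"] that by (auto simp: Hom_def transport_def)
    show "FA (glued s) (Ide C A) = Ide D (FO (glued s) A)" if A: "A \<in> Ob C" for A
    proof (rule glued_eqI[OF s])
      show "Ide C A \<in> Hom C A A" using A by (simp add: Hom_def)
      have "Ide (X (index A)) (point A) \<in> Hom (X (index A)) (point A) (point A)"
        using A by (simp add: Hom_def)
      from transport_FA[OF s _ this]
      show "transport s (index A) (point A) (index A) (point A) (Ide C A) (Ide D (FO (glued s) A))"
        using A by (simp add: psnat_functor_simps(5)[OF s])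
    qed
    fix f g assume fg: "f \<in> Ar C" "g \<in> Ar C" "Tgt C f = Src C g"
    then have f: "f \<in> Hom C (Src C f) (Tgt C f)" and g: "g \<in> Hom C (Tgt C f) (Tgt C g)" by (auto simp: Hom_def)
    show "FA (glued s) (g \<cdot>\<^bsub>C\<^esub> f) = FA (glued s) g \<cdot>\<^bsub>D\<^esub> FA (glued s) f"
    proof (rule glued_eqI[OF s C.Cmp_Hom[OF f g]])
      show "transport s (index (Src C f)) (point (Src C f)) (index (Tgt C g)) (point (Tgt C g))
          (g \<cdot>\<^bsub>C\<^esub> f) (FA (glued s) g \<cdot>\<^bsub>D\<^esub> FA (glued s) f)"
        by (rule transport_Cmp[OF s _ _ _ _ _ _ _ glued_transport[OF s f] _ glued_transport[OF s g]])
          (use fg f g in simp_all)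
    qed
  qed
  fix A B f g assume AB: "A \<in> Ob C" "B \<in> Ob C" and fg: "f \<in> Hom C A B" "g \<in> Hom C A B"
  show "FA (glued s) (ArAdd C f g) = ArAdd D (FA (glued s) f) (FA (glued s) g)"
  proof (rule glued_eqI[OF s C.add_Hom[OF AB fg]])
    show "transport s (index A) (point A) (index B) (point B) (ArAdd C f g) (ArAdd D (FA (glued s) f) (FA (glued s) g))"
      by (rule transport_add[OF s _ _ _ _ _ glued_transport[OF s fg(1)] _ glued_transport[OF s fg(2)]])
        (use AB fg in simp_all)
  qed
next
  fix f r assume f: "f \<in> Ar C" and r: "r \<in> carrier k"
  let ?A = "Src C f" and ?B = "Tgt C f"
  have fH: "f \<in> Hom C ?A ?B" using f by (simp add: Hom_def)
  show "FA (glued s) (ArSmult C r f) = ArSmult D r (FA (glued s) f)"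
  proof (rule glued_eqI[OF s C.smult_Hom[OF _ _ fH r]])
    show "transport s (index ?A) (point ?A) (index ?B) (point ?B) (ArSmult C r f) (ArSmult D r (FA (glued s) f))"
      by (rule transport_smult[OF s _ _ _ _ _ glued_transport[OF s fH] r]) (use f fH in simp_all)
  qed (use f in simp_all)
qed

section \<open>Composition with the cocone is an equivalence\<close>

abbreviation whisker :: "('o, 'm, 'd, 'e) func \<Rightarrow> ('i, 'a, 'x, 'y, 'd, 'e) psnat" where
  "whisker \<equiv> whisker_psnat I F cocone"

lemma lin_functor_linear_functor: "lin_functor k C D H \<Longrightarrow> linear_functor C D k H"
  by (intro linear_functorI C.linear D.linear)

lemma whisker_NObj [simp]: "i \<in> Ob I \<Longrightarrow> NObj (whisker H) i = comp_func (X i) H (u i)"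
  by (simp add: whisker_psnat_def)

lemma whisker_NArr [simp]:
  assumes "lin_functor k C D H" "a \<in> Ar I" "x \<in> Ob (X (Src I a))"
  shows "NArr (whisker H) a x = Ide D (FO H (FO (u (Src I a)) x))"
proof -
  interpret H: linear_functor C D k H by (rule lin_functor_linear_functor[OF assms(1)])
  show ?thesis using assms by (simp add: whisker_psnat_def)
qed

lemma whisker_lin_psnat:
  assumes "lin_functor k C D H"
  shows "lin_psnat k I F D (whisker H)"
  unfolding lin_psnat_def
proof (intro conjI ballI impI)
  interpret H: linear_functor C D k H by (rule lin_functor_linear_functor[OF assms])
  show "NObj (whisker H) \<in> extensional (Ob I)" "NArr (whisker H) \<in> extensional (Ar I)"
    by (simp_all add: whisker_psnat_def)
  fix i assume i: "i \<in> Ob I"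
  show "lin_functor k (PObj F i) D (NObj (whisker H) i)"
    using linear_functor_comp[OF u_linear_functor[OF i] H.linear_functor_axioms] i
    by (simp add: linear_functor_def linear_functor_axioms_def)
  fix x assume x: "x \<in> Ob (PObj F i)"
  show "NArr (whisker H) (Ide I i) x = FA (NObj (whisker H) i) (PUnit F i x)"
    using i x assms by simp
next
  interpret H: linear_functor C D k H by (rule lin_functor_linear_functor[OF assms])
  fix a assume a: "a \<in> Ar I"
  have "NArr (whisker H) a \<in> extensional (Ob (X (Src I a)))" using a by (simp add: whisker_psnat_def)
  then show "nat_iso (PObj F (Src I a)) D (NObj (whisker H) (Src I a))
        (comp_func (PObj F (Src I a)) (NObj (whisker H) (Tgt I a)) (PArr F a)) (NArr (whisker H) a)"
    using a assms by (auto simp: nat_iso_def nat_trans_def Hom_def)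
  fix b x assume b: "b \<in> Ar I" and ab: "Tgt I a = Src I b" and x: "x \<in> Ob (PObj F (Src I a))"
  have xb: "FO (\<phi> a) x \<in> Ob (X (Src I b))" using \<phi>_simps(1)[OF a, of x] x ab by simp
  have ux: "FO (u (Src I b)) (FO (\<phi> a) x) = FO (u (Src I a)) x" using u_\<phi>_simps(1)[OF a, of x] x ab by simp
  show "NArr (whisker H) (b \<cdot>\<^bsub>I\<^esub> a) x = FA (NObj (whisker H) (Tgt I b)) (PComp F b a x) \<cdot>\<^bsub>D\<^esub>
             (NArr (whisker H) b (FO (PArr F a) x) \<cdot>\<^bsub>D\<^esub> NArr (whisker H) a x)"
    using a b ab x xb assms by (simp add: ux)
qed

lemma modificationI:
  assumes "\<mu> \<in> extensional (Ob I)" "\<And>i. i \<in> Ob I \<Longrightarrow> nat_trans (X i) D (NObj s i) (NObj t i) (\<mu> i)"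
    "\<And>a i j x. a \<in> Hom I i j \<Longrightarrow> i \<in> Ob I \<Longrightarrow> j \<in> Ob I \<Longrightarrow> x \<in> Ob (X i) \<Longrightarrow>
      NArr t a x \<cdot>\<^bsub>D\<^esub> \<mu> i x = \<mu> j (FO (\<phi> a) x) \<cdot>\<^bsub>D\<^esub> NArr s a x"
  shows "modification I F D s t \<mu>"
  using assms unfolding modification_def by (auto simp: Hom_def)

lemma whisker_NArr_Hom:
  "lin_functor k C D H \<Longrightarrow> a \<in> Hom I i j \<Longrightarrow> x \<in> Ob (X i) \<Longrightarrow> NArr (whisker H) a x = Ide D (FO H (FO (u i) x))"
  using whisker_NArr[of H a x] by (auto simp: Hom_def)

lemma whisker_modification:
  assumes H: "lin_functor k C D H" and K: "lin_functor k C D K" and \<tau>: "nat_trans C D H K \<tau>"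
  shows "modification I F D (whisker H) (whisker K) (\<lambda>i \<in> Ob I. \<lambda>x \<in> Ob (X i). \<tau> (FO (u i) x))"
proof (rule modificationI)
  interpret H: linear_functor C D k H by (rule lin_functor_linear_functor[OF H])
  interpret K: linear_functor C D k K by (rule lin_functor_linear_functor[OF K])
  note [simp] = nat_transD(2-4)[OF \<tau>]
  fix i assume i: "i \<in> Ob I"
  show "nat_trans (X i) D (NObj (whisker H) i) (NObj (whisker K) i) ((\<lambda>i \<in> Ob I. \<lambda>x \<in> Ob (X i). \<tau> (FO (u i) x)) i)"
    unfolding nat_trans_def
  proof (intro conjI ballI)
    fix f assume f: "f \<in> Ar (X i)"
    show "FA (NObj (whisker K) i) f \<cdot>\<^bsub>D\<^esub> (\<lambda>i \<in> Ob I. \<lambda>x \<in> Ob (X i). \<tau> (FO (u i) x)) i (Src (X i) f) =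
       (\<lambda>i \<in> Ob I. \<lambda>x \<in> Ob (X i). \<tau> (FO (u i) x)) i (Tgt (X i) f) \<cdot>\<^bsub>D\<^esub> FA (NObj (whisker H) i) f"
      using nat_transD(5)[OF \<tau>, of "FA (u i) f"] f i by simp
  qed (use i in \<open>simp_all add: Hom_def\<close>)
next
  interpret H: linear_functor C D k H by (rule lin_functor_linear_functor[OF H])
  interpret K: linear_functor C D k K by (rule lin_functor_linear_functor[OF K])
  note [simp] = nat_transD(2-4)[OF \<tau>]
  fix a i j x assume a: "a \<in> Hom I i j" and ij: "i \<in> Ob I" "j \<in> Ob I" and x: "x \<in> Ob (X i)"
  show "NArr (whisker K) a x \<cdot>\<^bsub>D\<^esub> (\<lambda>i \<in> Ob I. \<lambda>x \<in> Ob (X i). \<tau> (FO (u i) x)) i x =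
      (\<lambda>i \<in> Ob I. \<lambda>x \<in> Ob (X i). \<tau> (FO (u i) x)) j (FO (\<phi> a) x) \<cdot>\<^bsub>D\<^esub> NArr (whisker H) a x"
    using ij x Hom_\<phi>(1,2)[OF a x] whisker_NArr_Hom[OF H a x] whisker_NArr_Hom[OF K a x] by simp
qed simp

abbreviation P where
  "P \<equiv> precomp_psnat k I F C cocone D"

lemma P_FO [simp]: "lin_functor k C D H \<Longrightarrow> FO P H = whisker H"
  by (simp add: precomp_psnat_def)

lemma P_FA [simp]:
  assumes "lin_functor k C D H" "lin_functor k C D K" "nat_trans C D H K \<tau>"
  shows "FA P (H, \<tau>, K) = (whisker H, (\<lambda>i \<in> Ob I. \<lambda>x \<in> Ob (X i). \<tau> (FO (u i) x)), whisker K)"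
proof -
  have "(\<lambda>i \<in> Ob I. \<lambda>x \<in> Ob (PObj F i). \<tau> (FO (NObj cocone i) x)) = (\<lambda>i \<in> Ob I. \<lambda>x \<in> Ob (X i). \<tau> (FO (u i) x))"
    by (rule restrict_ext) simp
  then show ?thesis using assms by (simp add: precomp_psnat_def)
qed

lemma P_functor: "functor_between (lin_functor_cat k C D) psnats P"
proof -
  let ?L = "lin_functor_cat k C D"
  note fb = lin_functor_between[OF C.linear D.linear]
  have "is_functor ?L psnats P"
  proof (rule is_functorI)
    show "FO P H \<in> Ob psnats" if "H \<in> Ob ?L" for H using that whisker_lin_psnat by simp
    show "FO P \<in> extensional (Ob ?L)" "FA P \<in> extensional (Ar ?L)" by (simp_all add: precomp_psnat_def)
    fix x assume x: "x \<in> Ar ?L"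
    obtain H \<tau> K where x_eq [simp]: "x = (H, \<tau>, K)" by (cases x) auto
    have H: "lin_functor k C D H" and K: "lin_functor k C D K" and \<tau>: "nat_trans C D H K \<tau>" using x by auto
    show "FA P x \<in> Hom psnats (FO P (Src ?L x)) (FO P (Tgt ?L x))"
      using H K \<tau> whisker_lin_psnat whisker_modification by (simp add: Hom_def)
    fix y assume y: "y \<in> Ar ?L" "Tgt ?L x = Src ?L y"
    obtain \<sigma> M where y_eq [simp]: "y = (K, \<sigma>, M)" using y by (cases y) auto
    have M: "lin_functor k C D M" and \<sigma>: "nat_trans C D K M \<sigma>" using y by auto
    have "nat_trans C D H M (\<lambda>x \<in> Ob C. \<sigma> x \<cdot>\<^bsub>D\<^esub> \<tau> x)"
      by (rule nat_trans_Cmp[OF fb[OF H] fb[OF K] fb[OF M] \<tau> \<sigma>])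
    then show "FA P (y \<cdot>\<^bsub>?L\<^esub> x) = FA P y \<cdot>\<^bsub>psnats\<^esub> FA P x"
      using H K M \<tau> \<sigma> by (auto intro!: restrict_ext)
  next
    fix H assume "H \<in> Ob ?L"
    then have H: "lin_functor k C D H" by simp
    have "nat_trans C D H H (\<lambda>x \<in> Ob C. Ide D (FO H x))"
      by (rule nat_trans_Ide[OF fb[OF H]])
    then show "FA P (Ide ?L H) = Ide psnats (FO P H)"
      using H by (auto intro!: restrict_ext)
  qed
  then show ?thesis
    using lin_functor_cat_category[OF C.linear D.linear] psnats_category
    by (simp add: functor_between_def category_def functor_between_axioms_def)
qed

text \<open>The structure cells of a whiskered transformation are identities, so the components of
  \<open>\<mu>\<close> are constant along the arrows of \<open>I\<close>. Over a common bound
  \<open>n\<close> in \<open>N\<close> the two points become equal, since \<open>u n\<close> is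
  injective on objects.\<close>

lemma modification_whisker_eq:
  assumes H: "lin_functor k C D H" and K: "lin_functor k C D K"
    and \<mu>: "modification I F D (whisker H) (whisker K) \<mu>"
    and i: "i \<in> Ob I" "x \<in> Ob (X i)" and j: "j \<in> Ob I" "y \<in> Ob (X j)" and eq: "FO (u i) x = FO (u j) y"
  shows "\<mu> i x = \<mu> j y"
proof -
  interpret H: linear_functor C D k H by (rule lin_functor_linear_functor[OF H])
  interpret K: linear_functor C D k K by (rule lin_functor_linear_functor[OF K])
  have up: "\<mu> i x = \<mu> n (FO (\<phi> a) x)" if a: "a \<in> Hom I i n" and x: "x \<in> Ob (X i)" for a i n x
  proof -
    note i = Hom_\<phi>(5,6)[OF a] and y = Hom_\<phi>(1,2)[OF a x]
    note \<mu>' = nat_transD(2-4)[OF modificationD(2)[OF \<mu> i(1)] x] nat_transD(2-4)[OF modificationD(2)[OF \<mu> i(2)] y(1)]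
    show ?thesis
      using modificationD(3)[OF \<mu> a x] \<mu>' i x y whisker_NArr_Hom[OF H a x] whisker_NArr_Hom[OF K a x] by simp
  qed
  obtain n a b where n: "n \<in> N" and a: "a \<in> Hom I i n" and b: "b \<in> Hom I j n"
    using N_upper[OF i(1) j(1)] by blast
  have "FO (\<phi> a) x = FO (\<phi> b) y"
    by (rule inj_onD[OF N_inj[OF n]])
      (use Hom_\<phi>(1,2)[OF a i(2)] Hom_\<phi>(1,2)[OF b j(2)] eq in simp_all)
  then show ?thesis using up[OF a i(2)] up[OF b j(2)] by simp
qed

text \<open>By \<open>modification_whisker_eq\<close> the components of \<open>\<mu>\<close> depend
  only on the object of \<open>C\<close>, which gives \<open>\<tau>\<close>. Naturality of
  \<open>\<tau>\<close> at an arbitrary \<open>f\<close> is naturality of \<open>\<mu> n\<close> at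
  a lift of \<open>f\<close> to some \<open>n\<close> in \<open>N\<close>.\<close>

lemma P_full:
  assumes H: "lin_functor k C D H" and K: "lin_functor k C D K"
    and g: "g \<in> Hom psnats (whisker H) (whisker K)"
  shows "\<exists>f \<in> Hom (lin_functor_cat k C D) H K. FA P f = g"
proof -
  interpret H: linear_functor C D k H by (rule lin_functor_linear_functor[OF H])
  interpret K: linear_functor C D k K by (rule lin_functor_linear_functor[OF K])
  obtain \<mu> where g_eq: "g = (whisker H, \<mu>, whisker K)" and \<mu>: "modification I F D (whisker H) (whisker K) \<mu>"
    using g by (cases g) (auto simp: Hom_def)
  define \<tau> where "\<tau> = (\<lambda>A \<in> Ob C. \<mu> (index A) (point A))"
  have \<tau>: "\<mu> i x = \<tau> (FO (u i) x)" if "i \<in> Ob I" "x \<in> Ob (X i)" for i x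
    using modification_whisker_eq[OF H K \<mu> that, of "index (FO (u i) x)" "point (FO (u i) x)"] that
    by (simp add: \<tau>_def)
  have \<mu>_simps: "\<mu> i x \<in> Ar D" "Src D (\<mu> i x) = FO H (FO (u i) x)" "Tgt D (\<mu> i x) = FO K (FO (u i) x)"
    if "i \<in> Ob I" "x \<in> Ob (X i)" for i x
    using nat_transD(2-4)[OF modificationD(2)[OF \<mu> that(1)] that(2)] that by simp_all
  have "nat_trans C D H K \<tau>"
    unfolding nat_trans_def
  proof (intro conjI ballI)
    show "\<tau> \<in> extensional (Ob C)" by (simp add: \<tau>_def)
    show "\<tau> A \<in> Hom D (FO H A) (FO K A)" if "A \<in> Ob C" for A
      using \<mu>_simps[of "index A" "point A"] that by (simp add: \<tau>_def Hom_def)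
    fix f assume f: "f \<in> Ar C"
    have A: "Src C f \<in> Ob C" "Tgt C f \<in> Ob C" using f by auto
    obtain n a b where n: "n \<in> N" and a: "a \<in> Hom I (index (Src C f)) n" and b: "b \<in> Hom I (index (Tgt C f)) n"
      using N_upper[of "index (Src C f)" "index (Tgt C f)"] A by auto
    have nO: "n \<in> Ob I" using n N_Ob by auto
    obtain g where g: "g \<in> Hom (X n) (FO (\<phi> a) (point (Src C f))) (FO (\<phi> b) (point (Tgt C f)))" "FA (u n) g = f"
      using lift_Ar[OF n a b, of "point (Src C f)" "point (Tgt C f)" f] A f by (auto simp: Hom_def)
    have g': "g \<in> Ar (X n)" using g by (simp add: Hom_def)
    have src: "FO (u n) (Src (X n) g) = Src C f" "FO (u n) (Tgt (X n) g) = Tgt C f"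
      using u_simps(3,4)[OF nO g'] g(2) by simp_all
    show "FA K f \<cdot>\<^bsub>D\<^esub> \<tau> (Src C f) = \<tau> (Tgt C f) \<cdot>\<^bsub>D\<^esub> FA H f"
      using nat_transD(5)[OF modificationD(2)[OF \<mu> nO] g'] g' nO g(2) by (simp add: \<tau> src)
  qed
  moreover have "(\<lambda>i \<in> Ob I. \<lambda>x \<in> Ob (X i). \<tau> (FO (u i) x)) = \<mu>"
  proof (rule extensionalityI[of _ "Ob I"])
    fix i assume i: "i \<in> Ob I"
    show "(\<lambda>i \<in> Ob I. \<lambda>x \<in> Ob (X i). \<tau> (FO (u i) x)) i = \<mu> i"
      using nat_transD(1)[OF modificationD(2)[OF \<mu> i]] i \<tau> by (auto intro!: extensionalityI[of _ "Ob (X i)"])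
  qed (use modificationD(1)[OF \<mu>] in simp_all)
  ultimately show ?thesis
    using H K g_eq by (intro bexI[of _ "(H, \<tau>, K)"]) (simp_all add: Hom_def)
qed

text \<open>Every object of \<open>C\<close> is the value of some \<open>u i\<close>, so every
  component of the transformation occurs in its whiskering.\<close>

lemma P_faithful:
  assumes H: "lin_functor k C D H" and K: "lin_functor k C D K"
    and \<tau>: "nat_trans C D H K \<tau>" and \<sigma>: "nat_trans C D H K \<sigma>"
    and eq: "FA P (H, \<tau>, K) = FA P (H, \<sigma>, K)"
  shows "\<tau> = \<sigma>"
proof (rule extensionalityI[OF nat_transD(1)[OF \<tau>] nat_transD(1)[OF \<sigma>]])
  fix A assume A: "A \<in> Ob C"
  have "(\<lambda>i \<in> Ob I. \<lambda>x \<in> Ob (X i). \<tau> (FO (u i) x)) (index A) (point A) =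
      (\<lambda>i \<in> Ob I. \<lambda>x \<in> Ob (X i). \<sigma> (FO (u i) x)) (index A) (point A)"
    using eq H K \<tau> \<sigma> by simp
  then show "\<tau> A = \<sigma> A" using A by simp
qed

text \<open>The comparison at a point \<open>x\<close> over \<open>A\<close> and its inverse are the
  transports of the identity of \<open>A\<close> between \<open>x\<close> and the chosen point over
  \<open>A\<close>. Each law that they must satisfy holds because both sides are transports of the
  same arrow of \<open>C\<close>.\<close>

lemma glued_whisker_iso:
  assumes s: "lin_psnat k I F D s"
  shows "\<exists>e \<in> Hom psnats (whisker (glued s)) s. is_iso psnats e"
proof -
  let ?H = "glued s"
  note H = glued_lin_functor[OF s]
  interpret H: linear_functor C D k ?H by (rule lin_functor_linear_functor[OF H])
  note W = whisker_lin_psnat[OF H]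
  let ?i = "\<lambda>i x. index (FO (u i) x)" and ?x = "\<lambda>i x. point (FO (u i) x)" and ?id = "\<lambda>i x. Ide C (FO (u i) x)"
  \<comment> \<open>\<open>\<mu>\<close> leads from the chosen point to \<open>x\<close>, and
    \<open>\<nu>\<close> back.\<close>
  define \<mu> where "\<mu> = (\<lambda>i \<in> Ob I. \<lambda>x \<in> Ob (X i). transported s (?i i x) (?x i x) i x (?id i x))"
  define \<nu> where "\<nu> = (\<lambda>i \<in> Ob I. \<lambda>x \<in> Ob (X i). transported s i x (?i i x) (?x i x) (?id i x))"
  have id: "?id i x \<in> Hom C (FO (u i) x) (FO (u i) x)" if "i \<in> Ob I" "x \<in> Ob (X i)" for i x
    using that by (simp add: Hom_def)
  have \<mu>: "transport s (?i i x) (?x i x) i x (?id i x) (\<mu> i x)" and \<nu>: "transport s i x (?i i x) (?x i x) (?id i x) (\<nu> i x)"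
    if "i \<in> Ob I" "x \<in> Ob (X i)" for i x
    using transported[OF s, of "?i i x" "?x i x" i x "?id i x"] transported[OF s, of i x "?i i x" "?x i x" "?id i x"] id that
    by (simp_all add: \<mu>_def \<nu>_def)
  note \<mu>_simps = transportD(1-3)[OF \<mu>] and \<nu>_simps = transportD(1-3)[OF \<nu>]
  have \<mu>_nat: "FA (NObj s i) f \<cdot>\<^bsub>D\<^esub> \<mu> i (Src (X i) f) = \<mu> i (Tgt (X i) f) \<cdot>\<^bsub>D\<^esub> FA ?H (FA (u i) f)"
    and \<nu>_nat: "FA ?H (FA (u i) f) \<cdot>\<^bsub>D\<^esub> \<nu> i (Src (X i) f) = \<nu> i (Tgt (X i) f) \<cdot>\<^bsub>D\<^esub> FA (NObj s i) f"
    if i: "i \<in> Ob I" and f: "f \<in> Ar (X i)" for i f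
  proof -
    let ?a = "Src (X i) f" and ?b = "Tgt (X i) f"
    have ab: "?a \<in> Ob (X i)" "?b \<in> Ob (X i)" using i f by simp_all
    have fH: "f \<in> Hom (X i) ?a ?b" using f by (simp add: Hom_def)
    have uf: "FA (u i) f \<in> Hom C (FO (u i) ?a) (FO (u i) ?b)" using i f by (simp add: Hom_def)
    have uab: "FO (u i) ?a \<in> Ob C" "FO (u i) ?b \<in> Ob C" using i ab by simp_all
    have un: "FA (u i) f \<cdot>\<^bsub>C\<^esub> ?id i ?a = FA (u i) f" "?id i ?b \<cdot>\<^bsub>C\<^esub> FA (u i) f = FA (u i) f"
      using i f by simp_all
    note f1 = transport_FA[OF s i fH] and f2 = glued_transport[OF s uf]
    note ip = index_point[OF uab(1)] index_point[OF uab(2)]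
    \<comment> \<open>Both paths around the naturality square are transports of
      \<open>FA (u i) f\<close>; the same holds for \<open>\<nu>\<close> below.\<close>
    have "transport s (?i i ?a) (?x i ?a) i ?b (FA (u i) f) (FA (NObj s i) f \<cdot>\<^bsub>D\<^esub> \<mu> i ?a)"
      using transport_Cmp[OF s ip(1,2) i ab(1) i ab(2) _ \<mu>[OF i ab(1)] uf f1] id[OF i ab(1)] ip unfolding un by simp
    moreover have "transport s (?i i ?a) (?x i ?a) i ?b (FA (u i) f) (\<mu> i ?b \<cdot>\<^bsub>D\<^esub> FA ?H (FA (u i) f))"
      using transport_Cmp[OF s ip(1,2) ip(4,5) i ab(2) _ f2 _ \<mu>[OF i ab(2)]] uf id[OF i ab(2)] ip unfolding un by simp
    ultimately show "FA (NObj s i) f \<cdot>\<^bsub>D\<^esub> \<mu> i ?a = \<mu> i ?b \<cdot>\<^bsub>D\<^esub> FA ?H (FA (u i) f)"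
      by (rule transport_unique[OF s ip(1,2) i ab(2), rotated]) (use uf ip in simp)
    have "transport s i ?a (?i i ?b) (?x i ?b) (FA (u i) f) (FA ?H (FA (u i) f) \<cdot>\<^bsub>D\<^esub> \<nu> i ?a)"
      using transport_Cmp[OF s i ab(1) ip(1,2) ip(4,5) _ \<nu>[OF i ab(1)] _ f2] uf id[OF i ab(1)] ip unfolding un by simp
    moreover have "transport s i ?a (?i i ?b) (?x i ?b) (FA (u i) f) (\<nu> i ?b \<cdot>\<^bsub>D\<^esub> FA (NObj s i) f)"
      using transport_Cmp[OF s i ab(1) i ab(2) ip(4,5) uf f1 _ \<nu>[OF i ab(2)]] id[OF i ab(2)] ip unfolding un by simp
    ultimately show "FA ?H (FA (u i) f) \<cdot>\<^bsub>D\<^esub> \<nu> i ?a = \<nu> i ?b \<cdot>\<^bsub>D\<^esub> FA (NObj s i) f"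
      by (rule transport_unique[OF s i ab(1) ip(4,5), rotated]) (use uf ip in simp)
  qed
  have \<mu>_NArr: "NArr s a x \<cdot>\<^bsub>D\<^esub> \<mu> i x = \<mu> j (FO (\<phi> a) x)"
    and \<nu>_NArr: "\<nu> i x = \<nu> j (FO (\<phi> a) x) \<cdot>\<^bsub>D\<^esub> NArr s a x"
    if a: "a \<in> Hom I i j" and ij: "i \<in> Ob I" "j \<in> Ob I" and x: "x \<in> Ob (X i)" for a i j x
  proof -
    note y = Hom_\<phi>(1,2)[OF a x]
    have ux: "FO (u i) x \<in> Ob C" using ij x by simp
    note ip = index_point[OF ux]
    have un: "?id i x \<cdot>\<^bsub>C\<^esub> ?id i x = ?id i x" using ux by simp
    \<comment> \<open>\<open>FO (\<phi> a) x\<close> and \<open>x\<close> have the same image in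
      \<open>C\<close>, hence the same chosen point, so the comparisons at both start from or end at
      one value of \<open>s\<close>.\<close>
    note t = transport_NArr[OF s a x] and \<mu>y = \<mu>[OF ij(2) y(1), unfolded y(2)] and \<nu>y = \<nu>[OF ij(2) y(1), unfolded y(2)]
    have \<mu>t: "transport s (?i i x) (?x i x) j (FO (\<phi> a) x) (?id i x) (NArr s a x \<cdot>\<^bsub>D\<^esub> \<mu> i x)"
      using transport_Cmp[OF s ip(1,2) ij(1) x ij(2) y(1) _ \<mu>[OF ij(1) x] _ t] id[OF ij(1) x] y ip unfolding un by simp
    show "NArr s a x \<cdot>\<^bsub>D\<^esub> \<mu> i x = \<mu> j (FO (\<phi> a) x)"
      by (rule transport_unique[OF s ip(1,2) ij(2) y(1) _ \<mu>t \<mu>y]) (use id[OF ij(1) x] y ip in simp)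
    have \<nu>t: "transport s i x (?i i x) (?x i x) (?id i x) (\<nu> j (FO (\<phi> a) x) \<cdot>\<^bsub>D\<^esub> NArr s a x)"
      using transport_Cmp[OF s ij(1) x ij(2) y(1) ip(1,2) _ t _ \<nu>y] id[OF ij(1) x] y ip unfolding un by simp
    show "\<nu> i x = \<nu> j (FO (\<phi> a) x) \<cdot>\<^bsub>D\<^esub> NArr s a x"
      by (rule transport_unique[OF s ij(1) x ip(1,2) _ \<nu>[OF ij(1) x] \<nu>t]) (use id[OF ij(1) x] ip in simp)
  qed
  have \<mu>_mod: "modification I F D (whisker ?H) s \<mu>"
  proof (rule modificationI)
    show "\<mu> \<in> extensional (Ob I)" by (simp add: \<mu>_def)
    fix i assume i: "i \<in> Ob I"
    show "nat_trans (X i) D (NObj (whisker ?H) i) (NObj s i) (\<mu> i)"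
      unfolding nat_trans_def
    proof (intro conjI ballI)
      show "\<mu> i \<in> extensional (Ob (X i))" using i by (simp add: \<mu>_def)
      show "\<mu> i x \<in> Hom D (FO (NObj (whisker ?H) i) x) (FO (NObj s i) x)" if "x \<in> Ob (X i)" for x
        using \<mu>_simps[OF i that] i that by (simp add: Hom_def)
      show "FA (NObj s i) f \<cdot>\<^bsub>D\<^esub> \<mu> i (Src (X i) f) = \<mu> i (Tgt (X i) f) \<cdot>\<^bsub>D\<^esub> FA (NObj (whisker ?H) i) f"
        if "f \<in> Ar (X i)" for f
        using \<mu>_nat[OF i that] i that by simp
    qed
  next
    fix a i j x assume a: "a \<in> Hom I i j" and ij: "i \<in> Ob I" "j \<in> Ob I" and x: "x \<in> Ob (X i)"
    show "NArr s a x \<cdot>\<^bsub>D\<^esub> \<mu> i x = \<mu> j (FO (\<phi> a) x) \<cdot>\<^bsub>D\<^esub> NArr (whisker ?H) a x"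
      using \<mu>_NArr[OF a ij x] \<mu>_simps[OF ij(2) Hom_\<phi>(1)[OF a x]] Hom_\<phi>(2)[OF a x] whisker_NArr_Hom[OF H a x] ij x by simp
  qed
  have \<nu>_mod: "modification I F D s (whisker ?H) \<nu>"
  proof (rule modificationI)
    show "\<nu> \<in> extensional (Ob I)" by (simp add: \<nu>_def)
    fix i assume i: "i \<in> Ob I"
    show "nat_trans (X i) D (NObj s i) (NObj (whisker ?H) i) (\<nu> i)"
      unfolding nat_trans_def
    proof (intro conjI ballI)
      show "\<nu> i \<in> extensional (Ob (X i))" using i by (simp add: \<nu>_def)
      show "\<nu> i x \<in> Hom D (FO (NObj s i) x) (FO (NObj (whisker ?H) i) x)" if "x \<in> Ob (X i)" for x
        using \<nu>_simps[OF i that] i that by (simp add: Hom_def)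
      show "FA (NObj (whisker ?H) i) f \<cdot>\<^bsub>D\<^esub> \<nu> i (Src (X i) f) = \<nu> i (Tgt (X i) f) \<cdot>\<^bsub>D\<^esub> FA (NObj s i) f"
        if "f \<in> Ar (X i)" for f
        using \<nu>_nat[OF i that] i that by simp
    qed
  next
    fix a i j x assume a: "a \<in> Hom I i j" and ij: "i \<in> Ob I" "j \<in> Ob I" and x: "x \<in> Ob (X i)"
    show "NArr (whisker ?H) a x \<cdot>\<^bsub>D\<^esub> \<nu> i x = \<nu> j (FO (\<phi> a) x) \<cdot>\<^bsub>D\<^esub> NArr s a x"
      using \<nu>_NArr[OF a ij x] \<nu>_simps[OF ij(1) x] whisker_NArr_Hom[OF H a x] ij x by simp
  qed
  have \<nu>\<mu>: "\<nu> i x \<cdot>\<^bsub>D\<^esub> \<mu> i x = Ide D (FO ?H (FO (u i) x))" and \<mu>\<nu>: "\<mu> i x \<cdot>\<^bsub>D\<^esub> \<nu> i x = Ide D (FO (NObj s i) x)"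
    if i: "i \<in> Ob I" and x: "x \<in> Ob (X i)" for i x
  proof -
    have ux: "FO (u i) x \<in> Ob C" using i x by simp
    note ip = index_point[OF ux]
    have un: "?id i x \<cdot>\<^bsub>C\<^esub> ?id i x = ?id i x" using ux by simp
    \<comment> \<open>The composites in both orders are transports of an identity of
      \<open>C\<close>, and so are the identities of \<open>D\<close>.\<close>
    have "transport s (?i i x) (?x i x) (?i i x) (?x i x) (?id i x) (\<nu> i x \<cdot>\<^bsub>D\<^esub> \<mu> i x)"
      using transport_Cmp[OF s ip(1,2) i x ip(1,2) _ \<mu>[OF i x] _ \<nu>[OF i x]] id[OF i x] ip unfolding un by simp
    from glued_eqI[OF s id[OF i x] this] show "\<nu> i x \<cdot>\<^bsub>D\<^esub> \<mu> i x = Ide D (FO ?H (FO (u i) x))"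
      using ux by (simp del: glued_FO)
    have 1: "transport s i x i x (?id i x) (\<mu> i x \<cdot>\<^bsub>D\<^esub> \<nu> i x)"
      using transport_Cmp[OF s i x ip(1,2) i x _ \<nu>[OF i x] _ \<mu>[OF i x]] id[OF i x] ip unfolding un by simp
    have "Ide (X i) x \<in> Hom (X i) x x" using i x by (simp add: Hom_def)
    from transport_FA[OF s i this] have 2: "transport s i x i x (?id i x) (Ide D (FO (NObj s i) x))"
      using i x by (simp add: psnat_functor_simps(5)[OF s])
    show "\<mu> i x \<cdot>\<^bsub>D\<^esub> \<nu> i x = Ide D (FO (NObj s i) x)"
      by (rule transport_unique[OF s i x i x id[OF i x] 1 2])
  qed
  interpret P: category psnats by unfold_locales (rule psnats_category)
  have e: "(whisker ?H, \<mu>, s) \<in> Hom psnats (whisker ?H) s" "(s, \<nu>, whisker ?H) \<in> Hom psnats s (whisker ?H)"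
    using s W \<mu>_mod \<nu>_mod by (simp_all add: Hom_def)
  have "is_iso psnats (whisker ?H, \<mu>, s)"
    by (rule P.is_isoI[OF e]) (auto simp: \<nu>\<mu> \<mu>\<nu> simp del: glued_FO intro!: restrict_ext)
  then show ?thesis using e(1) by blast
qed

lemma P_equivalence: "is_equivalence (lin_functor_cat k C D) psnats P"
proof (rule equivalenceI[OF P_functor])
  let ?L = "lin_functor_cat k C D"
  show "\<exists>f \<in> Hom ?L H K. FA P f = g" if "H \<in> Ob ?L" "K \<in> Ob ?L" "g \<in> Hom psnats (FO P H) (FO P K)" for H K g
    using that P_full by simp
  show "f = g" if fg: "f \<in> Ar ?L" "g \<in> Ar ?L" "Src ?L f = Src ?L g" "Tgt ?L f = Tgt ?L g" "FA P f = FA P g" for f g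
  proof -
    obtain H \<tau> K where f: "f = (H, \<tau>, K)" by (cases f) auto
    then obtain \<sigma> where g: "g = (H, \<sigma>, K)" using fg by (cases g) auto
    show ?thesis using P_faithful[of H K \<tau> \<sigma>] fg by (simp add: f g del: P_FA)
  qed
  show "\<exists>H \<in> Ob ?L. \<exists>e \<in> Hom psnats (FO P H) s. is_iso psnats e" if "s \<in> Ob psnats" for s
    using glued_whisker_iso[of s] glued_lin_functor[of s] that by (intro bexI[of _ "glued s"]) auto
qed

end

lemma (in full_cocone) bicolimit:
  "is_lin_filtered_bicolimit TYPE('d \<times> 'e) k I F C cocone"
  unfolding is_lin_filtered_bicolimit_def
proof (intro conjI allI impI filtered strict_pseudofunctor C.linear cocone_psnat)
  fix D :: "('d, 'e, 'k) lincat" assume D: "lin_category k D"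
  interpret full_cocone_target I C k X \<phi> u N D
    using D by unfold_locales (auto simp: lin_category_def)
  show "is_equivalence (lin_functor_cat k C D) (psnat_cat k I F D) (precomp_psnat k I F C cocone D)"
    by (rule P_equivalence)
qed

section \<open>The site presentations of a Grothendieck category as an instance of the
  criterion\<close>

theorem theorem1p3:
  fixes U :: "'u set" and k :: "'k ring" and C :: "('o, 'm, 'k) lincat"
  assumes "universe U"
    and "cring k" and "small U (carrier k)"
    and "grothendieck_category U k C"
  shows "is_lin_filtered_bicolimit TYPE('d \<times> 'e) k
           (site_presentations U k C) (presentation_functor U k C) C (presentation_cocone U k C)"
proof -
  interpret grothendieck_cat C k U
    using assms by unfold_locales (auto simp: grothendieck_category_def abelian_category_def lin_category_def)
  interpret SP: category SP by unfold_locales (rule SP_category)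
  let ?X = "\<lambda>(\<a>, T, u). \<a>" and ?\<phi> = "\<lambda>(p, f, q). f" and ?u = "\<lambda>(\<a>, T, u). u"
  \<comment> \<open>The indices at which comparisons are made: the full subcategories on all small
    generating sets.\<close>
  let ?N = "full_presentation ` {S. generating S}"
  have X: "?X = fst" and u: "?u = (\<lambda>p. snd (snd p))" by auto
  interpret full_cocone SP C k ?X ?\<phi> ?u ?N
  proof
    show "filtered_category SP" by (rule SP_filtered)
    show "lin_category k (?X p)" if "p \<in> Ob SP" for p
      unfolding X using that presentation_lin_category by simp
    show "lin_functor k (?X p) C (?u p)" if "p \<in> Ob SP" for p
      unfolding X u using that presentation_lin_functor by simp
    show "?\<phi> (Ide SP p) = id_func (?X p)" if "p \<in> Ob SP" for p unfolding X by simp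
    show "?N \<subseteq> Ob SP" using full_presentation_Ob by blast
    fix a assume a: "a \<in> Ar SP"
    then show "lin_functor k (?X (Src SP a)) (?X (Tgt SP a)) (?\<phi> a)"
      unfolding X using presentation_arrow_lin_functor by (cases a) auto
    show "comp_func (?X (Src SP a)) (?u (Tgt SP a)) (?\<phi> a) = ?u (Src SP a)"
      unfolding X u using a presentation_arrow_comm by (cases a) auto
    fix b assume "b \<in> Ar SP" "Tgt SP a = Src SP b"
    then show "?\<phi> (b \<cdot>\<^bsub>SP\<^esub> a) = comp_func (?X (Src SP a)) (?\<phi> b) (?\<phi> a)"
      unfolding X by (cases a; cases b) auto
  next
    fix n assume "n \<in> ?N"
    then obtain S where n: "n = full_presentation S" and S: "generating S" by blast
    interpret full_subcategory C k U S using S by unfold_locales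
    have Xn: "?X n = full_cat S" and un: "?u n = full_func S" by (simp_all add: n full_presentation_def)
    show "inj_on (FO (?u n)) (Ob (?X n))" unfolding Xn un by (auto intro!: inj_onI)
    show "inj_on (FA (?u n)) (Ar (?X n))"
      unfolding Xn un by (rule inj_onI) (metis decA_simps(4) full_func_simps(2))
    show "a = b" if "a \<in> Hom SP i n" "b \<in> Hom SP i n" for a b i
      using Hom_full_presentation_unique[OF S] that unfolding n by blast
    fix x y f assume "x \<in> Ob (?X n)" "y \<in> Ob (?X n)" and f: "f \<in> Hom C (FO (?u n) x) (FO (?u n) y)"
    then obtain A B where A: "x = encO S A" "A \<in> S" "y = encO S B" "B \<in> S" unfolding Xn by auto
    then have f': "f \<in> Hom C A B" using f unfolding un by simp
    have "encA S f \<in> Hom (full_cat S) x y" "FA (full_func S) (encA S f) = f"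
      using A f' by (auto simp: Hom_def)
    then show "\<exists>g \<in> Hom (?X n) x y. FA (?u n) g = f" unfolding Xn un by blast
  next
    show "\<exists>n \<in> ?N. Hom SP p n \<noteq> {} \<and> Hom SP q n \<noteq> {}" if "p \<in> Ob SP" "q \<in> Ob SP" for p q
      using SP_upper[OF that] by blast
    fix A assume A: "A \<in> Ob C"
    \<comment> \<open>A generating set stays generating when \<open>A\<close> is added, so
      \<open>A\<close> itself, and not just an isomorphic object, is the value of a
      presentation.\<close>
    obtain S0 where "generating S0" using ex_generating by blast
    then have S: "generating (insert A S0)" using A by (rule generating_insert)
    interpret full_subcategory C k U "insert A S0" using S by unfold_locales
    have "encO (insert A S0) A \<in> Ob (full_cat (insert A S0))"
      "FO (full_func (insert A S0)) (encO (insert A S0) A) = A"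
      by simp_all
    then show "\<exists>p \<in> Ob SP. \<exists>x \<in> Ob (?X p). FO (?u p) x = A"
      by (intro bexI[of _ "full_presentation (insert A S0)"] bexI[of _ "encO (insert A S0) A"])
        (simp_all add: full_presentation_def is_presentation_full[unfolded full_presentation_def])
  qed
  have "presentation_cocone U k C = cocone"
  proof -
    have "(\<lambda>((\<a>, T, u), f, q) \<in> Ar SP. \<lambda>x \<in> Ob \<a>. Ide C (FO u x)) =
        (\<lambda>a \<in> Ar SP. \<lambda>x \<in> Ob (?X (Src SP a)). Ide C (FO (?u (Src SP a)) x))"
      by (rule restrict_ext) auto
    then show ?thesis by (simp add: presentation_cocone_def cocone_def)
  qed
  moreover have "presentation_functor U k C = strict_psfunctor SP ?X ?\<phi>"
    by (simp add: presentation_functor_def)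
  ultimately show ?thesis using bicolimit by simp
qed

end
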